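(* Let $A$ be a (not necessarily bounded) normal operator in a complex Hilbert space $H$ and let $B\in B(H)$ be hyponormal. If $BA\subset AB$, then $$|A+B|\leq |A|+|B|.$$
   Context: $B(H)$ is the algebra of bounded everywhere defined linear operators on $H$. Operators are linear, not necessarily bounded, defined on a subspace $D(T)$ of $H$. $S\subset T$ means $D(S)\subset D(T)$ and $S=T$ on $D(S)$. Natural domains are used: $D(ST)=\{x\in D(T): Tx\in D(S)\}$, $D(S+T)=D(S)\cap D(T)$. A densely defined operator $T$ is normal if it is closed and $TT^*=T^*T$. A densely defined operator $T$ is hyponormal if $D(T)\subset D(T^* )$ and $\|T^*x\|\le\|Tx\|$ for all $x\in D(T)$. For a closed densely defined operator $T$, $|T|$ denotes the unique positive self-adjoint square root of $T^*T$. For positive self-adjoint operators $S,T$ (possibly unbounded), $T\le S$ means $D(S^{1/2})\subset D(T^{1/2})$ and $\|T^{1/2}x\|\le\|S^{1/2}x\|$ for all $x\in D(S^{1/2})$. *)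

theory Defs
  imports "HOL-Analysis.Analysis"
begin

section \<open>Complex Hilbert spaces\<close>

text \<open>
  The real inner product, and with it the norm and the topology, is tied to the sesquilinear
  one by its last axiom; hence \<open>cinner x x = (norm x)\<^sup>2\<close>. The form \<open>cinner\<close> is
  linear in its first argument and conjugate linear in its second.
\<close>

class complex_inner = real_inner +
  fixes scaleC :: "complex \<Rightarrow> 'a \<Rightarrow> 'a"  (infixr \<open>*\<^sub>C\<close> 75)
    and cinner :: "'a \<Rightarrow> 'a \<Rightarrow> complex"
  assumes scaleC_add_right: "c *\<^sub>C (x + y) = c *\<^sub>C x + c *\<^sub>C y"
    and scaleC_add_left: "(c + d) *\<^sub>C x = c *\<^sub>C x + d *\<^sub>C x"
    and scaleC_scaleC: "c *\<^sub>C d *\<^sub>C x = (c * d) *\<^sub>C x"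
    and scaleC_one: "1 *\<^sub>C x = x"
    and scaleC_of_real: "complex_of_real r *\<^sub>C x = r *\<^sub>R x"
    and cinner_commute: "cinner x y = cnj (cinner y x)"
    and cinner_add_left: "cinner (x + y) z = cinner x z + cinner y z"
    and cinner_scaleC_left: "cinner (c *\<^sub>C x) y = c * cinner x y"
    and inner_eq_Re_cinner: "inner x y = Re (cinner x y)"

class complex_hilbert = complex_inner + complete_space

global_interpretation complex_vector:
  vector_space "scaleC :: complex \<Rightarrow> 'a \<Rightarrow> 'a::complex_inner"
  by unfold_locales (simp_all add: scaleC_add_right scaleC_add_left scaleC_scaleC scaleC_one)

lemma cinner_self: "cinner x x = complex_of_real ((norm x)\<^sup>2)"
  for x :: "'a::complex_inner"
proof (rule complex_eqI)
  show "Re (cinner x x) = Re (complex_of_real ((norm x)\<^sup>2))"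
    by (simp add: power2_norm_eq_inner inner_eq_Re_cinner)
  have "Im (cinner x x) = - Im (cinner x x)"
    by (metis cinner_commute cnj.simps(2))
  then show "Im (cinner x x) = Im (complex_of_real ((norm x)\<^sup>2))"
    by simp
qed

instantiation complex :: complex_hilbert
begin

definition scaleC_complex :: "complex \<Rightarrow> complex \<Rightarrow> complex"
  where "scaleC_complex c x = c * x"

definition cinner_complex :: "complex \<Rightarrow> complex \<Rightarrow> complex"
  where "cinner_complex x y = x * cnj y"

instance
  by standard
    (simp_all add: scaleC_complex_def cinner_complex_def algebra_simps inner_complex_def
      scaleR_conv_of_real)

end


section \<open>Unbounded operators\<close>

text \<open>
  An operator is a partial map: \<open>dom T\<close> is its domain and \<open>the (T x)\<close> its value at
  \<open>x \<in> dom T\<close>, so that equality of operators includes equality of domains. The product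
  \<open>S T\<close> on its natural domain is \<open>S \<circ>\<^sub>m T\<close>, the inclusion of \<open>S\<close> in \<open>T\<close> is
  \<open>S \<subseteq>\<^sub>m T\<close>, and the graph of \<open>T\<close> is \<open>Map.graph T\<close>.
\<close>

type_synonym 'a operator = "'a \<rightharpoonup> 'a"

lemma dom_operator_comp: "dom (S \<circ>\<^sub>m T) = {x \<in> dom T. the (T x) \<in> dom S}"
  by (auto simp: map_comp_def split: option.splits)

definition linear_operator :: "'a::complex_inner operator \<Rightarrow> bool"
  where "linear_operator T \<longleftrightarrow>
    complex_vector.subspace (dom T) \<and>
    (\<forall>x\<in>dom T. \<forall>y\<in>dom T. the (T (x + y)) = the (T x) + the (T y)) \<and>
    (\<forall>c. \<forall>x\<in>dom T. the (T (c *\<^sub>C x)) = c *\<^sub>C the (T x))"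

definition operator_add :: "'a::complex_inner operator \<Rightarrow> 'a operator \<Rightarrow> 'a operator"
  where "operator_add S T =
    (\<lambda>x. if x \<in> dom S \<inter> dom T then Some (the (S x) + the (T x)) else None)"

definition bounded_operator :: "'a::complex_inner operator \<Rightarrow> bool"
  where "bounded_operator T \<longleftrightarrow>
    linear_operator T \<and> dom T = UNIV \<and> (\<exists>K. \<forall>x. norm (the (T x)) \<le> K * norm x)"

definition densely_defined :: "'a::complex_inner operator \<Rightarrow> bool"
  where "densely_defined T \<longleftrightarrow> linear_operator T \<and> closure (dom T) = UNIV"

definition closed_operator :: "'a::complex_inner operator \<Rightarrow> bool"
  where "closed_operator T \<longleftrightarrow> linear_operator T \<and> closed (Map.graph T)"

text \<open>The vector \<open>z\<close> below is unique when \<open>T\<close> is densely defined; otherwise the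
  adjoint carries no meaning.\<close>

definition operator_adjoint :: "'a::complex_inner operator \<Rightarrow> 'a operator"
  where "operator_adjoint T =
    (\<lambda>y. if \<exists>z. \<forall>x\<in>dom T. cinner (the (T x)) y = cinner x z
         then Some (THE z. \<forall>x\<in>dom T. cinner (the (T x)) y = cinner x z)
         else None)"

definition normal_operator :: "'a::complex_inner operator \<Rightarrow> bool"
  where "normal_operator T \<longleftrightarrow>
    densely_defined T \<and> closed_operator T \<and>
    T \<circ>\<^sub>m operator_adjoint T = operator_adjoint T \<circ>\<^sub>m T"

definition hyponormal_operator :: "'a::complex_inner operator \<Rightarrow> bool"
  where "hyponormal_operator T \<longleftrightarrow>
    densely_defined T \<and> dom T \<subseteq> dom (operator_adjoint T) \<and>
    (\<forall>x\<in>dom T. norm (the (operator_adjoint T x)) \<le> norm (the (T x)))"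

definition positive_selfadjoint :: "'a::complex_inner operator \<Rightarrow> bool"
  where "positive_selfadjoint T \<longleftrightarrow>
    densely_defined T \<and> operator_adjoint T = T \<and>
    (\<forall>x\<in>dom T. cinner (the (T x)) x \<in> \<real>\<^sub>\<ge>\<^sub>0)"

text \<open>Meaningful for a positive self-adjoint \<open>T\<close>, where the square root exists and is unique.\<close>

definition operator_sqrt :: "'a::complex_inner operator \<Rightarrow> 'a operator"
  where "operator_sqrt T = (THE S. positive_selfadjoint S \<and> S \<circ>\<^sub>m S = T)"

text \<open>Meaningful for a closed densely defined \<open>T\<close>.\<close>

definition operator_abs :: "'a::complex_inner operator \<Rightarrow> 'a operator"
  where "operator_abs T = operator_sqrt (operator_adjoint T \<circ>\<^sub>m T)"

text \<open>The order is a relation between positive self-adjoint operators only, so both sides are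
  required to be such.\<close>

definition operator_le :: "'a::complex_inner operator \<Rightarrow> 'a operator \<Rightarrow> bool"
  where "operator_le T S \<longleftrightarrow>
    positive_selfadjoint T \<and> positive_selfadjoint S \<and>
    dom (operator_sqrt S) \<subseteq> dom (operator_sqrt T) \<and>
    (\<forall>x\<in>dom (operator_sqrt S). norm (the (operator_sqrt T x)) \<le> norm (the (operator_sqrt S x)))"

end

theory Submission
  imports Defs "HOL-Complex_Analysis.Cauchy_Integral_Formula"
begin

text \<open>
  Let \<open>x\<close> belong to the domain of \<open>A\<close>. The squares of \<open>\<parallel>(A + B) x\<parallel>\<close> and \<open>\<parallel>(|A| + |B|) x\<parallel>\<close> both contain
  \<open>\<parallel>A x\<parallel>\<^sup>2 + \<parallel>B x\<parallel>\<^sup>2\<close>, so the first norm is at most the second as soon as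
  \<open>Re \<langle>A x, B x\<rangle> \<le> \<langle>|A| x, |B| x\<rangle>\<close>. The passage from the inequality of norms to the inequality of the
  positive operators \<open>|A + B|\<close> and \<open>|A| + |B|\<close> is the monotonicity of the square root, in the form of
  \<open>operator_le_of_norm_le\<close>.

  For the inequality of the cross terms, Fuglede's theorem \<open>fuglede\<close> shows that \<open>B\<close> commutes with \<open>A\<^sup>*\<close>
  as well. Hence \<open>B\<close> and \<open>B\<^sup>*\<close> commute with the bounded operators \<open>P = (1 + A\<^sup>* A)\<^bsup>-1/2\<^esup>\<close> and \<open>Q = |A| P\<close>,
  and \<open>B\<close> commutes with \<open>Z = A P\<close> and \<open>Z' = A\<^sup>* P\<close>. Writing \<open>x = P y\<close> turns the two sides into the
  quadratic forms at \<open>y\<close> of the real part of \<open>T = P B\<^sup>* Z\<close> and of \<open>S = P |B| Q\<close>. The operator \<open>S\<close> is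
  positive, being a product of commuting positive operators. Since \<open>\<parallel>Z v\<parallel> = \<parallel>Z' v\<parallel> = \<parallel>Q v\<parallel>\<close> by normality and
  \<open>\<parallel>B\<^sup>* v\<parallel> \<le> \<parallel>B v\<parallel> = \<parallel>|B| v\<parallel>\<close> by hyponormality, \<open>\<parallel>T v\<parallel>\<close> and \<open>\<parallel>T\<^sup>* v\<parallel>\<close> are at most \<open>\<parallel>S v\<parallel>\<close>. The same then
  holds for the real part \<open>M\<close> of \<open>T\<close>, and for a symmetric \<open>M\<close> the estimate \<open>\<parallel>M v\<parallel> \<le> \<parallel>S v\<parallel>\<close> implies
  \<open>M \<le> S\<close>; this is again monotonicity of the square root, proved in \<open>form_le_of_norm_le\<close> by Reid's
  inequality.

  The spectral theorem is replaced by the following devices. Roots of bounded positive operators are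
  limits of polynomials (\<open>positive_root_exists\<close>). An unbounded positive self-adjoint operator is
  the quotient \<open>Q\<^sup>2 P\<^bsup>-2\<^esup>\<close> of commuting bounded ones with \<open>P\<^sup>2 + Q\<^sup>2 = 1\<close>, and its root is \<open>Q P\<inverse>\<close>
  (\<open>circle_pair_exists\<close>, \<open>operator_sqrt_eq\<close>). Spectral projections, needed to reduce Fuglede's theorem to
  bounded operators, are projections to kernels (\<open>spectral_cutoff\<close>). Complex scalars are essential only
  for Fuglede's theorem; all other estimates concern the real part of the inner product.
\<close>

instance complex_hilbert \<subseteq> banach ..

section \<open>Orthogonal projection\<close>

text \<open>By the parallelogram law, a sequence that minimises the distance to \<open>x\<close> is a Cauchy sequence.\<close>

lemma orthogonal_projection_exists:
  fixes M :: "'a::{real_inner,banach} set"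
  assumes cl: "closed M" and sub: "subspace M"
  obtains m where "m \<in> M" "\<And>y. y \<in> M \<Longrightarrow> inner (x - m) y = 0"
proof -
  define D where "D = (\<lambda>y. (norm (x - y))\<^sup>2) ` M"
  define d where "d = Inf D"
  have ne: "D \<noteq> {}" unfolding D_def using subspace_0[OF sub] by blast
  have bdd: "bdd_below D" unfolding D_def by (rule bdd_belowI[of _ 0]) auto
  have d_le: "d \<le> (norm (x - y))\<^sup>2" if "y \<in> M" for y
    unfolding d_def using that bdd by (auto intro!: cInf_lower simp: D_def)
  have "\<exists>y\<in>M. (norm (x - y))\<^sup>2 < d + 1 / real (Suc n)" for n
  proof -
    have "\<exists>z\<in>D. z < d + 1 / real (Suc n)"
      unfolding d_def by (rule cInf_lessD[OF ne, THEN bexE]) auto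
    then show ?thesis by (auto simp: D_def)
  qed
  then obtain Y where YM: "\<And>n. Y n \<in> M"
    and Yd: "\<And>n. (norm (x - Y n))\<^sup>2 < d + 1 / real (Suc n)"
    by metis
  have est: "(norm (Y i - Y j))\<^sup>2 \<le> 2 / real (Suc i) + 2 / real (Suc j)" for i j
  proof -
    have "(1/2) *\<^sub>R (Y i + Y j) \<in> M"
      by (intro subspace_scale[OF sub] subspace_add[OF sub] YM)
    then have "4 * d \<le> 4 * (norm (x - (1/2) *\<^sub>R (Y i + Y j)))\<^sup>2"
      using d_le by simp
    also have "\<dots> = 2 * (norm (x - Y i))\<^sup>2 + 2 * (norm (x - Y j))\<^sup>2 - (norm (Y i - Y j))\<^sup>2"
      by (simp add: power2_norm_eq_inner inner_diff_left inner_diff_right inner_add_left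
          inner_add_right inner_commute algebra_simps)
    finally show ?thesis using Yd[of i] Yd[of j] by linarith
  qed
  have "Cauchy Y"
  proof (rule metric_CauchyI)
    fix e :: real assume "0 < e"
    then have "0 < e\<^sup>2 / 4" by simp
    then obtain N where N: "inverse (real (Suc N)) < e\<^sup>2 / 4"
      using reals_Archimedean by blast
    have "dist (Y i) (Y j) < e" if "i \<ge> N" "j \<ge> N" for i j
    proof -
      have "1 / real (Suc i) \<le> inverse (real (Suc N))" "1 / real (Suc j) \<le> inverse (real (Suc N))"
        using that by (auto simp: field_simps)
      then have "(norm (Y i - Y j))\<^sup>2 < e\<^sup>2" using est[of i j] N by simp
      then show ?thesis using \<open>0 < e\<close> by (simp add: dist_norm power_less_imp_less_base)
    qed
    then show "\<exists>N. \<forall>i\<ge>N. \<forall>j\<ge>N. dist (Y i) (Y j) < e" by blast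
  qed
  then obtain m where lim: "Y \<longlonglongrightarrow> m" using Cauchy_convergent convergent_def by blast
  have mM: "m \<in> M" using closed_sequentially[OF cl _ lim] YM by blast
  have lim1: "(\<lambda>n. d + 1 / real (Suc n)) \<longlonglongrightarrow> d"
    using tendsto_add[OF tendsto_const LIMSEQ_inverse_real_of_nat, of d]
    by (simp add: inverse_eq_divide)
  have lim2: "(\<lambda>n. (norm (x - Y n))\<^sup>2) \<longlonglongrightarrow> (norm (x - m))\<^sup>2"
    by (intro tendsto_intros lim)
  have md: "(norm (x - m))\<^sup>2 \<le> d"
    by (rule LIMSEQ_le[OF lim2 lim1]) (use Yd less_imp_le in blast)
  have "inner (x - m) y = 0" if y: "y \<in> M" for y
  proof (cases "y = 0")
    case False
    define t where "t = inner (x - m) y / inner y y"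
    have pos: "inner y y > 0" using False by simp
    have "m + t *\<^sub>R y \<in> M"
      by (intro subspace_scale[OF sub] subspace_add[OF sub] mM y)
    from order_trans[OF md d_le[OF this]]
    have "(norm (x - m))\<^sup>2 \<le> (norm (x - (m + t *\<^sub>R y)))\<^sup>2" .
    also have "\<dots> = (norm (x - m))\<^sup>2 - 2 * t * inner (x - m) y + t\<^sup>2 * inner y y"
      unfolding power2_norm_eq_inner
      by (simp add: inner_diff_left inner_diff_right inner_add_left inner_add_right
          inner_commute algebra_simps power2_eq_square)
    also have "\<dots> = (norm (x - m))\<^sup>2 - (inner (x - m) y)\<^sup>2 / inner y y"
      using pos by (simp add: t_def power2_eq_square field_simps)
    finally have "(inner (x - m) y)\<^sup>2 / inner y y \<le> 0" by simp
    then show ?thesis using pos by (simp add: divide_le_0_iff)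
  qed simp
  with mM show ?thesis by (rule that)
qed

lemma subspace_closure:
  fixes M :: "'a::real_normed_vector set"
  assumes sub: "subspace M"
  shows "subspace (closure M)"
proof (unfold subspace_def, intro conjI ballI allI)
  show "0 \<in> closure M" using subspace_0[OF sub] closure_subset by blast
next
  fix x y assume "x \<in> closure M" "y \<in> closure M"
  then obtain f g where "\<And>n. f n \<in> M" "f \<longlonglongrightarrow> x" "\<And>n. g n \<in> M" "g \<longlonglongrightarrow> y"
    unfolding closure_sequential by blast
  then show "x + y \<in> closure M" unfolding closure_sequential
    by (intro exI[of _ "\<lambda>n. f n + g n"]) (auto intro: tendsto_add subspace_add[OF sub])
next
  fix c x assume "x \<in> closure M"
  then obtain f where "\<And>n. f n \<in> M" "f \<longlonglongrightarrow> x" unfolding closure_sequential by blast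
  then show "c *\<^sub>R x \<in> closure M" unfolding closure_sequential
    by (intro exI[of _ "\<lambda>n. c *\<^sub>R f n"]) (auto intro: tendsto_scaleR subspace_scale[OF sub])
qed

text \<open>The projection of a vector to the closure of \<open>M\<close> leaves a remainder orthogonal to \<open>M\<close>.\<close>

lemma dense_subspaceI:
  fixes M :: "'a::{real_inner,banach} set"
  assumes sub: "subspace M" and orth: "\<And>w. (\<And>y. y \<in> M \<Longrightarrow> inner w y = 0) \<Longrightarrow> w = 0"
  shows "closure M = UNIV"
proof -
  have "x \<in> closure M" for x
  proof -
    obtain m where m: "m \<in> closure M" "\<And>y. y \<in> closure M \<Longrightarrow> inner (x - m) y = 0"
      using orthogonal_projection_exists[OF closed_closure subspace_closure[OF sub]] by blast
    have "x - m = 0" using m(2) closure_subset by (intro orth) blast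
    with m(1) show ?thesis by simp
  qed
  then show ?thesis by blast
qed

lemma orthogonal_to_dense_eq_0:
  fixes w :: "'a::real_inner"
  assumes "closure M = UNIV" and "\<And>y. y \<in> M \<Longrightarrow> inner w y = 0"
  shows "w = 0"
proof -
  have "closure M \<subseteq> {y. inner w y = 0}"
    by (rule closure_minimal) (use assms(2) in \<open>auto intro!: closed_Collect_eq continuous_intros\<close>)
  with assms(1) have "inner w w = 0" by blast
  then show ?thesis by simp
qed

text \<open>The orthogonal complement of the kernel is a line, spanned by \<open>x - m\<close> where \<open>m\<close> is the projection
  to the kernel of a vector \<open>x\<close> outside it.\<close>

lemma riesz_representation:
  fixes f :: "'a::{real_inner,banach} \<Rightarrow> real"
  assumes f: "bounded_linear f"
  obtains z where "\<And>x. f x = inner x z"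
proof (cases "\<forall>x. f x = 0")
  case True
  then show ?thesis using that[of 0] by simp
next
  case False
  interpret f: bounded_linear f by (rule f)
  from False obtain x where x: "f x \<noteq> 0" by blast
  have "closed {x. f x = 0}"
    by (intro closed_Collect_eq continuous_intros f.continuous_on)
  moreover have "subspace {x. f x = 0}"
    by (auto simp: subspace_def f.add f.zero f.scaleR)
  ultimately obtain m where "m \<in> {x. f x = 0}"
    and "\<And>y. y \<in> {x. f x = 0} \<Longrightarrow> inner (x - m) y = 0"
    by (rule orthogonal_projection_exists[where x = x]) (rule that; assumption)
  then have m: "f m = 0" "\<And>y. f y = 0 \<Longrightarrow> inner (x - m) y = 0" by simp_all
  define w where "w = x - m"
  have fw: "f w = f x" by (simp add: w_def f.diff m)
  then have w0: "w \<noteq> 0" using x f.zero by auto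
  have "f y = inner y ((f w / inner w w) *\<^sub>R w)" for y
  proof -
    have "f (y - (f y / f w) *\<^sub>R w) = 0"
      using fw x by (simp add: f.diff f.scaleR)
    then have "inner w (y - (f y / f w) *\<^sub>R w) = 0" unfolding w_def by (rule m(2))
    then have "inner y w = (f y / f w) * inner w w"
      by (simp add: inner_diff_right inner_commute)
    then show ?thesis using w0 fw x by simp
  qed
  then show ?thesis by (rule that)
qed

lemma bounded_adjoint_exists:
  fixes T :: "'a::{real_inner,banach} \<Rightarrow> 'a"
  assumes T: "bounded_linear T"
  obtains T' where "\<And>x y. inner (T x) y = inner x (T' y)"
proof -
  have "\<exists>z. \<forall>x. inner (T x) y = inner x z" for y
    by (rule riesz_representation[OF bounded_linear_compose[OF bounded_linear_inner_left T], of y])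
      blast
  then show ?thesis using that by metis
qed

section \<open>Positive bounded operators and their square roots\<close>

definition positive_map :: "('a::real_inner \<Rightarrow> 'a) \<Rightarrow> bool"
  where "positive_map T \<longleftrightarrow> bounded_linear T \<and>
    (\<forall>x y. inner (T x) y = inner x (T y)) \<and> (\<forall>x. 0 \<le> inner (T x) x)"

lemma positive_mapD:
  assumes "positive_map T"
  shows "bounded_linear T" "inner (T x) y = inner x (T y)" "0 \<le> inner (T x) x"
  using assms by (auto simp: positive_map_def)

text \<open>The polynomial arises as \<open>\<langle>T (x + t y), x + t y\<rangle>\<close>; the conclusion is that its discriminant is
  not positive. The case \<open>c < 0\<close> is excluded by a large value of \<open>t\<close>.\<close>

lemma positive_form_Cauchy_Schwarz:
  fixes a b c :: real
  assumes "\<And>t. 0 \<le> a + 2 * t * b + t\<^sup>2 * c"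
  shows "b\<^sup>2 \<le> a * c"
proof (cases "c = 0")
  case True
  show ?thesis
  proof (rule ccontr)
    assume "\<not> ?thesis"
    then have "b \<noteq> 0" using True by auto
    with assms[of "- (a + 1) / (2 * b)"] True show False by (simp add: field_simps)
  qed
next
  case False
  have "0 \<le> c"
  proof (rule ccontr)
    assume "\<not> 0 \<le> c"
    then have c: "c < 0" by simp
    define t where "t = (\<bar>a\<bar> + 2 * \<bar>b\<bar>) / - c + 1"
    have t1: "t \<ge> 1" using c by (simp add: t_def divide_nonneg_neg zero_le_divide_iff)
    have tc: "t * c = - (\<bar>a\<bar> + 2 * \<bar>b\<bar>) + c" using c by (simp add: t_def field_simps)
    have "a + 2 * t * b + t\<^sup>2 * c = a + t * (2 * b + t * c)"
      by (simp add: power2_eq_square algebra_simps)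
    also have "\<dots> = a + t * (2 * b - \<bar>a\<bar> - 2 * \<bar>b\<bar> + c)" by (simp add: tc)
    also have "\<dots> \<le> a + 1 * (2 * b - \<bar>a\<bar> - 2 * \<bar>b\<bar> + c)"
      using t1 c by (intro add_left_mono mult_right_mono_neg) auto
    also have "\<dots> < 0" using c by simp
    finally show False using assms[of t] by simp
  qed
  with False have c: "c > 0" by simp
  have "0 \<le> a - b\<^sup>2 / c" using assms[of "- b / c"] c
    by (simp add: field_simps power2_eq_square)
  then show ?thesis using c by (simp add: field_simps)
qed

lemma positive_map_Cauchy_Schwarz:
  assumes "positive_map T"
  shows "(inner (T x) y)\<^sup>2 \<le> inner (T x) x * inner (T y) y"
proof (rule positive_form_Cauchy_Schwarz)
  fix t :: real
  interpret T: bounded_linear T by (rule positive_mapD[OF assms])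
  have "0 \<le> inner (T (x + t *\<^sub>R y)) (x + t *\<^sub>R y)" by (rule positive_mapD[OF assms])
  also have "\<dots> = inner (T x) x + 2 * t * inner (T x) y + t\<^sup>2 * inner (T y) y"
    using positive_mapD(2)[OF assms, of x y]
    by (simp add: T.add T.scaleR inner_add_left inner_add_right algebra_simps power2_eq_square
        inner_commute)
  finally show "0 \<le> inner (T x) x + 2 * t * inner (T x) y + t\<^sup>2 * inner (T y) y" .
qed

text \<open>Take \<open>y = T x\<close> in the Cauchy-Schwarz inequality for the form \<open>\<langle>T \<sqdot>, \<sqdot>\<rangle>\<close>.\<close>

lemma positive_map_norm_le:
  assumes T: "positive_map T" and le: "\<And>x. inner (T x) x \<le> c * (norm x)\<^sup>2"
  shows "(norm (T x))\<^sup>2 \<le> c * inner (T x) x"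
proof (cases "T x = 0")
  case False
  have "((norm (T x))\<^sup>2)\<^sup>2 \<le> inner (T x) x * inner (T (T x)) (T x)"
    using positive_map_Cauchy_Schwarz[OF T, of x "T x"] by (simp add: power2_norm_eq_inner)
  also have "\<dots> \<le> inner (T x) x * (c * (norm (T x))\<^sup>2)"
    by (intro mult_left_mono le positive_mapD[OF T])
  finally have "(norm (T x))\<^sup>2 * (norm (T x))\<^sup>2 \<le> (c * inner (T x) x) * (norm (T x))\<^sup>2"
    by (simp only: power2_eq_square ac_simps)
  then show ?thesis by (rule mult_right_le_imp_le) (use False in simp)
qed (use positive_mapD[OF T] in auto)

lemma positive_map_eq_0:
  assumes T: "positive_map T" and "inner (T x) x = 0"
  shows "T x = 0"
proof -
  have "(inner (T x) (T x))\<^sup>2 \<le> inner (T x) x * inner (T (T x)) (T x)"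
    by (rule positive_map_Cauchy_Schwarz[OF T])
  then show ?thesis using assms(2) by simp
qed

text \<open>If \<open>Y\<close> solves \<open>2 Y = X + Y\<^sup>2\<close>, then \<open>1 - Y\<close> is a square root of \<open>1 - X\<close>. The iteration of this
  equation from \<open>0\<close> yields polynomials in \<open>X\<close> with coefficients that are not negative.\<close>

fun root_approx :: "('a::real_vector \<Rightarrow> 'a) \<Rightarrow> nat \<Rightarrow> 'a \<Rightarrow> 'a"
  where "root_approx X 0 x = 0"
  | "root_approx X (Suc n) x = (1/2) *\<^sub>R (X x + root_approx X n (root_approx X n x))"

fun root_bound :: "nat \<Rightarrow> real"
  where "root_bound 0 = 0"
  | "root_bound (Suc n) = (1 + (root_bound n)\<^sup>2) / 2"

lemma root_bound_mono: "root_bound n \<le> root_bound (Suc n)"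
proof -
  have "0 \<le> (1 - root_bound n)\<^sup>2" by simp
  then show ?thesis by (simp add: power2_eq_square algebra_simps)
qed

lemma root_bound_range: "0 \<le> root_bound n" "root_bound n \<le> 1"
proof -
  show nn: "0 \<le> root_bound n" for n by (cases n) auto
  show "root_bound n \<le> 1"
    by (induction n) (auto simp: nn power_le_one)
qed

lemma root_approx_linear:
  assumes "linear X"
  shows "linear (root_approx X n)"
proof (induction n)
  case 0
  have "root_approx X 0 = (\<lambda>x. 0)" by auto
  then show ?case by (simp add: linear_zero)
next
  case (Suc n)
  interpret X: linear X by fact
  interpret Y: linear "root_approx X n" by fact
  show ?case
    by (rule linearI) (simp_all add: X.add X.scaleR Y.add Y.scaleR algebra_simps)
qed

lemma root_approx_commute:
  assumes X: "linear X" and Z: "linear Z" and "\<And>x. Z (X x) = X (Z x)"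
  shows "Z (root_approx X n x) = root_approx X n (Z x)"
proof (induction n arbitrary: x)
  case 0
  then show ?case by (simp add: linear_0[OF Z])
next
  case (Suc n)
  then show ?case using assms(3) by (simp add: linear_add[OF Z] linear_scale[OF Z])
qed

lemma root_approx_commute_self:
  assumes "linear X"
  shows "root_approx X m (root_approx X n x) = root_approx X n (root_approx X m x)"
  by (rule root_approx_commute[OF assms root_approx_linear[OF assms]])
    (rule root_approx_commute[OF assms assms refl, symmetric])

lemma root_approx_norm_le:
  assumes X: "\<And>x. norm (X x) \<le> norm x"
  shows "norm (root_approx X n x) \<le> root_bound n * norm x"
proof (induction n arbitrary: x)
  case (Suc n)
  have "norm (root_approx X n (root_approx X n x)) \<le> root_bound n * (root_bound n * norm x)"
    by (rule order_trans[OF Suc mult_left_mono[OF Suc root_bound_range(1)]])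
  then have "norm (X x + root_approx X n (root_approx X n x)) \<le> norm x + (root_bound n)\<^sup>2 * norm x"
    using X[of x] by (intro norm_triangle_le add_mono) (auto simp: power2_eq_square mult.assoc)
  then have "norm (X x + root_approx X n (root_approx X n x)) / 2
      \<le> (norm x + (root_bound n)\<^sup>2 * norm x) / 2" by simp
  also have "\<dots> = root_bound (Suc n) * norm x" by (simp add: field_simps)
  finally show ?case by (simp del: root_bound.simps)
qed simp

text \<open>The increments of the operator sequence are products of earlier increments with earlier
  sums, so that they are dominated by those of the scalar sequence, which belongs to
  \<open>X = 1\<close>.\<close>

lemma root_approx_increment:
  assumes X: "\<And>x. norm (X x) \<le> norm x" and lin: "linear X"
  shows "norm (root_approx X (Suc n) x - root_approx X n x)
    \<le> (root_bound (Suc n) - root_bound n) * norm x"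
proof (induction n arbitrary: x)
  case 0
  then show ?case using X[of x] by simp
next
  case (Suc n)
  let ?Y = "root_approx X"
  interpret Y0: linear "?Y n" by (rule root_approx_linear[OF lin])
  interpret Y1: linear "?Y (Suc n)" by (rule root_approx_linear[OF lin])
  define z where "z = ?Y (Suc n) x + ?Y n x"
  have "norm z \<le> root_bound (Suc n) * norm x + root_bound n * norm x"
    unfolding z_def by (intro norm_triangle_le add_mono root_approx_norm_le X)
  then have z: "norm z \<le> (root_bound (Suc n) + root_bound n) * norm x"
    by (simp only: distrib_right)
  have "?Y (Suc (Suc n)) x - ?Y (Suc n) x
      = (1/2) *\<^sub>R (?Y (Suc n) (?Y (Suc n) x) - ?Y n (?Y n x))"
    by (subst (1 2) root_approx.simps(2)) (simp add: algebra_simps del: root_approx.simps)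
  also have "\<dots> = (1/2) *\<^sub>R (?Y (Suc n) z - ?Y n z)"
    using root_approx_commute_self[OF lin, of "Suc n" n x]
    by (simp add: z_def Y0.add Y1.add del: root_approx.simps)
  finally have "norm (?Y (Suc (Suc n)) x - ?Y (Suc n) x) = norm (?Y (Suc n) z - ?Y n z) / 2"
    by (simp del: root_approx.simps)
  also have "\<dots> \<le> (root_bound (Suc n) - root_bound n) * norm z / 2"
    using Suc[of z] by simp
  also have "\<dots> \<le> (root_bound (Suc n) - root_bound n)
      * ((root_bound (Suc n) + root_bound n) * norm x) / 2"
    by (intro divide_right_mono mult_left_mono z) (use root_bound_mono[of n] in auto)
  also have "\<dots> = (root_bound (Suc (Suc n)) - root_bound (Suc n)) * norm x"
    by (simp add: power2_eq_square field_simps)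
  finally show ?case .
qed

lemma root_approx_Cauchy:
  fixes X :: "'a::real_normed_vector \<Rightarrow> 'a"
  assumes X: "\<And>x. norm (X x) \<le> norm x" and lin: "linear X"
  shows "Cauchy (\<lambda>n. root_approx X n x)"
proof -
  have step: "norm (root_approx X (n + k) x - root_approx X n x)
      \<le> (root_bound (n + k) - root_bound n) * norm x" for n k
  proof (induction k)
    case (Suc k)
    have "norm (root_approx X (Suc (n + k)) x - root_approx X n x)
      \<le> norm (root_approx X (Suc (n + k)) x - root_approx X (n + k) x)
        + norm (root_approx X (n + k) x - root_approx X n x)"
      by (rule norm_diff_triangle_le) auto
    also have "\<dots> \<le> (root_bound (Suc (n + k)) - root_bound (n + k)) * norm x
        + (root_bound (n + k) - root_bound n) * norm x"
      by (intro add_mono Suc root_approx_increment X lin)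
    finally show ?case by (simp only: add_Suc_right) (simp add: algebra_simps)
  qed simp
  have "convergent root_bound"
    by (rule Bseq_monoseq_convergent[OF BseqI'[of _ 1]])
      (auto simp: root_bound_range monoseq_Suc root_bound_mono simp del: root_bound.simps)
  then have cau: "Cauchy (\<lambda>n. root_bound n * norm x)"
    by (intro convergent_Cauchy convergent_mult convergent_const)
  show ?thesis
  proof (rule metric_CauchyI, goal_cases)
    case (1 e)
    from metric_CauchyD[OF cau 1] obtain N where
      N: "\<And>i j. i \<ge> N \<Longrightarrow> j \<ge> N \<Longrightarrow> dist (root_bound i * norm x) (root_bound j * norm x) < e" by blast
    have le: "dist (root_approx X i x) (root_approx X j x) < e" if "i \<ge> N" "j \<ge> i" for i j
    proof -
      have "norm (root_approx X j x - root_approx X i x) \<le> (root_bound j - root_bound i) * norm x"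
        using step[of i "j - i"] that by simp
      also have "\<dots> \<le> dist (root_bound i * norm x) (root_bound j * norm x)"
        by (simp add: dist_real_def algebra_simps)
      also have "\<dots> < e" using N that by auto
      finally show ?thesis by (simp add: dist_norm norm_minus_commute)
    qed
    then have "dist (root_approx X i x) (root_approx X j x) < e" if "i \<ge> N" "j \<ge> N" for i j
      using le[of i j] le[of j i] that by (cases "i \<le> j") (auto simp: dist_commute)
    then show ?case by blast
  qed
qed


text \<open>With \<open>X = 1 - T / k\<close>, both \<open>X\<close> and \<open>1 - X\<close> are positive.\<close>

lemma contraction_of_positive:
  assumes T: "positive_map T" and k: "0 < k" and Tk: "\<And>x. norm (T x) \<le> k * norm x"
  shows "norm (x - (1/k) *\<^sub>R T x) \<le> norm x"
proof -
  interpret T: bounded_linear T by (rule positive_mapD[OF T])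
  define X where "X = (\<lambda>x. x - (1/k) *\<^sub>R T x)"
  have nn: "0 \<le> inner (X x) x" for x
  proof -
    have "inner (T x) x \<le> k * norm x * norm x"
      by (rule order_trans[OF norm_cauchy_schwarz mult_right_mono[OF Tk]]) simp
    then show ?thesis using k
      by (simp add: X_def inner_diff_left dot_square_norm power2_eq_square field_simps)
  qed
  have bl: "bounded_linear X"
    unfolding X_def by (intro bounded_linear_sub bounded_linear_ident
        bounded_linear_const_scaleR T.bounded_linear_axioms)
  have "positive_map X"
    using nn bl positive_mapD(2)[OF T]
    by (auto simp: positive_map_def X_def inner_diff_left inner_diff_right)
  moreover have le: "inner (X x) x \<le> 1 * (norm x)\<^sup>2" for x
    using positive_mapD(3)[OF T, of x] k by (simp add: X_def inner_diff_left dot_square_norm)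
  ultimately have "(norm (X x))\<^sup>2 \<le> 1 * inner (X x) x" by (rule positive_map_norm_le)
  also have "\<dots> \<le> (norm x)\<^sup>2" using le[of x] by simp
  finally show ?thesis unfolding X_def by (rule power2_le_imp_le) simp
qed

text \<open>The last property says that the root is a limit of polynomials in \<open>T\<close> in a form that can
  be applied to graphs: if a closed operator, bounded or not, commutes with \<open>T\<close>, then its graph
  is mapped into itself by \<open>T \<times> T\<close>, and therefore it commutes with the root.\<close>

lemma positive_root_exists:
  fixes T :: "'a::{real_inner,banach} \<Rightarrow> 'a"
  assumes T: "positive_map T"
  shows "\<exists>S. positive_map S \<and> (\<forall>x. S (S x) = T x) \<and>
    (\<forall>M. closed M \<longrightarrow> subspace M \<longrightarrow> (\<forall>(x, y)\<in>M. (T x, T y) \<in> M) \<longrightarrow> (\<forall>(x, y)\<in>M. (S x, S y) \<in> M))"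
proof -
  interpret T: bounded_linear T by (rule positive_mapD[OF T])
  obtain k where k: "0 < k" and "\<And>x. norm (T x) \<le> norm x * k" using T.pos_bounded by blast
  then have Tk: "\<And>x. norm (T x) \<le> k * norm x" by (simp add: mult.commute)
  define X where "X = (\<lambda>x. x - (1/k) *\<^sub>R T x)"
  have X: "norm (X x) \<le> norm x" for x
    unfolding X_def by (rule contraction_of_positive[OF T k Tk])
  have lin: "linear X"
    unfolding X_def by (rule linearI) (simp_all add: T.add T.scaleR algebra_simps)
  let ?Y = "root_approx X"
  have Ylin: "linear (?Y n)" for n by (rule root_approx_linear[OF lin])
  have Yle: "norm (?Y n x) \<le> norm x" for n x
    using root_approx_norm_le[of X n x, OF X] mult_right_mono[OF root_bound_range(2)[of n], of "norm x"] by simp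
  define L where "L = (\<lambda>x. lim (\<lambda>n. ?Y n x))"
  have lim: "(\<lambda>n. ?Y n x) \<longlonglongrightarrow> L x" for x
    unfolding L_def using root_approx_Cauchy[OF X lin]
    by (simp add: Cauchy_convergent_iff convergent_LIMSEQ_iff)
  have Llin: "linear L"
  proof (rule linearI)
    show "L (x + y) = L x + L y" for x y
      using lim[of "x + y"] tendsto_add[OF lim[of x] lim[of y]]
      by (simp add: linear_add[OF Ylin] LIMSEQ_unique)
    show "L (r *\<^sub>R x) = r *\<^sub>R L x" for r x
      using lim[of "r *\<^sub>R x"] tendsto_scaleR[OF tendsto_const lim[of x]]
      by (simp add: linear_scale[OF Ylin] LIMSEQ_unique)
  qed
  have Lle: "norm (L x) \<le> norm x" for x
    by (rule LIMSEQ_le_const2[OF tendsto_norm[OF lim]]) (use Yle in auto)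
  have Lbl: "bounded_linear L"
    using Llin Lle by (intro bounded_linear_intro[where K = 1]) (auto simp: linear_add linear_scale)
  have Ysym: "inner (?Y n x) y = inner x (?Y n y)" for n x y
  proof (induction n arbitrary: x y)
    case (Suc n)
    have "inner (X x) y = inner x (X y)"
      using positive_mapD(2)[OF T] by (simp add: X_def inner_diff_left inner_diff_right)
    then show ?case using Suc by (simp add: inner_add_left inner_add_right)
  qed simp
  have Lsym: "inner (L x) y = inner x (L y)" for x y
    by (rule LIMSEQ_unique[OF tendsto_inner[OF lim tendsto_const]])
      (simp add: Ysym tendsto_inner[OF tendsto_const lim])
  have YY: "(\<lambda>n. ?Y n (?Y n x)) \<longlonglongrightarrow> L (L x)" for x
  proof -
    have "(\<lambda>n. ?Y n (?Y n x - L x)) \<longlonglongrightarrow> 0"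
      by (rule tendsto_norm_zero_cancel, rule tendsto_sandwich[of "\<lambda>_. 0" _ _ "\<lambda>n. norm (?Y n x - L x)"])
        (use Yle tendsto_norm_zero[OF LIM_zero[OF lim]] in auto)
    from tendsto_add[OF this lim[of "L x"]] show ?thesis by (simp add: linear_diff[OF Ylin])
  qed
  have fixpt: "2 *\<^sub>R L x = X x + L (L x)" for x
  proof -
    have "(\<lambda>n. (1/2) *\<^sub>R (X x + ?Y n (?Y n x))) \<longlonglongrightarrow> (1/2) *\<^sub>R (X x + L (L x))"
      by (intro tendsto_intros YY)
    moreover have "(\<lambda>n. ?Y (Suc n) x) \<longlonglongrightarrow> L x" by (rule LIMSEQ_Suc[OF lim])
    ultimately have "L x = (1/2) *\<^sub>R (X x + L (L x))" by (simp add: LIMSEQ_unique)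
    then have "2 *\<^sub>R L x = 2 *\<^sub>R ((1/2) *\<^sub>R (X x + L (L x)))" by (rule arg_cong)
    then show ?thesis by simp
  qed
  define S where "S = (\<lambda>x. sqrt k *\<^sub>R (x - L x))"
  have "bounded_linear S"
    unfolding S_def by (intro bounded_linear_const_scaleR bounded_linear_sub bounded_linear_ident Lbl)
  moreover have "0 \<le> inner (S x) x" for x
  proof -
    have "inner (L x) x \<le> norm x * norm x"
      by (rule order_trans[OF norm_cauchy_schwarz mult_right_mono[OF Lle]]) simp
    then show ?thesis using k
      by (simp add: S_def inner_diff_left dot_square_norm power2_eq_square)
  qed
  ultimately have "positive_map S"
    by (auto simp: positive_map_def S_def inner_diff_left inner_diff_right Lsym)
  moreover have "S (S x) = T x" for x
  proof -
    have "S (S x) = k *\<^sub>R (x - 2 *\<^sub>R L x + L (L x))"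
      using k by (simp add: S_def linear_scale[OF Llin] linear_diff[OF Llin] scaleR_2 algebra_simps)
    also have "\<dots> = T x" using k by (simp add: fixpt X_def)
    finally show ?thesis .
  qed
  moreover have "(S x, S y) \<in> M"
    if cl: "closed M" and sub: "subspace M" and inv: "\<And>x y. (x, y) \<in> M \<Longrightarrow> (T x, T y) \<in> M"
      and xy: "(x, y) \<in> M" for M :: "('a \<times> 'a) set" and x y
  proof -
    have XM: "(X x, X y) \<in> M" if "(x, y) \<in> M" for x y
      using subspace_diff[OF sub that subspace_scale[OF sub inv[OF that], of "1/k"]]
      by (simp add: X_def)
    have "(?Y n x, ?Y n y) \<in> M" if "(x, y) \<in> M" for n x y
      using that
    proof (induction n arbitrary: x y)
      case 0
      then show ?case using subspace_0[OF sub] by (simp add: zero_prod_def)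
    next
      case (Suc n)
      show ?case
        using subspace_scale[OF sub subspace_add[OF sub XM[OF Suc.prems] Suc.IH[OF Suc.IH[OF Suc.prems]]], of "1/2"]
        by simp
    qed
    then have "(L x, L y) \<in> M"
      by (intro closed_sequentially[OF cl _ tendsto_Pair[OF lim lim]]) (use xy in auto)
    then show ?thesis
      using subspace_scale[OF sub subspace_diff[OF sub xy, of "(L x, L y)"], of "sqrt k"]
      by (simp add: S_def)
  qed
  ultimately show ?thesis by (intro exI[of _ S]) fast
qed

definition positive_root :: "('a::{real_inner,banach} \<Rightarrow> 'a) \<Rightarrow> 'a \<Rightarrow> 'a"
  where "positive_root T = (SOME S. positive_map S \<and> (\<forall>x. S (S x) = T x) \<and>
    (\<forall>M. closed M \<longrightarrow> subspace M \<longrightarrow> (\<forall>(x, y)\<in>M. (T x, T y) \<in> M) \<longrightarrow> (\<forall>(x, y)\<in>M. (S x, S y) \<in> M)))"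

lemma positive_root:
  assumes "positive_map T"
  shows positive_map_root: "positive_map (positive_root T)"
    and positive_root_square: "positive_root T (positive_root T x) = T x"
    and positive_root_invariant: "\<lbrakk>closed M; subspace M; \<And>x y. (x, y) \<in> M \<Longrightarrow> (T x, T y) \<in> M; (u, v) \<in> M\<rbrakk>
      \<Longrightarrow> (positive_root T u, positive_root T v) \<in> M"
proof -
  note R = someI_ex[OF positive_root_exists[OF assms], folded positive_root_def]
  show "positive_map (positive_root T)" "positive_root T (positive_root T x) = T x"
    using R by blast+
  show "(positive_root T u, positive_root T v) \<in> M"
    if "closed M" "subspace M" "\<And>x y. (x, y) \<in> M \<Longrightarrow> (T x, T y) \<in> M" "(u, v) \<in> M"
    using R that by fast
qed

lemma positive_root_commute:
  fixes Z :: "'a::{real_inner,banach} \<Rightarrow> 'a"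
  assumes T: "positive_map T" and Z: "bounded_linear Z" and c: "\<And>x. T (Z x) = Z (T x)"
  shows "positive_root T (Z x) = Z (positive_root T x)"
proof -
  interpret Z: bounded_linear Z by (rule Z)
  let ?M = "{p. snd p = Z (fst p)}"
  have "(positive_root T x, positive_root T (Z x)) \<in> ?M"
  proof (rule positive_root_invariant[OF T])
    show "closed ?M" by (intro closed_Collect_eq continuous_intros Z.continuous_on)
    show "subspace ?M" by (auto simp: subspace_def Z.add Z.scaleR Z.zero)
  qed (auto simp: c)
  then show ?thesis by simp
qed

text \<open>\<open>\<langle>S T x, x\<rangle> = \<langle>T R x, R x\<rangle>\<close> for the root \<open>R\<close> of \<open>S\<close>, which commutes with \<open>T\<close>.\<close>

lemma positive_map_comp:
  fixes S T :: "'a::{real_inner,banach} \<Rightarrow> 'a"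
  assumes S: "positive_map S" and T: "positive_map T" and c: "\<And>x. S (T x) = T (S x)"
  shows "positive_map (\<lambda>x. S (T x))"
proof -
  note SD = positive_mapD[OF S] and TD = positive_mapD[OF T]
  let ?R = "positive_root S"
  have "inner (S (T x)) x = inner (T (?R x)) (?R x)" for x
  proof -
    have "inner (S (T x)) x = inner (?R (?R (T x))) x" by (simp add: positive_root_square[OF S])
    also have "\<dots> = inner (?R (T x)) (?R x)" by (rule positive_mapD(2)[OF positive_map_root[OF S]])
    finally show ?thesis by (simp add: positive_root_commute[OF S TD(1) c])
  qed
  then show ?thesis
    unfolding positive_map_def using SD TD c
    by (auto intro: bounded_linear_compose)
qed

lemma positive_map_square_unique:
  fixes S T :: "'a::{real_inner,banach} \<Rightarrow> 'a"
  assumes S: "positive_map S" and T: "positive_map T" and eq: "\<And>x. S (S x) = T (T x)"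
  shows "S x = T x"
proof -
  note SD = positive_mapD[OF S] and TD = positive_mapD[OF T]
  interpret S: bounded_linear S by (rule SD)
  interpret T: bounded_linear T by (rule TD)
  have pos: "positive_map (\<lambda>x. U (U x))" if "positive_map U" for U :: "'a \<Rightarrow> 'a"
    by (rule positive_map_comp[OF that that refl])
  \<comment> \<open>It suffices to compare \<open>U\<close> with the root \<open>R\<close> of its square, which commutes with \<open>U\<close>.\<close>
  have "U x = positive_root (\<lambda>x. U (U x)) x" if U: "positive_map U" for U :: "'a \<Rightarrow> 'a" and x
  proof -
    note UD = positive_mapD[OF U]
    define R where "R = positive_root (\<lambda>x. U (U x))"
    have R: "positive_map R" and RR: "\<And>x. R (R x) = U (U x)"
      unfolding R_def using positive_map_root[OF pos[OF U]] positive_root_square[OF pos[OF U]]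
      by simp_all
    note RD = positive_mapD[OF R]
    interpret U: bounded_linear U by (rule UD)
    interpret R: bounded_linear R by (rule RD)
    have comm: "R (U x) = U (R x)" for x
      unfolding R_def by (rule positive_root_commute[OF pos[OF U] UD(1) refl])
    define y where "y = U x - R x"
    have "U y + R y = 0" by (simp add: y_def U.diff R.diff comm RR)
    then have "inner (U y + R y) y = 0" by simp
    then have "inner (U y) y + inner (R y) y = 0" by (simp only: inner_add_left)
    then have "inner (U y) y = 0" "inner (R y) y = 0" using UD(3)[of y] RD(3)[of y] by linarith+
    then have "U y = 0" "R y = 0" by (auto intro: positive_map_eq_0 U R)
    then have "inner y y = 0"
      using UD(2)[of x y] RD(2)[of x y] by (subst (1) y_def) (simp add: inner_diff_left)
    then show ?thesis by (simp add: y_def R_def)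
  qed
  from this[OF S, of x] this[OF T, of x] show ?thesis by (simp only: eq)
qed

section \<open>Complex structure and linear operators\<close>

lemma inner_scaleC_left: "inner (c *\<^sub>C x) y = inner x (cnj c *\<^sub>C y)"
  for x y :: "'a::complex_inner"
proof -
  have "cinner x (cnj c *\<^sub>C y) = cnj (cnj c * cinner y x)"
    by (metis cinner_commute cinner_scaleC_left)
  also have "\<dots> = cinner (c *\<^sub>C x) y"
    by (simp add: cinner_scaleC_left flip: cinner_commute[of x y])
  finally show ?thesis by (simp add: inner_eq_Re_cinner)
qed

lemma cinner_eq_inner: "cinner x y = Complex (inner x y) (inner x (\<i> *\<^sub>C y))"
  for x y :: "'a::complex_inner"
proof (rule complex_eqI)
  have "cinner x (\<i> *\<^sub>C y) = cnj (\<i> * cinner y x)"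
    by (metis cinner_commute cinner_scaleC_left)
  also have "\<dots> = - \<i> * cinner x y" by (simp flip: cinner_commute[of x y])
  finally show "Im (cinner x y) = Im (Complex (inner x y) (inner x (\<i> *\<^sub>C y)))"
    by (simp add: inner_eq_Re_cinner)
qed (simp add: inner_eq_Re_cinner)

lemma norm_scaleC: "norm (c *\<^sub>C x) = cmod c * norm x"
  for x :: "'a::complex_inner"
proof -
  have "(norm (c *\<^sub>C x))\<^sup>2 = inner x ((cnj c * c) *\<^sub>C x)"
    by (simp add: power2_norm_eq_inner inner_scaleC_left scaleC_scaleC)
  also have "cnj c * c = complex_of_real ((cmod c)\<^sup>2)"
    by (metis complex_norm_square mult.commute)
  finally have "(norm (c *\<^sub>C x))\<^sup>2 = (cmod c * norm x)\<^sup>2"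
    by (simp only: scaleC_of_real) (simp add: dot_square_norm power_mult_distrib)
  then show ?thesis by (simp add: power2_eq_iff_nonneg)
qed

lemma scaleR_scaleC_commute: "r *\<^sub>R c *\<^sub>C x = c *\<^sub>C r *\<^sub>R x"
  for x :: "'a::complex_inner"
  by (simp add: scaleC_scaleC mult.commute flip: scaleC_of_real)

lemma bounded_linear_scaleC: "bounded_linear ((*\<^sub>C) c :: 'a::complex_inner \<Rightarrow> 'a)"
  by (rule bounded_linear_intro[where K = "cmod c"])
    (simp_all add: scaleC_add_right norm_scaleC scaleR_scaleC_commute mult.commute)

definition complex_homogeneous :: "('a::complex_inner \<Rightarrow> 'a) \<Rightarrow> bool"
  where "complex_homogeneous f \<longleftrightarrow> (\<forall>c x. f (c *\<^sub>C x) = c *\<^sub>C f x)"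

lemma linear_operator_iff:
  "linear_operator T \<longleftrightarrow> T 0 = Some 0 \<and>
    (\<forall>x y a b. T x = Some a \<longrightarrow> T y = Some b \<longrightarrow> T (x + y) = Some (a + b)) \<and>
    (\<forall>c x a. T x = Some a \<longrightarrow> T (c *\<^sub>C x) = Some (c *\<^sub>C a))" (is "_ \<longleftrightarrow> ?R")
proof
  assume T: "linear_operator T"
  note T' = T[unfolded linear_operator_def complex_vector.subspace_def]
  have sc: "T (c *\<^sub>C x) = Some (c *\<^sub>C a)" if "T x = Some a" for c x a
  proof -
    have "c *\<^sub>C x \<in> dom T" using T' that by (meson domI)
    then obtain b where "T (c *\<^sub>C x) = Some b" by blast
    moreover have "the (T (c *\<^sub>C x)) = c *\<^sub>C a" using T' that by (metis domI option.sel)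
    ultimately show ?thesis by simp
  qed
  have add: "T (x + y) = Some (a + b)" if "T x = Some a" "T y = Some b" for x y a b
  proof -
    have "x + y \<in> dom T" using T' that by (meson domI)
    then obtain d where "T (x + y) = Some d" by blast
    moreover have "the (T (x + y)) = a + b" using T' that by (metis domI option.sel)
    ultimately show ?thesis by simp
  qed
  obtain a where "T 0 = Some a" using T' by blast
  from sc[OF this, of 0] have "T 0 = Some 0" by simp
  with sc add show ?R by blast
next
  assume ?R
  then show "linear_operator T"
    unfolding linear_operator_def complex_vector.subspace_def by (fastforce simp: dom_def)
qed

lemma linear_operatorD:
  assumes "linear_operator T"
  shows linear_operator_zero: "T 0 = Some 0"
    and linear_operator_add: "T x = Some a \<Longrightarrow> T y = Some b \<Longrightarrow> T (x + y) = Some (a + b)"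
    and linear_operator_scaleC: "T x = Some a \<Longrightarrow> T (c *\<^sub>C x) = Some (c *\<^sub>C a)"
    and linear_operator_scaleR: "T x = Some a \<Longrightarrow> T (r *\<^sub>R x) = Some (r *\<^sub>R a)"
    and linear_operator_diff: "T x = Some a \<Longrightarrow> T y = Some b \<Longrightarrow> T (x - y) = Some (a - b)"
proof -
  note L = assms[unfolded linear_operator_iff]
  show "T 0 = Some 0" and add: "T x = Some a \<Longrightarrow> T y = Some b \<Longrightarrow> T (x + y) = Some (a + b)"
    and sc: "T x = Some a \<Longrightarrow> T (c *\<^sub>C x) = Some (c *\<^sub>C a)" for x y a b c
    using L by blast+
  show scR: "T x = Some a \<Longrightarrow> T (r *\<^sub>R x) = Some (r *\<^sub>R a)" for r x a
    using sc[of x a "complex_of_real r"] by (simp add: scaleC_of_real)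
  show "T x = Some a \<Longrightarrow> T y = Some b \<Longrightarrow> T (x - y) = Some (a - b)"
    using add[of x a "- y" "- b"] scR[of y b "-1"] by simp
qed

lemma subspace_dom: "linear_operator T \<Longrightarrow> subspace (dom T)"
  unfolding subspace_def dom_def
  using linear_operator_zero linear_operator_add linear_operator_scaleR by (simp, blast)

lemma subspace_graph: "linear_operator T \<Longrightarrow> subspace (Map.graph T)"
  unfolding subspace_def Map.graph_def
  by (auto simp: zero_prod_def linear_operatorD)

lemma closed_operatorD:
  assumes T: "closed_operator T" and "\<And>n. T (f n) = Some (g n)" "f \<longlonglongrightarrow> x" "g \<longlonglongrightarrow> z"
  shows "T x = Some z"
proof -
  have "closed (Map.graph T)" using T by (simp add: closed_operator_def)
  then have "(x, z) \<in> Map.graph T"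
    by (rule closed_sequentially[OF _ _ tendsto_Pair[OF assms(3,4)]]) (simp add: Map.graph_def assms(2))
  then show ?thesis by (simp add: Map.graph_def)
qed

lemma densely_definedD:
  assumes "densely_defined T"
  shows "linear_operator T" "closure (dom T) = UNIV"
  using assms by (simp_all add: densely_defined_def)

lemma densely_defined_total:
  assumes "densely_defined T" "\<And>x a. T x = Some a \<Longrightarrow> inner w x = 0"
  shows "w = 0"
  by (rule orthogonal_to_dense_eq_0[OF densely_definedD(2)[OF assms(1)]]) (use assms(2) in blast)

text \<open>Since \<open>dom T\<close> is invariant under multiplication by \<open>\<i>\<close>, the real parts of the sesquilinear
  identities that define the adjoint already imply them. This reduces all later work to
  the real inner product.\<close>

lemma cinner_eq_of_inner_eq:
  assumes T: "linear_operator T" and eq: "\<And>x a. T x = Some a \<Longrightarrow> inner a y = inner x z"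
    and x: "T x = Some a"
  shows "cinner a y = cinner x z"
  using eq[OF x] eq[OF linear_operator_scaleC[OF T x, of "- \<i>"]]
  by (simp add: cinner_eq_inner inner_scaleC_left)

lemma operator_adjoint_Some_iff:
  assumes T: "densely_defined T"
  shows "operator_adjoint T y = Some z \<longleftrightarrow> (\<forall>x a. T x = Some a \<longrightarrow> inner a y = inner x z)"
proof -
  note lin = densely_definedD(1)[OF T]
  have iff: "(\<forall>x\<in>dom T. cinner (the (T x)) y = cinner x z) \<longleftrightarrow>
      (\<forall>x a. T x = Some a \<longrightarrow> inner a y = inner x z)" for z
  proof
    assume h: "\<forall>x\<in>dom T. cinner (the (T x)) y = cinner x z"
    show "\<forall>x a. T x = Some a \<longrightarrow> inner a y = inner x z"
    proof (intro allI impI)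
      fix x a assume "T x = Some a"
      then have "cinner a y = cinner x z" using h by force
      then show "inner a y = inner x z" by (simp add: inner_eq_Re_cinner)
    qed
  next
    assume "\<forall>x a. T x = Some a \<longrightarrow> inner a y = inner x z"
    then show "\<forall>x\<in>dom T. cinner (the (T x)) y = cinner x z"
      by (auto intro: cinner_eq_of_inner_eq[OF lin])
  qed
  have uniq: "z = z'" if "\<forall>x a. T x = Some a \<longrightarrow> inner a y = inner x z"
    "\<forall>x a. T x = Some a \<longrightarrow> inner a y = inner x z'" for z z'
  proof -
    have "z - z' = 0"
      by (rule densely_defined_total[OF T]) (metis that inner_commute inner_diff_right diff_self)
    then show ?thesis by simp
  qed
  show ?thesis
  proof (cases "\<exists>z. \<forall>x a. T x = Some a \<longrightarrow> inner a y = inner x z")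
    case True
    then obtain w where w: "\<forall>x a. T x = Some a \<longrightarrow> inner a y = inner x w" ..
    have "(THE z. \<forall>x a. T x = Some a \<longrightarrow> inner a y = inner x z) = w"
      by (rule the_equality, rule w, rule uniq[OF _ w])
    then have "operator_adjoint T y = Some w"
      unfolding operator_adjoint_def iff using True by simp
    moreover have "w = z" if "\<forall>x a. T x = Some a \<longrightarrow> inner a y = inner x z"
      by (rule uniq[OF w that])
    ultimately show ?thesis using w by (metis option.inject)
  next
    case False
    then show ?thesis unfolding operator_adjoint_def iff by auto
  qed
qed

lemma operator_adjointD:
  "densely_defined T \<Longrightarrow> operator_adjoint T y = Some z \<Longrightarrow> T x = Some a \<Longrightarrow> inner a y = inner x z"
  by (simp add: operator_adjoint_Some_iff)

lemma linear_operator_adjoint: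
  assumes T: "densely_defined T"
  shows "linear_operator (operator_adjoint T)"
proof -
  note adj = operator_adjoint_Some_iff[OF T]
  have "inner a (c *\<^sub>C y) = inner x (c *\<^sub>C z)"
    if h: "\<forall>x a. T x = Some a \<longrightarrow> inner a y = inner x z" and x: "T x = Some a" for c x y z a
    using h linear_operator_scaleC[OF densely_definedD(1)[OF T] x, of "cnj c"]
    by (metis inner_scaleC_left complex_cnj_cnj)
  then show ?thesis
    unfolding linear_operator_iff adj by (auto simp: inner_add_right)
qed

lemma closed_operator_adjoint:
  assumes T: "densely_defined T"
  shows "closed_operator (operator_adjoint T)"
proof -
  have "Map.graph (operator_adjoint T)
      = (\<Inter>(x, a)\<in>Map.graph T. {p. inner a (fst p) = inner x (snd p)})"
    by (auto simp: Map.graph_def operator_adjoint_Some_iff[OF T])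
  also have "closed \<dots>"
    by (intro closed_INT ballI) (auto simp: split_beta intro!: closed_Collect_eq continuous_intros)
  finally show ?thesis by (simp add: closed_operator_def linear_operator_adjoint[OF T])
qed

lemma map_comp_linear_operator:
  "linear_operator S \<Longrightarrow> linear_operator T \<Longrightarrow> linear_operator (S \<circ>\<^sub>m T)"
  unfolding linear_operator_iff by (auto simp: map_comp_Some_iff map_comp_simps)

section \<open>Positive self-adjoint operators\<close>

lemma positive_selfadjoint_iff:
  "positive_selfadjoint T \<longleftrightarrow> densely_defined T \<and>
    (\<forall>y z. T y = Some z \<longleftrightarrow> (\<forall>x a. T x = Some a \<longrightarrow> inner a y = inner x z)) \<and>
    (\<forall>x a. T x = Some a \<longrightarrow> 0 \<le> inner a x)" (is "?L \<longleftrightarrow> ?R")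
proof (cases "densely_defined T")
  case True
  note lin = densely_definedD(1)[OF True]
  have adj: "operator_adjoint T = T \<longleftrightarrow>
      (\<forall>y z. T y = Some z \<longleftrightarrow> (\<forall>x a. T x = Some a \<longrightarrow> inner a y = inner x z))"
    unfolding operator_adjoint_Some_iff[OF True, symmetric]
    by (metis (no_types) ext not_None_eq option.sel)
  have "(\<forall>x\<in>dom T. cinner (the (T x)) x \<in> \<real>\<^sub>\<ge>\<^sub>0) \<longleftrightarrow> (\<forall>x a. T x = Some a \<longrightarrow> 0 \<le> inner a x)"
    if "operator_adjoint T = T"
  proof -
    have "Im (cinner a x) = 0" if x: "T x = Some a" for x a
    proof -
      have "cinner a x = cinner x a"
        by (rule cinner_eq_of_inner_eq[OF lin _ x]) (use \<open>operator_adjoint T = T\<close> x adj in blast)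
      moreover have "Im (cinner x a) = - Im (cinner a x)" by (subst cinner_commute) simp
      ultimately show ?thesis by simp
    qed
    then show ?thesis by (force simp: dom_def complex_nonneg_Reals_iff inner_eq_Re_cinner)
  qed
  then show ?thesis unfolding positive_selfadjoint_def using True adj by blast
qed (simp add: positive_selfadjoint_def)

lemma positive_selfadjointD:
  assumes "positive_selfadjoint T"
  shows "densely_defined T" "linear_operator T" "closed_operator T"
    "T x = Some a \<Longrightarrow> T y = Some b \<Longrightarrow> inner a y = inner x b"
    "T x = Some a \<Longrightarrow> 0 \<le> inner a x"
    "(\<And>x a. T x = Some a \<Longrightarrow> inner a y = inner x z) \<Longrightarrow> T y = Some z"
proof -
  note T = assms[unfolded positive_selfadjoint_iff]
  show d: "densely_defined T" using T by blast
  then show "linear_operator T" by (rule densely_definedD)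
  show "closed_operator T"
    using closed_operator_adjoint[OF d] assms by (simp add: positive_selfadjoint_def)
  show "T x = Some a \<Longrightarrow> T y = Some b \<Longrightarrow> inner a y = inner x b"
    "T x = Some a \<Longrightarrow> 0 \<le> inner a x"
    "(\<And>x a. T x = Some a \<Longrightarrow> inner a y = inner x z) \<Longrightarrow> T y = Some z"
    using T by blast+
qed

text \<open>The adjoint reverses inclusions, so that \<open>S \<subseteq> T\<close> implies \<open>T = T\<^sup>* \<subseteq> S\<^sup>* = S\<close>.\<close>

lemma positive_selfadjoint_maximal:
  assumes S: "positive_selfadjoint S" and T: "positive_selfadjoint T"
    and le: "\<And>x a. S x = Some a \<Longrightarrow> T x = Some a"
  shows "S = T"
proof
  fix y
  show "S y = T y"
  proof (cases "T y")
    case None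
    then show ?thesis using le by (metis option.exhaust option.distinct(1))
  next
    case (Some z)
    have "S y = Some z"
      by (rule positive_selfadjointD(6)[OF S]) (rule positive_selfadjointD(4)[OF T le Some])
    with Some show ?thesis by simp
  qed
qed

text \<open>Surjectivity of \<open>1 + T\<close> is what makes a symmetric positive operator self-adjoint: it
  determines the solution of the adjoint equation within the domain.\<close>

lemma positive_selfadjointI:
  fixes T :: "'a::complex_hilbert operator"
  assumes lin: "linear_operator T"
    and sym: "\<And>x a y b. T x = Some a \<Longrightarrow> T y = Some b \<Longrightarrow> inner a y = inner x b"
    and pos: "\<And>x a. T x = Some a \<Longrightarrow> 0 \<le> inner a x"
    and surj: "\<And>u. \<exists>x a. T x = Some a \<and> x + a = u"
  shows "positive_selfadjoint T"
proof -
  have "w = 0" if w: "\<And>y. y \<in> dom T \<Longrightarrow> inner w y = 0" for w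
  proof -
    obtain x a where x: "T x = Some a" "x + a = w" using surj by blast
    then have "inner (x + a) x = 0" using w by blast
    then have "inner x x = 0" using pos[OF x(1)] inner_ge_zero[of x]
      by (simp only: inner_add_left)
    then show ?thesis using x linear_operator_zero[OF lin] by auto
  qed
  then have dense: "densely_defined T"
    using lin dense_subspaceI[OF subspace_dom[OF lin]] by (simp add: densely_defined_def)
  have "T y = Some z" if h: "\<And>x a. T x = Some a \<Longrightarrow> inner a y = inner x z" for y z
  proof -
    obtain v b where v: "T v = Some b" "v + b = y + z" using surj by blast
    obtain x a where x: "T x = Some a" "x + a = y - v" using surj by blast
    have "inner (x + a) (y - v) = inner x (y + z) - inner x (v + b)"
      using h[OF x(1)] sym[OF x(1) v(1)]
      by (simp add: inner_add_left inner_add_right inner_diff_right)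
    then have "inner (y - v) (y - v) = 0" by (simp add: x v)
    then show ?thesis using v by simp
  qed
  then show ?thesis
    unfolding positive_selfadjoint_iff using dense sym pos by blast
qed

text \<open>The estimate \<open>c \<parallel>x\<parallel> \<le> \<parallel>c x + T x\<parallel>\<close> makes the range of \<open>c + T\<close> closed. A vector \<open>w\<close> orthogonal to the
  range satisfies \<open>T\<^sup>* w = - c w\<close>, hence \<open>T w = - c w\<close>, and positivity forces \<open>w = 0\<close>.\<close>

lemma resolvent_surjective:
  fixes T :: "'a::complex_hilbert operator"
  assumes T: "positive_selfadjoint T" and c: "0 < c"
  shows "\<exists>x a. T x = Some a \<and> c *\<^sub>R x + a = u"
proof -
  note lin = positive_selfadjointD(2)[OF T]
  have below: "c * norm x \<le> norm (c *\<^sub>R x + a)" if x: "T x = Some a" for x a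
  proof (cases "x = 0")
    case False
    have "c * norm x * norm x \<le> inner (c *\<^sub>R x + a) x"
      using positive_selfadjointD(5)[OF T x]
      by (simp add: inner_add_left dot_square_norm power2_eq_square)
    also have "\<dots> \<le> norm (c *\<^sub>R x + a) * norm x" by (rule norm_cauchy_schwarz)
    finally show ?thesis using False by simp
  qed simp
  define W where "W = {c *\<^sub>R x + a | x a. T x = Some a}"
  have sub: "subspace W"
    unfolding subspace_def
  proof (intro conjI ballI allI)
    show "0 \<in> W" unfolding W_def using linear_operator_zero[OF lin] by force
  next
    fix p q assume "p \<in> W" "q \<in> W"
    then obtain x a y b where "T x = Some a" "p = c *\<^sub>R x + a" "T y = Some b" "q = c *\<^sub>R y + b"
      unfolding W_def by blast
    then show "p + q \<in> W" unfolding W_def using linear_operator_add[OF lin]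
      by (intro CollectI exI[of _ "x + y"] exI[of _ "a + b"]) (simp add: algebra_simps)
  next
    fix r p assume "p \<in> W"
    then obtain x a where "T x = Some a" "p = c *\<^sub>R x + a" unfolding W_def by blast
    then show "r *\<^sub>R p \<in> W" unfolding W_def using linear_operator_scaleR[OF lin]
      by (intro CollectI exI[of _ "r *\<^sub>R x"] exI[of _ "r *\<^sub>R a"]) (simp add: algebra_simps)
  qed
  obtain m where m: "m \<in> closure W" "\<And>y. y \<in> closure W \<Longrightarrow> inner (u - m) y = 0"
    using orthogonal_projection_exists[OF closed_closure subspace_closure[OF sub]] by metis
  from m(1) obtain f where f: "\<And>n. f n \<in> W" "f \<longlonglongrightarrow> m" unfolding closure_sequential by blast
  from f(1) have "\<forall>n. \<exists>x a. T x = Some a \<and> f n = c *\<^sub>R x + a" unfolding W_def by blast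
  then obtain x a where xa: "\<And>n. T (x n) = Some (a n)" "\<And>n. f n = c *\<^sub>R x n + a n" by metis
  have "Cauchy x"
  proof (rule metric_CauchyI)
    fix e :: real assume "0 < e"
    then have "0 < c * e" using c by simp
    with LIMSEQ_imp_Cauchy[OF f(2)] obtain N
      where N: "\<And>i j. i \<ge> N \<Longrightarrow> j \<ge> N \<Longrightarrow> dist (f i) (f j) < c * e"
      using metric_CauchyD by metis
    have "dist (x i) (x j) < e" if "i \<ge> N" "j \<ge> N" for i j
    proof -
      have "c * norm (x i - x j) \<le> norm (f i - f j)"
        using below[OF linear_operator_diff[OF lin xa(1) xa(1)], of i j]
        by (simp add: xa(2) algebra_simps)
      then have "c * norm (x i - x j) < c * e" using N[OF that] by (simp add: dist_norm)
      then show ?thesis using c by (simp add: dist_norm)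
    qed
    then show "\<exists>N. \<forall>i\<ge>N. \<forall>j\<ge>N. dist (x i) (x j) < e" by blast
  qed
  then obtain v where v: "x \<longlonglongrightarrow> v" using Cauchy_convergent convergent_def by blast
  have "(\<lambda>n. f n - c *\<^sub>R x n) \<longlonglongrightarrow> m - c *\<^sub>R v" by (intro tendsto_intros f v)
  then have "a \<longlonglongrightarrow> m - c *\<^sub>R v" by (simp add: xa(2))
  then have Tv: "T v = Some (m - c *\<^sub>R v)"
    by (rule closed_operatorD[OF positive_selfadjointD(3)[OF T] xa(1) v])
  have "T (u - m) = Some (- c *\<^sub>R (u - m))"
  proof (rule positive_selfadjointD(6)[OF T])
    fix y b assume "T y = Some b"
    then have "c *\<^sub>R y + b \<in> W" unfolding W_def by blast
    then have "inner (u - m) (c *\<^sub>R y + b) = 0" using m(2) closure_subset by blast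
    then show "inner b (u - m) = inner y (- c *\<^sub>R (u - m))"
      using inner_commute[of b "u - m"] inner_commute[of y "u - m"]
      by (simp only: inner_add_right inner_scaleR_right)
  qed
  from positive_selfadjointD(5)[OF T this] have "c * inner (u - m) (u - m) \<le> 0" by simp
  then have "u = m" using c by (metis eq_iff_diff_eq_0 inner_ge_zero inner_eq_zero_iff mult_le_0_iff not_le order_antisym)
  with Tv show ?thesis by (intro exI[of _ v] exI[of _ "m - c *\<^sub>R v"]) simp
qed

text \<open>Every positive self-adjoint operator is parametrised by its resolvent \<open>G = (c + T)\<inverse>\<close>, a bounded
  positive operator: the graph of \<open>T\<close> consists of the pairs \<open>(G w, w - c G w)\<close>.\<close>

lemma resolvent_exists:
  fixes T :: "'a::complex_hilbert operator"
  assumes T: "positive_selfadjoint T" and c: "0 < c"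
  obtains G where "positive_map G" "complex_homogeneous G" "inj G"
    "\<And>x a. T x = Some a \<longleftrightarrow> (\<exists>w. x = G w \<and> a = w - c *\<^sub>R G w)"
    "\<And>w. inner (G w) (w - c *\<^sub>R G w) \<ge> 0"
proof -
  note lin = positive_selfadjointD(2)[OF T] and pos = positive_selfadjointD(5)[OF T]
  have inj: "x = y" if x: "T x = Some a" and y: "T y = Some b" and eq: "c *\<^sub>R x + a = c *\<^sub>R y + b"
    for x y a b
  proof -
    have "a - b = - c *\<^sub>R (x - y)" using eq by (simp add: algebra_simps)
    then have "c * inner (x - y) (x - y) \<le> 0"
      using pos[OF linear_operator_diff[OF lin x y]] by simp
    then show ?thesis using c by (metis eq_iff_diff_eq_0 inner_ge_zero inner_eq_zero_iff mult_le_0_iff not_le order_antisym)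
  qed
  have "\<forall>u. \<exists>x. T x = Some (u - c *\<^sub>R x)"
    using resolvent_surjective[OF T c] by (metis add_diff_cancel_left')
  then obtain G where G: "\<And>u. T (G u) = Some (u - c *\<^sub>R G u)" by metis
  have G_eq: "G u = x" if "T x = Some (u - c *\<^sub>R x)" for u x
    by (rule inj[OF G that]) simp
  have add: "G (u + v) = G u + G v" for u v
    using linear_operator_add[OF lin G G] by (intro G_eq) (simp add: algebra_simps)
  have hom: "G (d *\<^sub>C u) = d *\<^sub>C G u" for d u
    using linear_operator_scaleC[OF lin G, of d]
    by (intro G_eq) (simp add: complex_vector.scale_right_diff_distrib scaleR_scaleC_commute)
  have scR: "G (r *\<^sub>R u) = r *\<^sub>R G u" for r u
    using hom[of "complex_of_real r" u] by (simp add: scaleC_of_real)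
  have nn: "inner (G w) (w - c *\<^sub>R G w) \<ge> 0" for w
    using pos[OF G] by (simp add: inner_commute)
  have ge: "c * (norm (G w))\<^sup>2 \<le> inner (G w) w" for w
    using nn[of w] by (simp add: inner_diff_right dot_square_norm)
  have "norm (G w) \<le> norm w * (1 / c)" for w
  proof (cases "G w = 0")
    case False
    have "c * norm (G w) * norm (G w) \<le> norm w * norm (G w)"
      using order_trans[OF ge norm_cauchy_schwarz, of w]
      by (simp only: power2_eq_square ac_simps)
    then have "c * norm (G w) \<le> norm w" using False by simp
    then show ?thesis using c by (simp add: field_simps)
  qed (use c in simp)
  then have "bounded_linear G" by (intro bounded_linear_intro add scR)
  moreover have "inner (G x) y = inner x (G y)" for x y
    using positive_selfadjointD(4)[OF T G G, of x y]
    by (simp add: inner_diff_left inner_diff_right)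
  moreover have "0 \<le> inner (G x) x" for x
    by (rule order_trans[OF _ ge]) (use c in simp)
  ultimately have "positive_map G" by (simp add: positive_map_def)
  moreover have "inj G"
    using G by (metis injI add_diff_cancel_right' diff_add_cancel option.inject)
  moreover have "T x = Some a \<longleftrightarrow> (\<exists>w. x = G w \<and> a = w - c *\<^sub>R G w)" for x a
  proof
    assume x: "T x = Some a"
    have "G (c *\<^sub>R x + a) = x" by (rule G_eq) (simp add: x)
    then show "\<exists>w. x = G w \<and> a = w - c *\<^sub>R G w" by (intro exI[of _ "c *\<^sub>R x + a"]) simp
  qed (use G in blast)
  ultimately show ?thesis using that nn hom unfolding complex_homogeneous_def by blast
qed

text \<open>The point \<open>(x, T x)\<close> of the graph that is nearest to \<open>(u, 0)\<close> solves \<open>x + T\<^sup>* T x = u\<close>.\<close>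

theorem positive_selfadjoint_adjoint_comp:
  fixes T :: "'a::complex_hilbert operator"
  assumes T: "densely_defined T" and cl: "closed_operator T"
  shows "positive_selfadjoint (operator_adjoint T \<circ>\<^sub>m T)"
proof (rule positive_selfadjointI)
  note lin = densely_definedD(1)[OF T] and adjD = operator_adjointD[OF T]
  show "linear_operator (operator_adjoint T \<circ>\<^sub>m T)"
    by (intro map_comp_linear_operator linear_operator_adjoint T lin)
  show "inner a y = inner x b"
    if xy: "(operator_adjoint T \<circ>\<^sub>m T) x = Some a" "(operator_adjoint T \<circ>\<^sub>m T) y = Some b" for x y a b
  proof -
    obtain p q where "T x = Some p" "operator_adjoint T p = Some a"
      "T y = Some q" "operator_adjoint T q = Some b"
      using xy unfolding map_comp_Some_iff by blast
    then have "inner p q = inner x b" "inner q p = inner y a" using adjD by blast+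
    then show ?thesis by (simp add: inner_commute)
  qed
  show "0 \<le> inner a x" if x: "(operator_adjoint T \<circ>\<^sub>m T) x = Some a" for x a
  proof -
    obtain p where "T x = Some p" "operator_adjoint T p = Some a"
      using x by (auto simp: map_comp_Some_iff)
    then have "inner p p = inner x a" using adjD by blast
    then show ?thesis by (metis inner_commute inner_ge_zero)
  qed
  show "\<exists>x a. (operator_adjoint T \<circ>\<^sub>m T) x = Some a \<and> x + a = u" for u
  proof -
    have "closed (Map.graph T)" using cl by (simp add: closed_operator_def)
    then obtain m where m: "m \<in> Map.graph T" "\<And>p. p \<in> Map.graph T \<Longrightarrow> inner ((u, 0) - m) p = 0"
      using orthogonal_projection_exists[OF _ subspace_graph[OF lin]] by metis
    obtain x a where xa: "m = (x, a)" "T x = Some a" using m(1) by (auto simp: Map.graph_def)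
    have "operator_adjoint T a = Some (u - x)"
      unfolding operator_adjoint_Some_iff[OF T]
    proof (intro allI impI)
      fix y b assume "T y = Some b"
      then have "inner ((u, 0) - m) (y, b) = 0" by (intro m(2)) (simp add: Map.graph_def)
      then show "inner b a = inner y (u - x)" by (simp add: xa inner_diff_left inner_commute)
    qed
    with xa show ?thesis by (intro exI[of _ x] exI[of _ "u - x"]) (simp add: map_comp_Some_iff)
  qed
qed

section \<open>Square roots of positive self-adjoint operators\<close>

text \<open>For a positive self-adjoint operator \<open>S\<close> put \<open>P = (1 + S\<^sup>2)\<^bsup>-1/2\<^esup>\<close> and \<open>Q = S P\<close>. These bounded
  operators behave like the cosine and the sine of the angle whose tangent is \<open>S\<close>. Conversely,
  every such pair defines the operator \<open>S = Q P\<inverse>\<close> on the range of \<open>P\<close>.\<close>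

definition circle_pair :: "('a::complex_hilbert \<Rightarrow> 'a) \<Rightarrow> ('a \<Rightarrow> 'a) \<Rightarrow> bool"
  where "circle_pair P Q \<longleftrightarrow> positive_map P \<and> positive_map Q \<and>
    complex_homogeneous P \<and> complex_homogeneous Q \<and> inj P \<and>
    (\<forall>x. P (Q x) = Q (P x)) \<and> (\<forall>x. P (P x) + Q (Q x) = x)"

definition quotient_operator :: "('a \<Rightarrow> 'a) \<Rightarrow> ('a \<Rightarrow> 'a) \<Rightarrow> 'a operator"
  where "quotient_operator P Q = (\<lambda>x. if x \<in> range P then Some (Q (inv P x)) else None)"

lemma quotient_operator_Some_iff:
  "inj P \<Longrightarrow> quotient_operator P Q x = Some z \<longleftrightarrow> (\<exists>w. x = P w \<and> z = Q w)"
  by (auto simp: quotient_operator_def)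

text \<open>A symmetric operator vanishes on the orthogonal complement of its range.\<close>

lemma dense_range_positive_map:
  fixes P :: "'a::{real_inner,banach} \<Rightarrow> 'a"
  assumes P: "positive_map P" and inj: "inj P"
  shows "closure (range P) = UNIV"
proof -
  interpret P: bounded_linear P by (rule positive_mapD[OF P])
  show ?thesis
  proof (rule dense_subspaceI)
    show "subspace (range P)"
      by (rule linear_subspace_image[OF P.linear_axioms subspace_UNIV])
    fix w assume "\<And>y. y \<in> range P \<Longrightarrow> inner w y = 0"
    then have "inner w (P (P w)) = 0" by blast
    then have "inner (P w) (P w) = 0" by (simp add: positive_mapD(2)[OF P])
    then have "P w = P 0" by (simp add: P.zero)
    then show "w = 0" by (rule injD[OF inj])
  qed
qed

lemma circle_pairD:
  assumes "circle_pair P Q"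
  shows "positive_map P" "positive_map Q" "P (c *\<^sub>C x) = c *\<^sub>C P x" "Q (c *\<^sub>C x) = c *\<^sub>C Q x"
    "inj P" "P (Q x) = Q (P x)" "P (P x) + Q (Q x) = x"
    "bounded_linear P" "bounded_linear Q" "inner (P x) y = inner x (P y)" "inner (Q x) y = inner x (Q y)"
    "closure (range P) = UNIV"
proof -
  note PQ = assms[unfolded circle_pair_def complex_homogeneous_def]
  show P: "positive_map P" and Q: "positive_map Q" and inj: "inj P"
    and "P (c *\<^sub>C x) = c *\<^sub>C P x" "Q (c *\<^sub>C x) = c *\<^sub>C Q x"
    and "P (Q x) = Q (P x)" "P (P x) + Q (Q x) = x"
    using PQ by blast+
  show "bounded_linear P" by (rule positive_mapD(1)[OF P])
  show "inner (P x) y = inner x (P y)" by (rule positive_mapD(2)[OF P])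
  show "bounded_linear Q" by (rule positive_mapD(1)[OF Q])
  show "inner (Q x) y = inner x (Q y)" by (rule positive_mapD(2)[OF Q])
  show "closure (range P) = UNIV" by (rule dense_range_positive_map[OF P inj])
qed

text \<open>The adjoint equation for \<open>(y, z)\<close> amounts to \<open>Q y = P z\<close>. The vector \<open>P y + Q z\<close> then has the
  image \<open>P\<^sup>2 y + Q\<^sup>2 y = y\<close> under \<open>P\<close> and the image \<open>P\<^sup>2 z + Q\<^sup>2 z = z\<close> under \<open>Q\<close>.\<close>

lemma positive_selfadjoint_quotient:
  assumes PQ: "circle_pair P Q"
  shows "positive_selfadjoint (quotient_operator P Q)"
proof -
  note D = circle_pairD[OF PQ] and iff = quotient_operator_Some_iff[OF circle_pairD(5)[OF PQ]]
  interpret P: bounded_linear P by (rule D)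
  interpret Q: bounded_linear Q by (rule D)
  have "linear_operator (quotient_operator P Q)"
    unfolding linear_operator_iff iff
  proof (intro conjI allI impI)
    show "\<exists>w. 0 = P w \<and> 0 = Q w" by (intro exI[of _ 0]) (simp add: P.zero Q.zero)
  next
    fix x y a b assume "\<exists>w. x = P w \<and> a = Q w" "\<exists>w. y = P w \<and> b = Q w"
    then obtain v w where "x = P v" "a = Q v" "y = P w" "b = Q w" by blast
    then show "\<exists>w. x + y = P w \<and> a + b = Q w"
      by (intro exI[of _ "v + w"]) (simp add: P.add Q.add)
  next
    fix c x a assume "\<exists>w. x = P w \<and> a = Q w"
    then obtain w where "x = P w" "a = Q w" by blast
    then show "\<exists>w. c *\<^sub>C x = P w \<and> c *\<^sub>C a = Q w"
      by (intro exI[of _ "c *\<^sub>C w"]) (simp add: D(3,4))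
  qed
  moreover have "dom (quotient_operator P Q) = range P"
    by (auto simp: dom_def quotient_operator_def)
  ultimately have dense: "densely_defined (quotient_operator P Q)"
    using D(12) by (simp add: densely_defined_def)
  have "(\<exists>w. y = P w \<and> z = Q w) \<longleftrightarrow> (\<forall>x a. (\<exists>w. x = P w \<and> a = Q w) \<longrightarrow> inner a y = inner x z)" for y z
  proof
    assume "\<exists>w. y = P w \<and> z = Q w"
    then show "\<forall>x a. (\<exists>w. x = P w \<and> a = Q w) \<longrightarrow> inner a y = inner x z"
      by (auto simp: D)
  next
    assume h: "\<forall>x a. (\<exists>w. x = P w \<and> a = Q w) \<longrightarrow> inner a y = inner x z"
    have "inner v (Q y) = inner v (P z)" for v
      using h[rule_format, of "P v" "Q v"] by (auto simp: D)
    then have eq: "Q y = P z" by (metis inner_diff_right inner_eq_zero_iff right_minus_eq)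
    have "P (P y + Q z) = P (P y) + Q (Q y)" by (simp add: P.add D(6) eq)
    moreover have "Q (P y + Q z) = P (P z) + Q (Q z)" by (simp add: Q.add eq flip: D(6))
    ultimately show "\<exists>w. y = P w \<and> z = Q w" by (metis D(7))
  qed
  moreover have "0 \<le> inner (Q w) (P w)" for w
    using positive_mapD(3)[OF positive_map_comp[OF D(1,2,6)], of w] by (simp add: D)
  ultimately show ?thesis
    unfolding positive_selfadjoint_iff iff using dense by blast
qed

text \<open>If \<open>Q y\<close> belongs to the range of \<open>P\<close>, then so does \<open>y = P\<^sup>2 y + Q\<^sup>2 y\<close>, because \<open>P\<close> and \<open>Q\<close> commute.\<close>

lemma quotient_operator_square:
  assumes PQ: "circle_pair P Q"
  shows "(quotient_operator P Q \<circ>\<^sub>m quotient_operator P Q) x = Some z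
    \<longleftrightarrow> (\<exists>w. x = P (P w) \<and> z = Q (Q w))"
proof -
  note D = circle_pairD[OF PQ] and iff = quotient_operator_Some_iff[OF circle_pairD(5)[OF PQ]]
  interpret P: bounded_linear P by (rule D)
  have "\<exists>u. y = P u \<and> z = Q (Q u)" if eq: "Q y = P w" "z = Q w" for y w
  proof (intro exI conjI)
    have "P (P y + Q w) = P (P y) + Q (Q y)" by (simp add: P.add D(6) eq)
    then show y: "y = P (P y + Q w)" by (simp add: D)
    have "P (Q (P y + Q w)) = P w" using y eq by (metis D(6))
    then have "Q (P y + Q w) = w" by (rule injD[OF D(5)])
    then show "z = Q (Q (P y + Q w))" by (simp add: eq)
  qed
  then have "(\<exists>y. (\<exists>w. x = P w \<and> y = Q w) \<and> (\<exists>w. y = P w \<and> z = Q w))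
      \<longleftrightarrow> (\<exists>w. x = P (P w) \<and> z = Q (Q w))"
    using D(6)[symmetric] by blast
  then show ?thesis unfolding map_comp_Some_iff iff .
qed

text \<open>A positive operator is the root of its own square, hence commutes with everything that
  commutes with the square.\<close>

lemma positive_map_commute_square:
  fixes P Z :: "'a::{real_inner,banach} \<Rightarrow> 'a"
  assumes P: "positive_map P" and Z: "bounded_linear Z" and c: "\<And>x. P (P (Z x)) = Z (P (P x))"
  shows "P (Z x) = Z (P x)"
proof -
  have PP: "positive_map (\<lambda>x. P (P x))" by (rule positive_map_comp[OF P P refl])
  have "P y = positive_root (\<lambda>x. P (P x)) y" for y
    by (rule positive_map_square_unique[OF P positive_map_root[OF PP]])
      (simp add: positive_root_square[OF PP])
  from this[of x] this[of "Z x"] show ?thesis by (simp only: positive_root_commute[OF PP Z c])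
qed

lemma positive_map_invariant_square:
  fixes P :: "'a::{real_inner,banach} \<Rightarrow> 'a"
  assumes P: "positive_map P" and M: "closed M" "subspace M"
    and c: "\<And>x y. (x, y) \<in> M \<Longrightarrow> (P (P x), P (P y)) \<in> M" and xy: "(x, y) \<in> M"
  shows "(P x, P y) \<in> M"
proof -
  have PP: "positive_map (\<lambda>x. P (P x))" by (rule positive_map_comp[OF P P refl])
  have "P y = positive_root (\<lambda>x. P (P x)) y" for y
    by (rule positive_map_square_unique[OF P positive_map_root[OF PP]])
      (simp add: positive_root_square[OF PP])
  from this[of x] this[of y] show ?thesis by (simp only: positive_root_invariant[OF PP M c xy])
qed

lemma complex_homogeneous_root:
  fixes T :: "'a::complex_hilbert \<Rightarrow> 'a"
  assumes T: "positive_map T" and h: "complex_homogeneous T"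
  shows "complex_homogeneous (positive_root T)"
  using positive_root_commute[OF T bounded_linear_scaleC] h by (simp add: complex_homogeneous_def)

lemma circle_pair_commute:
  assumes PQ: "circle_pair P Q" and Z: "bounded_linear Z" and c: "\<And>x. P (P (Z x)) = Z (P (P x))"
  shows "P (Z x) = Z (P x)" "Q (Z x) = Z (Q x)"
proof -
  note D = circle_pairD[OF PQ]
  interpret Z: bounded_linear Z by (rule Z)
  show "P (Z x) = Z (P x)" by (rule positive_map_commute_square[OF D(1) Z c])
  have QQ: "Q (Q x) = x - P (P x)" for x using D(7)[of x] by (simp add: algebra_simps)
  show "Q (Z x) = Z (Q x)"
    by (rule positive_map_commute_square[OF D(2) Z]) (simp add: QQ c Z.diff)
qed

text \<open>The roots of \<open>(1 + T)\<inverse>\<close> and of \<open>1 - (1 + T)\<inverse> = T (1 + T)\<inverse>\<close>.\<close>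

lemma circle_pair_exists:
  fixes T :: "'a::complex_hilbert operator"
  assumes T: "positive_selfadjoint T"
  obtains P Q where "circle_pair P Q"
    "\<And>x a. T x = Some a \<longleftrightarrow> (\<exists>w. x = P (P w) \<and> a = Q (Q w))"
proof -
  obtain R where R: "positive_map R" "complex_homogeneous R" "inj R"
    and iff: "\<And>x a. T x = Some a \<longleftrightarrow> (\<exists>w. x = R w \<and> a = w - 1 *\<^sub>R R w)"
    and nn: "\<And>w. inner (R w) (w - 1 *\<^sub>R R w) \<ge> 0"
    by (rule resolvent_exists[OF T zero_less_one]) (rule that; assumption)
  note RD = positive_mapD[OF R(1)]
  interpret R: bounded_linear R by (rule RD)
  define N where "N = (\<lambda>w. w - R w)"
  have "0 \<le> inner (N w) w" for w
  proof -
    have "(norm (R w))\<^sup>2 \<le> norm (R w) * norm w"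
      using nn[of w] norm_cauchy_schwarz[of "R w" w] by (simp add: inner_diff_right dot_square_norm)
    then have "norm (R w) \<le> norm w" by (cases "R w = 0") (auto simp: power2_eq_square)
    then have "norm (R w) * norm w \<le> norm w * norm w" by (rule mult_right_mono) simp
    with norm_cauchy_schwarz[of "R w" w] show ?thesis
      by (simp add: N_def inner_diff_left dot_square_norm power2_eq_square)
  qed
  moreover have Nbl: "bounded_linear N"
    unfolding N_def by (intro bounded_linear_sub bounded_linear_ident R.bounded_linear_axioms)
  ultimately have N: "positive_map N"
    by (simp add: positive_map_def N_def inner_diff_left inner_diff_right RD(2))
  have Nh: "complex_homogeneous N"
    using R(2) by (simp add: complex_homogeneous_def N_def complex_vector.scale_right_diff_distrib)
  define P Q where "P = positive_root R" and "Q = positive_root N"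
  have P: "positive_map P" "\<And>x. P (P x) = R x" and Q: "positive_map Q" "\<And>x. Q (Q x) = N x"
    unfolding P_def Q_def
    using positive_map_root[OF R(1)] positive_root_square[OF R(1)]
      positive_map_root[OF N] positive_root_square[OF N] by simp_all
  have "N (P x) = P (N x)" for x
    unfolding P_def by (rule positive_root_commute[OF R(1) Nbl, symmetric]) (simp add: N_def R.diff)
  then have comm: "P (Q x) = Q (P x)" for x
    unfolding Q_def by (intro positive_root_commute[OF N positive_mapD(1)[OF P(1)], symmetric])
  have "inj P"
    using R(3) by (metis P(2) injD injI)
  then have "circle_pair P Q"
    unfolding circle_pair_def
    using P Q comm complex_homogeneous_root[OF R(1,2), folded P_def]
      complex_homogeneous_root[OF N Nh, folded Q_def]
    by (simp add: N_def)
  moreover have "T x = Some a \<longleftrightarrow> (\<exists>w. x = P (P w) \<and> a = Q (Q w))" for x a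
    by (simp add: iff P Q N_def)
  ultimately show ?thesis by (rule that)
qed

text \<open>The uniqueness of the root is reduced to that of bounded positive roots. With \<open>G = (1 + S)\<inverse>\<close> and
  \<open>C = 1 - G = S G\<close>, the operator \<open>M = G\<^sup>2 + C\<^sup>2 = (1 + T) G\<^sup>2\<close> satisfies \<open>P\<^sup>2 M = G\<^sup>2\<close> and \<open>Q\<^sup>2 M = C\<^sup>2\<close>.
  Taking roots gives \<open>P W = G\<close> and \<open>Q W = C\<close> for the root \<open>W\<close> of \<open>M\<close>, so that the graph of \<open>S\<close>, formed
  by the pairs \<open>(G w, C w)\<close>, is contained in that of \<open>Q P\<inverse>\<close>.\<close>

lemma operator_sqrt_unique:
  fixes S T :: "'a::complex_hilbert operator"
  assumes PQ: "circle_pair P Q" and T: "\<And>x a. T x = Some a \<longleftrightarrow> (\<exists>w. x = P (P w) \<and> a = Q (Q w))"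
    and S: "positive_selfadjoint S" and SS: "S \<circ>\<^sub>m S = T"
  shows "S = quotient_operator P Q"
proof -
  note D = circle_pairD[OF PQ]
  interpret P: bounded_linear P by (rule D)
  interpret Q: bounded_linear Q by (rule D)
  obtain G where G: "positive_map G"
    and iff: "\<And>x a. S x = Some a \<longleftrightarrow> (\<exists>w. x = G w \<and> a = w - 1 *\<^sub>R G w)"
    and nn: "\<And>w. inner (G w) (w - 1 *\<^sub>R G w) \<ge> 0"
    by (rule resolvent_exists[OF S zero_less_one]) (rule that; assumption)
  note GD = positive_mapD[OF G]
  interpret G: bounded_linear G by (rule GD)
  define C where "C = (\<lambda>w. w - G w)"
  have Cbl: "bounded_linear C"
    unfolding C_def by (intro bounded_linear_sub bounded_linear_ident G.bounded_linear_axioms)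
  have Csym: "inner (C x) y = inner x (C y)" for x y
    by (simp add: C_def inner_diff_left inner_diff_right GD(2))
  have GC: "G (C x) = C (G x)" for x by (simp add: C_def G.diff)
  have "0 \<le> inner (C w) w" for w
    using nn[of w] inner_ge_zero[of "C w"] GD(2)[of w w]
    by (simp add: C_def inner_diff_left inner_diff_right inner_commute)
  with Cbl Csym have C: "positive_map C" by (simp add: positive_map_def)
  define M where "M = (\<lambda>w. G (G w) + C (C w))"
  have "0 \<le> inner (M x) x" for x
    using inner_ge_zero[of "G x"] inner_ge_zero[of "C x"] by (simp add: M_def inner_add_left GD(2) Csym)
  moreover have "bounded_linear M"
    unfolding M_def by (intro bounded_linear_add bounded_linear_compose[OF GD(1) GD(1)]
        bounded_linear_compose[OF Cbl Cbl])
  ultimately have M: "positive_map M"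
    by (simp add: positive_map_def M_def inner_add_left inner_add_right GD(2) Csym)
  have TG: "T (G (G y)) = Some (C (C y))" for y
  proof -
    have "S (G (G y)) = Some (G (C y))" unfolding iff by (auto simp: C_def G.diff)
    moreover have "S (G (C y)) = Some (C (C y))" unfolding iff by (auto simp: C_def)
    ultimately show ?thesis by (simp add: map_comp_Some_iff flip: SS)
  qed
  have PPM: "P (P (M y)) = G (G y)" and QQM: "Q (Q (M y)) = C (C y)" for y
  proof -
    obtain w where w: "G (G y) = P (P w)" "C (C y) = Q (Q w)" using TG T by blast
    then have "M y = w" by (simp add: M_def D(7))
    with w show "P (P (M y)) = G (G y)" "Q (Q (M y)) = C (C y)" by simp_all
  qed
  have Mbl: "bounded_linear M" and Msym: "\<And>x y. inner (M x) y = inner x (M y)"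
    using positive_mapD[OF M] by auto
  interpret M: bounded_linear M by (rule Mbl)
  have PM: "P (P (M x)) = M (P (P x))" for x
  proof -
    have "inner (M (P (P x))) y = inner (P (P (M x))) y" for y
      by (simp add: Msym D(10) PPM GD(2))
    then show ?thesis by (metis inner_diff_left inner_eq_zero_iff right_minus_eq)
  qed
  define W where "W = positive_root M"
  have W: "positive_map W" "\<And>x. W (W x) = M x"
    unfolding W_def using positive_map_root[OF M] positive_root_square[OF M] by simp_all
  have "W (P x) = P (W x)" "W (Q x) = Q (W x)" for x
    unfolding W_def using positive_root_commute[OF M D(8)] positive_root_commute[OF M D(9)]
      circle_pair_commute[OF PQ Mbl PM] by simp_all
  then have PW: "P (W x) = W (P x)" and QW: "Q (W x) = W (Q x)" for x by simp_all
  have "P (W x) = G x" for x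
  proof (rule positive_map_square_unique[OF positive_map_comp[OF D(1) W(1) PW] G])
    fix x
    have "P (W (P (W x))) = P (P (W (W x)))" by (simp add: PW)
    then show "P (W (P (W x))) = G (G x)" by (simp add: W PPM)
  qed
  moreover have "Q (W x) = C x" for x
  proof (rule positive_map_square_unique[OF positive_map_comp[OF D(2) W(1) QW] C])
    fix x
    have "Q (W (Q (W x))) = Q (Q (W (W x)))" by (simp add: QW)
    then show "Q (W (Q (W x))) = C (C x)" by (simp add: W QQM)
  qed
  ultimately have "quotient_operator P Q x = Some a" if "S x = Some a" for x a
    using that unfolding iff quotient_operator_Some_iff[OF D(5)] by (metis C_def scaleR_one)
  then show ?thesis
    by (rule positive_selfadjoint_maximal[OF S positive_selfadjoint_quotient[OF PQ]])
qed

lemma operator_sqrt_eq: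
  assumes PQ: "circle_pair P Q" and T: "\<And>x a. T x = Some a \<longleftrightarrow> (\<exists>w. x = P (P w) \<and> a = Q (Q w))"
  shows "operator_sqrt T = quotient_operator P Q"
  unfolding operator_sqrt_def
proof (rule the_equality)
  have "(quotient_operator P Q \<circ>\<^sub>m quotient_operator P Q) x = T x" for x
    using quotient_operator_square[OF PQ, of x] T[of x] by (metis option.exhaust)
  then show "positive_selfadjoint (quotient_operator P Q) \<and>
      quotient_operator P Q \<circ>\<^sub>m quotient_operator P Q = T"
    using positive_selfadjoint_quotient[OF PQ] by blast
qed (use operator_sqrt_unique[OF PQ T] in blast)

theorem operator_sqrt:
  fixes T :: "'a::complex_hilbert operator"
  assumes T: "positive_selfadjoint T"
  shows positive_selfadjoint_sqrt: "positive_selfadjoint (operator_sqrt T)"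
    and operator_sqrt_square: "operator_sqrt T \<circ>\<^sub>m operator_sqrt T = T"
    and operator_sqrt_eqI: "\<lbrakk>positive_selfadjoint S; S \<circ>\<^sub>m S = T\<rbrakk> \<Longrightarrow> operator_sqrt T = S"
proof -
  obtain P Q where PQ: "circle_pair P Q"
    and iff: "\<And>x a. T x = Some a \<longleftrightarrow> (\<exists>w. x = P (P w) \<and> a = Q (Q w))"
    by (rule circle_pair_exists[OF T]) (rule that; assumption)
  note eq = operator_sqrt_eq[OF PQ iff]
  show "positive_selfadjoint (operator_sqrt T)"
    by (simp add: eq positive_selfadjoint_quotient[OF PQ])
  show "operator_sqrt T \<circ>\<^sub>m operator_sqrt T = T"
  proof
    fix x
    show "(operator_sqrt T \<circ>\<^sub>m operator_sqrt T) x = T x"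
      using quotient_operator_square[OF PQ, of x] iff[of x] unfolding eq by (metis option.exhaust)
  qed
  show "operator_sqrt T = S" if "positive_selfadjoint S" "S \<circ>\<^sub>m S = T"
    unfolding eq using operator_sqrt_unique[OF PQ iff that] by simp
qed

section \<open>The absolute value of a closed operator\<close>

text \<open>Closedness extends a norm estimate from a dense set of arguments to all of them.\<close>

lemma closed_operator_bound:
  fixes T :: "'a::complex_hilbert operator"
  assumes T: "closed_operator T" and P: "bounded_linear P" and Q: "bounded_linear Q"
    and Y: "closure Y = UNIV" "subspace Y"
    and bound: "\<And>y. y \<in> Y \<Longrightarrow> \<exists>z. T (P y) = Some z \<and> norm z \<le> norm (Q y)"
  obtains Z where "bounded_linear Z" "\<And>y. T (P y) = Some (Z y)" "\<And>y. norm (Z y) \<le> norm (Q y)"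
proof -
  interpret P: bounded_linear P by (rule P)
  interpret Q: bounded_linear Q by (rule Q)
  have lin: "linear_operator T" using T by (simp add: closed_operator_def)
  have "\<exists>z. T (P y) = Some z \<and> norm z \<le> norm (Q y)" for y
  proof -
    have "y \<in> closure Y" using Y by simp
    then obtain f where f: "\<And>n. f n \<in> Y" "f \<longlonglongrightarrow> y" unfolding closure_sequential by blast
    have "\<forall>n. \<exists>z. T (P (f n)) = Some z" using bound f(1) by blast
    then obtain g where g: "\<And>n. T (P (f n)) = Some (g n)" by metis
    have le: "norm (g i - g j) \<le> norm (Q (f i) - Q (f j))" for i j
    proof -
      have "f i - f j \<in> Y" by (rule subspace_diff[OF Y(2) f(1) f(1)])
      then obtain z where "T (P (f i - f j)) = Some z" "norm z \<le> norm (Q (f i - f j))"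
        using bound by blast
      then show ?thesis
        using linear_operator_diff[OF lin g g, of i j] by (simp add: P.diff Q.diff)
    qed
    have Qf: "(\<lambda>n. Q (f n)) \<longlonglongrightarrow> Q y" by (rule Q.tendsto[OF f(2)])
    have "Cauchy g"
    proof (rule metric_CauchyI)
      fix e :: real assume "0 < e"
      with LIMSEQ_imp_Cauchy[OF Qf] obtain N
        where "\<And>i j. i \<ge> N \<Longrightarrow> j \<ge> N \<Longrightarrow> dist (Q (f i)) (Q (f j)) < e"
        using metric_CauchyD by metis
      then show "\<exists>N. \<forall>i\<ge>N. \<forall>j\<ge>N. dist (g i) (g j) < e"
        using le by (metis dist_norm order_le_less_trans)
    qed
    then obtain z where z: "g \<longlonglongrightarrow> z" using Cauchy_convergent convergent_def by blast
    have "T (P y) = Some z" by (rule closed_operatorD[OF T g P.tendsto[OF f(2)] z])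
    moreover have "norm (g n) \<le> norm (Q (f n))" for n using bound[OF f(1)] g by (metis option.inject)
    then have "norm z \<le> norm (Q y)"
      by (intro LIMSEQ_le[OF tendsto_norm[OF z] tendsto_norm[OF Qf]]) blast
    ultimately show ?thesis by blast
  qed
  then obtain Z where Z: "\<And>y. T (P y) = Some (Z y)" "\<And>y. norm (Z y) \<le> norm (Q y)" by metis
  have "Z (x + y) = Z x + Z y" for x y
    using linear_operator_add[OF lin Z(1) Z(1), of x y] by (simp add: Z(1) flip: P.add)
  moreover have "Z (r *\<^sub>R x) = r *\<^sub>R Z x" for r x
    using linear_operator_scaleR[OF lin Z(1), of r x] by (simp add: Z(1) flip: P.scaleR)
  moreover obtain K where "\<And>x. norm (Q x) \<le> norm x * K" using Q.bounded by blast
  then have "norm (Z x) \<le> norm x * K" for x using Z(2) order_trans by blast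
  ultimately have "bounded_linear Z" by (rule bounded_linear_intro)
  with Z show ?thesis using that by blast
qed

lemma continuous_eq_on_dense:
  fixes f g :: "'a::topological_space \<Rightarrow> 'b::t2_space"
  assumes "closure Y = UNIV" "continuous_on UNIV f" "continuous_on UNIV g" "\<And>y. y \<in> Y \<Longrightarrow> f y = g y"
  shows "f x = g x"
proof -
  have "closure Y \<subseteq> {x. f x = g x}"
    by (rule closure_minimal) (use assms in \<open>auto intro: closed_Collect_eq\<close>)
  with assms(1) show ?thesis by blast
qed

text \<open>The identity \<open>\<parallel>T x\<parallel> = \<parallel>|T| x\<parallel>\<close> is immediate on the domain of \<open>T\<^sup>* T\<close> and extends to the range of \<open>P\<close>,
  which is the domain of \<open>|T|\<close>, because \<open>T\<close> is closed. For the converse inclusion of domains, the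
  preimage of \<open>x \<in> dom T\<close> under \<open>P\<close> can be written down: it is \<open>P x + Z\<^sup>* T x\<close> where \<open>Z = T P\<close>, since
  formally \<open>P Z\<^sup>* T x = P\<^sup>2 T\<^sup>* T x = Q\<^sup>2 x\<close>.\<close>

theorem operator_abs_circle_pair:
  fixes T :: "'a::complex_hilbert operator"
  assumes T: "densely_defined T" and cl: "closed_operator T"
  obtains P Q Z where "circle_pair P Q" "operator_abs T = quotient_operator P Q"
    "\<And>x a. (operator_adjoint T \<circ>\<^sub>m T) x = Some a \<longleftrightarrow> (\<exists>w. x = P (P w) \<and> a = Q (Q w))"
    "bounded_linear Z" "\<And>y. T (P y) = Some (Z y)" "\<And>y. norm (Z y) = norm (Q y)" "dom T = range P"
proof -
  note lin = densely_definedD(1)[OF T] and adj = operator_adjointD[OF T]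
  obtain P Q where PQ: "circle_pair P Q"
    and iff: "\<And>x a. (operator_adjoint T \<circ>\<^sub>m T) x = Some a \<longleftrightarrow> (\<exists>w. x = P (P w) \<and> a = Q (Q w))"
    by (rule circle_pair_exists[OF positive_selfadjoint_adjoint_comp[OF T cl]]) (rule that; assumption)
  note D = circle_pairD[OF PQ]
  interpret P: bounded_linear P by (rule D)
  interpret Q: bounded_linear Q by (rule D)
  have PP: "\<exists>z. T (P (P w)) = Some z \<and> operator_adjoint T z = Some (Q (Q w))" for w
    using iff[of "P (P w)" "Q (Q w)"] unfolding map_comp_Some_iff by blast
  have range: "\<exists>z. T (P y) = Some z \<and> norm z = norm (Q y)" if y: "y \<in> range P" for y
  proof -
    obtain w where w: "y = P w" using y by blast
    obtain z where z: "T (P y) = Some z" "operator_adjoint T z = Some (Q (Q w))"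
      using PP[of w] w by blast
    have "inner z z = inner (P y) (Q (Q w))" by (rule adj[OF z(2,1)])
    also have "\<dots> = inner (Q y) (Q y)" by (simp add: w D(6,10,11))
    finally have "norm z = norm (Q y)" by (simp add: norm_eq_sqrt_inner)
    with z show ?thesis by blast
  qed
  obtain Z where Z: "bounded_linear Z" "\<And>y. T (P y) = Some (Z y)"
    by (rule closed_operator_bound[OF cl D(8,9,12)])
      (use range linear_subspace_image[OF P.linear_axioms subspace_UNIV] in force)+
  interpret Z: bounded_linear Z by (rule Z)
  have norm: "norm (Z y) = norm (Q y)" for y
    by (rule continuous_eq_on_dense[OF D(12)])
      (use range Z(2) in \<open>auto intro!: continuous_intros Z.continuous_on Q.continuous_on\<close>)
  have dom: "dom T = range P"
  proof
    show "range P \<subseteq> dom T" using Z(2) by blast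
    show "dom T \<subseteq> range P"
    proof
      fix x assume "x \<in> dom T"
      then obtain a where a: "T x = Some a" by blast
      obtain Z' where Z': "\<And>x y. inner (Z x) y = inner x (Z' y)"
        using bounded_adjoint_exists[OF Z(1)] by blast
      have "inner (P (P x + Z' a)) y = inner x y" for y
      proof -
        have "operator_adjoint T (Z (P y)) = Some (Q (Q y))" using PP[of y] Z(2) by simp
        from adj[OF this a] have "inner a (Z (P y)) = inner x (Q (Q y))" .
        moreover have "inner (P (P x + Z' a)) y = inner x (P (P y)) + inner (Z' a) (P y)"
          by (simp only: D(10) inner_add_left)
        moreover have "inner (Z' a) (P y) = inner a (Z (P y))"
          using Z'[of "P y" a] by (simp only: inner_commute)
        ultimately have "inner (P (P x + Z' a)) y = inner x (P (P y) + Q (Q y))"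
          by (simp only: inner_add_right)
        then show ?thesis by (simp add: D(7))
      qed
      then have "P (P x + Z' a) = x" by (metis inner_diff_left inner_eq_zero_iff right_minus_eq)
      then show "x \<in> range P" by (metis rangeI)
    qed
  qed
  have "operator_abs T = quotient_operator P Q"
    unfolding operator_abs_def by (rule operator_sqrt_eq[OF PQ iff])
  with PQ iff Z norm dom show ?thesis using that by blast
qed

section \<open>Monotonicity of the square root\<close>

text \<open>Iterated squaring: by the Cauchy-Schwarz inequality for the form \<open>\<langle>G \<sqdot>, \<sqdot>\<rangle>\<close>, an
  excess factor \<open>r > 1\<close> for \<open>V\<close> would become \<open>r ^ 2 ^ k\<close> for \<open>V ^^ 2 ^ k\<close>, whereas all powers
  of \<open>V\<close> are contractions.\<close>

lemma reid_inequality: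
  assumes G: "positive_map G" and sym: "\<And>x y. inner (G (V x)) y = inner x (G (V y))"
    and V: "\<And>x. norm (V x) \<le> norm x"
  shows "inner (G (V u)) u \<le> inner (G u) u"
proof (rule ccontr)
  assume "\<not> ?thesis"
  then have gt: "inner (G u) u < inner (G (V u)) u" by simp
  define a where "a = inner (G u) u"
  note GD = positive_mapD[OF G]
  have cs: "(inner (G (W u)) u)\<^sup>2 \<le> inner (G (W (W u))) u * a"
    if "\<And>x y. inner (G (W x)) y = inner x (G (W y))" for W
  proof -
    have "(inner (G (W u)) u)\<^sup>2 \<le> inner (G (W u)) (W u) * a"
      unfolding a_def by (rule positive_map_Cauchy_Schwarz[OF G])
    also have "inner (G (W u)) (W u) = inner (G (W (W u))) u"
      using that[of u "W u"] by (simp add: inner_commute)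
    finally show ?thesis .
  qed
  have symW: "inner (G ((V ^^ n) x)) y = inner x (G ((V ^^ n) y))" for n x y
  proof (induction n arbitrary: x y)
    case (Suc n)
    have "inner (G ((V ^^ Suc n) x)) y = inner ((V ^^ n) x) (G (V y))" by (simp add: sym)
    also have "\<dots> = inner (G ((V ^^ n) x)) (V y)" by (simp add: GD(2))
    also have "\<dots> = inner x (G ((V ^^ Suc n) y))"
      by (simp add: Suc funpow_swap1)
    finally show ?case .
  qed (simp add: GD(2))
  have contr: "norm ((V ^^ n) x) \<le> norm x" for n x
    by (induction n) (auto intro: order_trans[OF V])
  have a: "0 < a"
  proof -
    have "0 \<le> a" unfolding a_def by (rule GD(3))
    moreover have "(inner (G (V u)) u)\<^sup>2 \<le> inner (G (V u)) (V u) * a"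
      unfolding a_def by (rule positive_map_Cauchy_Schwarz[OF G])
    ultimately show ?thesis using gt unfolding a_def by (cases "inner (G u) u = 0") auto
  qed
  define r where "r = inner (G (V u)) u / a"
  have r: "1 < r" using gt a by (simp add: r_def flip: a_def)
  have pow: "r ^ 2 ^ k * a \<le> inner (G ((V ^^ 2 ^ k) u)) u" for k
  proof (induction k)
    case (Suc k)
    have "(r ^ 2 ^ k * a)\<^sup>2 \<le> (inner (G ((V ^^ 2 ^ k) u)) u)\<^sup>2"
      by (rule power_mono[OF Suc]) (use r a in simp)
    also have "\<dots> \<le> inner (G ((V ^^ 2 ^ k) ((V ^^ 2 ^ k) u))) u * a" by (rule cs[OF symW])
    finally have "((r ^ 2 ^ k)\<^sup>2 * a) * a \<le> inner (G ((V ^^ 2 ^ k) ((V ^^ 2 ^ k) u))) u * a"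
      by (simp only: power2_eq_square ac_simps)
    then have "(r ^ 2 ^ k)\<^sup>2 * a \<le> inner (G ((V ^^ 2 ^ k) ((V ^^ 2 ^ k) u))) u"
      using a by simp
    then show ?case
      by (simp only: power_Suc mult_2 power_add funpow_add o_apply power2_eq_square)
  qed (use a in \<open>simp add: r_def\<close>)
  obtain K where K: "0 < K" "\<And>x. norm (G x) \<le> norm x * K"
    using bounded_linear.pos_bounded[OF GD(1)] by blast
  obtain k where k: "norm u * K * norm u / a < r ^ k" using real_arch_pow[OF r] by blast
  have "r ^ k \<le> r ^ 2 ^ k" by (rule power_increasing) (use r in auto)
  with k have "norm u * K * norm u / a < r ^ 2 ^ k" by (rule less_le_trans)
  then have "norm u * K * norm u < r ^ 2 ^ k * a" using a by (simp only: pos_divide_less_eq)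
  also have "\<dots> \<le> inner (G ((V ^^ 2 ^ k) u)) u" by (rule pow)
  also have "\<dots> \<le> norm (G ((V ^^ 2 ^ k) u)) * norm u" by (rule norm_cauchy_schwarz)
  also have "\<dots> \<le> (norm u * K) * norm u"
    by (intro mult_right_mono order_trans[OF K(2)]) (use K(1) contr in auto)
  finally show False by simp
qed

text \<open>Apply the preceding inequality to \<open>G = (\<epsilon> + T)\<inverse>\<close> and the contraction \<open>V = S G\<close>.\<close>

lemma form_le_of_norm_le:
  fixes S T :: "'a::complex_hilbert operator"
  assumes T: "positive_selfadjoint T"
    and sym: "\<And>x a y b. S x = Some a \<Longrightarrow> S y = Some b \<Longrightarrow> inner a y = inner x b"
    and le: "\<And>x a. T x = Some a \<Longrightarrow> \<exists>b. S x = Some b \<and> norm b \<le> norm a"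
    and x: "T x = Some a" "S x = Some b"
  shows "inner b x \<le> inner a x"
proof -
  have eps: "inner b x \<le> inner a x + e * inner x x" if e: "0 < e" for e
  proof -
    obtain G where G: "positive_map G"
      and iff: "\<And>x a. T x = Some a \<longleftrightarrow> (\<exists>w. x = G w \<and> a = w - e *\<^sub>R G w)"
      and nn: "\<And>w. inner (G w) (w - e *\<^sub>R G w) \<ge> 0"
      by (rule resolvent_exists[OF T e]) (rule that; assumption)
    note GD = positive_mapD[OF G]
    have TG: "T (G w) = Some (w - e *\<^sub>R G w)" for w unfolding iff by blast
    have "\<exists>v. S (G w) = Some v \<and> norm v \<le> norm w" for w
    proof -
      have "(norm w)\<^sup>2 = (norm (w - e *\<^sub>R G w))\<^sup>2 + 2 * e * inner (G w) (w - e *\<^sub>R G w) + (norm (e *\<^sub>R G w))\<^sup>2"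
        unfolding power2_norm_eq_inner
        by (simp add: inner_diff_left inner_diff_right inner_commute algebra_simps)
      also have "\<dots> \<ge> (norm (w - e *\<^sub>R G w))\<^sup>2" using nn[of w] e by simp
      finally have "norm (w - e *\<^sub>R G w) \<le> norm w" by (rule power2_le_imp_le) simp
      moreover obtain v where "S (G w) = Some v" "norm v \<le> norm (w - e *\<^sub>R G w)"
        using le[OF TG[of w]] by blast
      ultimately show ?thesis by (intro exI[of _ v] conjI) simp_all
    qed
    then obtain V where V: "\<And>w. S (G w) = Some (V w)" "\<And>w. norm (V w) \<le> norm w" by metis
    obtain u where u: "x = G u" "a = u - e *\<^sub>R G u" using x(1) iff by blast
    have "inner (G (V v)) w = inner v (G (V w))" for v w
      using sym[OF V(1) V(1), of v w] by (simp add: GD(2))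
    then have "inner (G (V u)) u \<le> inner (G u) u" by (rule reid_inequality[OF G _ V(2)])
    moreover have "b = V u" using x(2) V(1)[of u] u(1) by simp
    ultimately have "inner b x \<le> inner u x" by (simp add: u(1) GD(2))
    moreover have "u = a + e *\<^sub>R x" by (simp add: u)
    ultimately show ?thesis by (simp add: inner_add_left)
  qed
  show ?thesis
  proof (rule field_le_epsilon)
    fix d :: real assume d: "0 < d"
    define e where "e = d / (1 + inner x x)"
    have pos: "0 < 1 + inner x x" by (simp add: add_pos_nonneg)
    have "e * inner x x \<le> e * (1 + inner x x)"
      by (rule mult_left_mono) (use d pos in \<open>simp_all add: e_def\<close>)
    also have "\<dots> = d" using pos by (simp add: e_def)
    finally show "inner b x \<le> inner a x + d" using eps[of e] d pos by (simp add: e_def)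
  qed
qed

text \<open>On \<open>dom T\<close>, the forms of \<open>S\<close> and \<open>T\<close> are the squared norms of \<open>S\<^bsup>1/2\<^esup> x\<close> and \<open>T\<^bsup>1/2\<^esup> x\<close>. As \<open>dom T\<close> is the
  image of a dense set under \<open>P\<close>, closedness of \<open>S\<^bsup>1/2\<^esup>\<close> extends the estimate to \<open>dom T\<^bsup>1/2\<^esup>\<close>, the range of \<open>P\<close>.\<close>

theorem operator_le_of_norm_le:
  fixes S T :: "'a::complex_hilbert operator"
  assumes S: "positive_selfadjoint S" and T: "positive_selfadjoint T"
    and le: "\<And>x a. T x = Some a \<Longrightarrow> \<exists>b. S x = Some b \<and> norm b \<le> norm a"
  shows "operator_le S T"
proof -
  obtain P Q where PQ: "circle_pair P Q"
    and iff: "\<And>x a. T x = Some a \<longleftrightarrow> (\<exists>w. x = P (P w) \<and> a = Q (Q w))"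
    by (rule circle_pair_exists[OF T]) (rule that; assumption)
  note D = circle_pairD[OF PQ]
  note sqrtT = operator_sqrt_eq[OF PQ iff]
  interpret P: bounded_linear P by (rule D)
  have HS: "positive_selfadjoint (operator_sqrt S)" by (rule positive_selfadjoint_sqrt[OF S])
  have bound: "\<exists>z. operator_sqrt S (P y) = Some z \<and> norm z \<le> norm (Q y)" if y: "y \<in> range P" for y
  proof -
    obtain w where w: "y = P w" using y by blast
    have Tx: "T (P (P w)) = Some (Q (Q w))" using iff by blast
    then obtain b where b: "S (P (P w)) = Some b" using le by blast
    then have "(operator_sqrt S \<circ>\<^sub>m operator_sqrt S) (P (P w)) = Some b"
      by (simp only: operator_sqrt_square[OF S])
    then obtain h where h: "operator_sqrt S (P (P w)) = Some h" "operator_sqrt S h = Some b"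
      unfolding map_comp_Some_iff by blast
    have "inner h h = inner b (P (P w))"
      using positive_selfadjointD(4)[OF HS h(1) h(2)] by (simp add: inner_commute)
    also have "\<dots> \<le> inner (Q (Q w)) (P (P w))"
      by (rule form_le_of_norm_le[where S = S, OF T _ le Tx b]) (rule positive_selfadjointD(4)[OF S])
    also have "\<dots> = inner (Q (P w)) (Q (P w))" using D(6) by (simp add: D(10,11))
    finally show ?thesis using h(1) w by (auto simp: norm_le)
  qed
  obtain Z where Z: "\<And>y. operator_sqrt S (P y) = Some (Z y)" "\<And>y. norm (Z y) \<le> norm (Q y)"
    by (rule closed_operator_bound[OF positive_selfadjointD(3)[OF HS] D(8,9,12)
          linear_subspace_image[OF P.linear_axioms subspace_UNIV] bound]) (assumption, (rule that; assumption))
  have qT: "\<exists>w. x = P w \<and> the (operator_sqrt T x) = Q w" if "x \<in> dom (operator_sqrt T)" for x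
  proof -
    from that obtain a where a: "operator_sqrt T x = Some a" by blast
    then have "\<exists>w. x = P w \<and> a = Q w" by (simp only: sqrtT quotient_operator_Some_iff[OF D(5)])
    with a show ?thesis by simp
  qed
  show ?thesis
    unfolding operator_le_def
  proof (intro conjI S T subsetI ballI)
    fix x assume "x \<in> dom (operator_sqrt T)"
    then obtain w where w: "x = P w" "the (operator_sqrt T x) = Q w" using qT by blast
    show "x \<in> dom (operator_sqrt S)" using Z(1)[of w] by (simp add: w dom_def)
    show "norm (the (operator_sqrt S x)) \<le> norm (the (operator_sqrt T x))"
      unfolding w(2) using Z[of w] by (simp add: w(1))
  qed
qed

section \<open>Fuglede's theorem for bounded operators\<close>

lemma cmod_cinner_le: "cmod (cinner x y) \<le> norm x * norm y"
  for x y :: "'a::complex_inner"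
proof (cases "cinner x y = 0")
  case False
  define c where "c = cnj (sgn (cinner x y))"
  have c: "cmod c = 1" using False by (simp add: c_def norm_sgn)
  have "cnj (cinner x y) * cinner x y = complex_of_real ((cmod (cinner x y))\<^sup>2)"
    using complex_norm_square[of "cinner x y"] by (simp only: mult.commute)
  then have "c * cinner x y = complex_of_real (cmod (cinner x y))"
    using False by (simp add: c_def sgn_eq power2_eq_square)
  then have "cmod (cinner x y) = inner (c *\<^sub>C x) y"
    by (simp add: inner_eq_Re_cinner cinner_scaleC_left)
  also have "\<dots> \<le> norm x * norm y"
    using norm_cauchy_schwarz[of "c *\<^sub>C x" y] by (simp add: norm_scaleC c)
  finally show ?thesis .
qed simp

text \<open>Let \<open>\<delta> X = X N\<^sup>* - N\<^sup>* X\<close>. On the operators that commute with \<open>N\<close>, this derivation agrees with the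
  commutator with \<open>K = c N\<^sup>* - cnj c N\<close>, up to the factor \<open>c\<close>. As \<open>K\<close> is skew-adjoint, the flow
  \<open>exp (c \<delta>)\<close> is isometric on these operators for every complex \<open>c\<close>, and Liouville's theorem makes it constant.
  The exponential is replaced below by the Euler method \<open>(1 + c \<delta>)\<^sup>k\<close>, a polynomial in \<open>c\<close>: one step changes norms
  only to second order, so \<open>k\<close> steps of length \<open>k\<^bsup>-1/2\<^esup>\<close> increase them by a bounded factor, and a Cauchy
  estimate bounds \<open>k \<delta> X\<close> by a multiple of the square root of \<open>k\<close>.\<close>

locale bounded_normal =
  fixes N N' :: "'a::complex_hilbert \<Rightarrow> 'a" and a :: real
  assumes N: "bounded_linear N" and N': "bounded_linear N'"
    and N_hom: "N (c *\<^sub>C x) = c *\<^sub>C N x" and N'_hom: "N' (c *\<^sub>C x) = c *\<^sub>C N' x"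
    and adj: "inner (N x) y = inner x (N' y)"
    and normal: "N (N' x) = N' (N x)"
    and a: "0 \<le> a" and N_le: "norm (N x) \<le> a * norm x" and N'_le: "norm (N' x) \<le> a * norm x"
begin

sublocale N: bounded_linear N by (rule N)
sublocale N': bounded_linear N' by (rule N')

definition commuting :: "('a \<Rightarrow> 'a) \<Rightarrow> bool"
  where "commuting X \<longleftrightarrow> bounded_linear X \<and> complex_homogeneous X \<and> (\<forall>x. X (N x) = N (X x))"

definition \<delta> :: "('a \<Rightarrow> 'a) \<Rightarrow> 'a \<Rightarrow> 'a"
  where "\<delta> X = (\<lambda>x. X (N' x) - N' (X x))"

definition euler_step :: "complex \<Rightarrow> ('a \<Rightarrow> 'a) \<Rightarrow> 'a \<Rightarrow> 'a"
  where "euler_step c X = (\<lambda>x. X x + c *\<^sub>C \<delta> X x)"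

fun euler_flow :: "complex \<Rightarrow> nat \<Rightarrow> ('a \<Rightarrow> 'a) \<Rightarrow> 'a \<Rightarrow> 'a"
  where "euler_flow c 0 X = X"
  | "euler_flow c (Suc k) X = euler_flow c k (euler_step c X)"

lemma commuting_\<delta>:
  assumes X: "commuting X"
  shows "commuting (\<delta> X)"
proof -
  have "bounded_linear X" and h: "X (c *\<^sub>C x) = c *\<^sub>C X x" and c: "X (N x) = N (X x)" for c x
    using X by (auto simp: commuting_def complex_homogeneous_def)
  then interpret X: bounded_linear X by simp
  have "bounded_linear (\<delta> X)"
    unfolding \<delta>_def by (intro bounded_linear_sub bounded_linear_compose[OF X.bounded_linear_axioms N']
        bounded_linear_compose[OF N' X.bounded_linear_axioms])
  moreover have "\<delta> X (N x) = N (\<delta> X x)" for x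
    by (simp add: \<delta>_def c N.diff flip: normal)
  ultimately show ?thesis
    by (simp add: commuting_def complex_homogeneous_def \<delta>_def h N'_hom complex_vector.scale_right_diff_distrib)
qed

lemma commuting_euler_step:
  assumes X: "commuting X"
  shows "commuting (euler_step c X)"
  using X commuting_\<delta>[OF X] unfolding commuting_def euler_step_def complex_homogeneous_def
  by (auto intro!: bounded_linear_add bounded_linear_compose[OF bounded_linear_scaleC]
      simp: scaleC_add_right scaleC_scaleC mult.commute N.add N_hom)

text \<open>If \<open>X\<close> commutes with \<open>N\<close>, then \<open>X + c \<delta> X = (1 - K) X (1 + K) + K X K\<close>, and
  \<open>\<parallel>x \<plusminus> K x\<parallel>\<^sup>2 = \<parallel>x\<parallel>\<^sup>2 + \<parallel>K x\<parallel>\<^sup>2\<close> because \<open>K\<close> is skew-adjoint.\<close>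

lemma euler_step_norm_le:
  assumes X: "commuting X" and m: "\<And>x. norm (X x) \<le> m * norm x"
  shows "norm (euler_step c X x) \<le> (1 + 8 * (cmod c)\<^sup>2 * a\<^sup>2) * m * norm x"
proof -
  have "bounded_linear X" and h: "\<And>c x. X (c *\<^sub>C x) = c *\<^sub>C X x" and comm: "\<And>x. X (N x) = N (X x)"
    using X by (auto simp: commuting_def complex_homogeneous_def)
  then interpret X: bounded_linear X by simp
  define K where "K = (\<lambda>x. c *\<^sub>C N' x - cnj c *\<^sub>C N x)"
  define q where "q = (cmod c)\<^sup>2 * a\<^sup>2"
  have q: "0 \<le> q" by (simp add: q_def)
  have m0: "0 \<le> m * norm x" for x :: 'a using m[of x] norm_ge_zero[of "X x"] by linarith
  have Klin: "K (x + y) = K x + K y" "K (- x) = - K x" for x y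
    by (simp_all add: K_def N.add N'.add scaleC_add_right N.neg N'.neg)
  have skew: "inner (K x) x = 0" for x
  proof -
    have "inner (c *\<^sub>C N' x) x = inner (N (cnj c *\<^sub>C x)) x"
      unfolding adj inner_scaleC_left[of c] by (rule inner_commute)
    then show ?thesis by (simp only: K_def inner_diff_left N_hom diff_self)
  qed
  have K_le: "norm (K x) \<le> 2 * cmod c * a * norm x" for x
  proof -
    have "norm (K x) \<le> cmod c * norm (N' x) + cmod c * norm (N x)"
      unfolding K_def by (rule norm_triangle_le_diff) (simp add: norm_scaleC)
    also have "\<dots> \<le> cmod c * (a * norm x) + cmod c * (a * norm x)"
      by (intro add_mono mult_left_mono N_le N'_le) auto
    finally show ?thesis by (simp add: algebra_simps)
  qed
  have K2: "(norm (K x))\<^sup>2 \<le> 4 * q * (norm x)\<^sup>2" for x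
  proof -
    have "(norm (K x))\<^sup>2 \<le> (2 * cmod c * a * norm x)\<^sup>2" by (rule power_mono[OF K_le]) simp
    then show ?thesis by (simp add: q_def power_mult_distrib)
  qed
  have pm: "(norm (x + s *\<^sub>R K x))\<^sup>2 = (norm x)\<^sup>2 + s\<^sup>2 * (norm (K x))\<^sup>2" for x s
    using skew[of x] unfolding power2_norm_eq_inner
    by (simp add: inner_add_left inner_add_right inner_commute power2_eq_square)
  have near_isometry: "norm (x + s *\<^sub>R K x) \<le> sqrt (1 + 4 * q) * norm x" if "s\<^sup>2 = 1" for x s
  proof (rule power2_le_imp_le)
    show "(norm (x + s *\<^sub>R K x))\<^sup>2 \<le> (sqrt (1 + 4 * q) * norm x)\<^sup>2"
      using K2[of x] q by (simp add: pm that power_mult_distrib algebra_simps)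
  qed (use q in simp)
  define y where "y = X (x + 1 *\<^sub>R K x)"
  have "X (K x) - K (X x) = c *\<^sub>C \<delta> X x"
    by (simp add: K_def \<delta>_def X.diff h comm complex_vector.scale_right_diff_distrib)
  then have "euler_step c X x = (y + (- 1) *\<^sub>R K y) + K (X (K x))"
    by (simp add: y_def euler_step_def X.add Klin algebra_simps)
  then have "norm (euler_step c X x) \<le> norm (y + (- 1) *\<^sub>R K y) + norm (K (X (K x)))"
    using norm_triangle_ineq by simp
  also have "\<dots> \<le> (1 + 4 * q) * m * norm x + 4 * q * m * norm x"
  proof (rule add_mono)
    have s: "0 \<le> sqrt (1 + 4 * q)" using q by simp
    have m': "0 \<le> m \<or> x = 0" using m0[of x] by (auto simp: zero_le_mult_iff)
    have "norm y \<le> m * norm (x + 1 *\<^sub>R K x)" unfolding y_def by (rule m)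
    also have "\<dots> \<le> m * (sqrt (1 + 4 * q) * norm x)"
    proof (cases "x = 0")
      case False
      then show ?thesis using m' by (intro mult_left_mono near_isometry) auto
    qed (simp add: K_def N.zero N'.zero)
    finally have y: "norm y \<le> m * (sqrt (1 + 4 * q) * norm x)" .
    have "norm (y + (- 1) *\<^sub>R K y) \<le> sqrt (1 + 4 * q) * norm y" by (rule near_isometry) simp
    also have "\<dots> \<le> sqrt (1 + 4 * q) * (m * (sqrt (1 + 4 * q) * norm x))"
      by (rule mult_left_mono[OF y s])
    also have "\<dots> = (sqrt (1 + 4 * q))\<^sup>2 * m * norm x" by (simp only: power2_eq_square ac_simps)
    also have "\<dots> = (1 + 4 * q) * m * norm x" using q by simp
    finally show "norm (y + (- 1) *\<^sub>R K y) \<le> (1 + 4 * q) * m * norm x" .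
    let ?k = "2 * cmod c * a"
    have k: "0 \<le> ?k" using a by simp
    have "norm (K (X (K x))) \<le> ?k * (m * norm (K x))"
      by (rule order_trans[OF K_le mult_left_mono[OF m k]])
    also have "\<dots> \<le> ?k * (m * (?k * norm x))"
    proof (cases "x = 0")
      case False
      then show ?thesis using m' k by (intro mult_left_mono K_le) auto
    qed (simp add: K_def N.zero N'.zero)
    also have "\<dots> = 4 * q * m * norm x" by (simp add: q_def power2_eq_square)
    finally show "norm (K (X (K x))) \<le> 4 * q * m * norm x" .
  qed
  also have "\<dots> = (1 + 8 * (cmod c)\<^sup>2 * a\<^sup>2) * m * norm x" by (simp add: q_def algebra_simps)
  finally show ?thesis .
qed

lemma euler_flow_norm_le:
  assumes "commuting X" and "\<And>x. norm (X x) \<le> m * norm x"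
  shows "norm (euler_flow c k X x) \<le> (1 + 8 * (cmod c)\<^sup>2 * a\<^sup>2) ^ k * m * norm x"
  using assms
proof (induction k arbitrary: X m)
  case (Suc k)
  from Suc.IH[OF commuting_euler_step[OF Suc.prems(1)] euler_step_norm_le[OF Suc.prems]]
  show ?case by (simp only: euler_flow.simps power_Suc2 ac_simps)
qed simp

lemma euler_flow_add:
  "euler_flow c k (\<lambda>x. X x + d *\<^sub>C Y x) x = euler_flow c k X x + d *\<^sub>C euler_flow c k Y x"
proof (induction k arbitrary: X Y)
  case (Suc k)
  have "euler_step c (\<lambda>x. X x + d *\<^sub>C Y x) = (\<lambda>x. euler_step c X x + d *\<^sub>C euler_step c Y x)"
    by (rule ext) (simp add: euler_step_def \<delta>_def N'.add N'_hom scaleC_add_right scaleC_scaleC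
        complex_vector.scale_right_diff_distrib mult.commute)
  then show ?case by (simp add: Suc.IH)
qed simp

lemma euler_flow_Suc:
  "cinner (euler_flow c (Suc k) X u) v = cinner (euler_flow c k X u) v + c * cinner (euler_flow c k (\<delta> X) u) v"
  by (simp add: euler_step_def euler_flow_add cinner_add_left cinner_scaleC_left)

lemma euler_flow_holomorphic: "(\<lambda>c. cinner (euler_flow c k X u) v) holomorphic_on S"
  by (induction k arbitrary: X) (auto simp only: euler_flow.simps(1) euler_flow_Suc intro!: holomorphic_intros)

lemma euler_flow_zero: "euler_flow 0 k X = X"
  by (induction k arbitrary: X) (simp_all add: euler_step_def)

lemma euler_flow_deriv:
  "((\<lambda>c. cinner (euler_flow c k X u) v) has_field_derivative of_nat k * cinner (\<delta> X u) v) (at 0)"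
proof (induction k arbitrary: X)
  case (Suc k)
  obtain D where D: "((\<lambda>c. cinner (euler_flow c k (\<delta> X) u) v) has_field_derivative D) (at 0)"
    using Suc.IH by blast
  have "((\<lambda>c. cinner (euler_flow c k X u) v + c * cinner (euler_flow c k (\<delta> X) u) v)
      has_field_derivative of_nat (Suc k) * cinner (\<delta> X u) v) (at 0)"
    by (rule derivative_eq_intros Suc.IH D refl)+ (simp add: euler_flow_zero algebra_simps)
  then show ?case by (simp only: euler_flow_Suc)
qed simp

text \<open>Cauchy's estimate is applied on the circle of radius \<open>1 / n\<close> with \<open>k = n\<^sup>2\<close> Euler steps, for which the
  bound \<open>(1 + 8 a\<^sup>2 / k)\<^sup>k\<close> does not exceed \<open>exp (8 a\<^sup>2)\<close>.\<close>

theorem fuglede_bounded: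
  assumes X: "commuting X"
  shows "X (N' u) = N' (X u)"
proof -
  have "bounded_linear X" using X by (simp add: commuting_def)
  then obtain m where "0 < m" and "\<And>x. norm (X x) \<le> norm x * m"
    using bounded_linear.pos_bounded by blast
  then have m: "\<And>x. norm (X x) \<le> m * norm x" by (simp add: mult.commute)
  have "cinner (\<delta> X u) v = 0" for v
  proof (rule ccontr)
    assume ne: "cinner (\<delta> X u) v \<noteq> 0"
    define C where "C = exp (8 * a\<^sup>2) * m * norm u * norm v"
    obtain n :: nat where n: "C < real n * cmod (cinner (\<delta> X u) v)"
      using reals_Archimedean3[of "cmod (cinner (\<delta> X u) v)"] ne by auto
    have C0: "0 \<le> C" using \<open>0 < m\<close> by (simp add: C_def)
    then have n0: "0 < real n" using n by (metis mult_zero_left not_le of_nat_0_le_iff order_le_less)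
    define k where "k = n * n"
    define f where "f = (\<lambda>c. cinner (euler_flow c k X u) v)"
    have bound: "cmod (f c) \<le> C" if c: "cmod (0 - c) = 1 / real n" for c
    proof -
      have "(1 + 8 * (cmod c)\<^sup>2 * a\<^sup>2) ^ k \<le> exp (8 * (cmod c)\<^sup>2 * a\<^sup>2) ^ k"
        by (intro power_mono exp_ge_add_one_self) simp
      also have "\<dots> = exp (8 * a\<^sup>2)"
        using c n0 by (simp add: k_def power2_eq_square flip: exp_of_nat_mult)
      finally have "(1 + 8 * (cmod c)\<^sup>2 * a\<^sup>2) ^ k * (m * norm u) \<le> exp (8 * a\<^sup>2) * (m * norm u)"
        using \<open>0 < m\<close> by (intro mult_right_mono) auto
      then have "norm (euler_flow c k X u) \<le> exp (8 * a\<^sup>2) * (m * norm u)"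
        using euler_flow_norm_le[OF X m, of c k u] by (simp add: mult.assoc)
      then have "norm (euler_flow c k X u) * norm v \<le> C"
        unfolding C_def using mult_right_mono[OF _ norm_ge_zero[of v]] by (simp only: mult.assoc[symmetric])
      then show ?thesis unfolding f_def using cmod_cinner_le order_trans by blast
    qed
    have "cmod ((deriv ^^ 1) f 0) \<le> fact 1 * C / (1 / real n) ^ 1"
    proof (rule Cauchy_inequality)
      show "f holomorphic_on ball 0 (1 / real n)" unfolding f_def by (rule euler_flow_holomorphic)
      show "continuous_on (cball 0 (1 / real n)) f"
        unfolding f_def by (rule holomorphic_on_imp_continuous_on[OF euler_flow_holomorphic])
    qed (use n0 bound in auto)
    moreover have "deriv f 0 = of_nat k * cinner (\<delta> X u) v"
      unfolding f_def by (rule DERIV_imp_deriv[OF euler_flow_deriv])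
    ultimately have "real n * (real n * cmod (cinner (\<delta> X u) v)) \<le> real n * C"
      by (simp add: k_def norm_mult mult.assoc mult.commute)
    then show False using n n0 by simp
  qed
  from this[of "\<delta> X u"] have "\<delta> X u = 0" by (simp add: cinner_self)
  then show ?thesis by (simp add: \<delta>_def)
qed

end

section \<open>Spectral cut-offs\<close>

text \<open>\<open>E\<close> is the spectral projection of \<open>R\<close> for \<open>[c, \<infinity>)\<close>, obtained as the projection to the kernel of the negative
  part of \<open>T = R - c\<close>, that is, to the set \<open>K\<close> where \<open>F = |T|\<close> agrees with \<open>T\<close>. As for square roots, commutation is
  expressed by the invariance of closed subspaces of the product, such as graphs.\<close>

lemma spectral_cutoff:
  fixes R :: "'a::{real_inner,banach} \<Rightarrow> 'a"
  assumes R: "positive_map R"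
  obtains E where "bounded_linear E" "\<And>x. E (E x) = E x" "\<And>x y. inner (E x) y = inner x (E y)"
    "\<And>x. norm (E x) \<le> norm x"
    "\<And>x. c * (norm (E x))\<^sup>2 \<le> inner (R (E x)) (E x)"
    "\<And>x. inner (R (x - E x)) (x - E x) \<le> c * (norm (x - E x))\<^sup>2"
    "\<And>M. closed M \<Longrightarrow> subspace M \<Longrightarrow> \<forall>(x, y)\<in>M. (R x, R y) \<in> M \<Longrightarrow> \<forall>(x, y)\<in>M. (E x, E y) \<in> M"
proof -
  note RD = positive_mapD[OF R]
  interpret R: bounded_linear R by (rule RD)
  define T where "T = (\<lambda>x. R x - c *\<^sub>R x)"
  have Tbl: "bounded_linear T"
    unfolding T_def by (intro bounded_linear_sub bounded_linear_const_scaleR bounded_linear_ident RD(1))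
  interpret T: bounded_linear T by (rule Tbl)
  have Tsym: "inner (T x) y = inner x (T y)" for x y
    by (simp add: T_def inner_diff_left inner_diff_right RD(2))
  have "0 \<le> inner (T (T x)) x" for x unfolding Tsym[of "T x"] by (rule inner_ge_zero)
  then have TT: "positive_map (\<lambda>x. T (T x))"
    unfolding positive_map_def using bounded_linear_compose[OF Tbl Tbl] by (simp add: Tsym)
  define F where "F = positive_root (\<lambda>x. T (T x))"
  have F: "positive_map F" and FF: "F (F x) = T (T x)" and FT: "F (T x) = T (F x)" for x
    unfolding F_def using positive_map_root[OF TT] positive_root_square[OF TT]
      positive_root_commute[OF TT Tbl refl] by simp_all
  note FD = positive_mapD[OF F]
  interpret F: bounded_linear F by (rule FD)
  define K where "K = {x. F x = T x}"
  have clK: "closed K"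
    unfolding K_def by (intro closed_Collect_eq F.continuous_on T.continuous_on continuous_intros)
  have subK: "subspace K"
    by (auto simp: K_def subspace_def F.add T.add F.zero T.zero F.scaleR T.scaleR)
  have "\<forall>x. \<exists>m. m \<in> K \<and> (\<forall>y\<in>K. inner (x - m) y = 0)"
    using orthogonal_projection_exists[OF clK subK] by metis
  then obtain E where EK: "\<And>x. E x \<in> K" and E: "\<And>x y. y \<in> K \<Longrightarrow> inner (x - E x) y = 0" by metis
  have E_eq: "E x = m" if m: "m \<in> K" "\<And>y. y \<in> K \<Longrightarrow> inner (x - m) y = 0" for x m
  proof -
    have d: "m - E x \<in> K" by (rule subspace_diff[OF subK m(1) EK])
    have "inner (m - E x) (m - E x) = inner (x - E x) (m - E x) - inner (x - m) (m - E x)"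
      by (simp add: inner_diff_left)
    then show ?thesis using E[OF d] m(2)[OF d] by simp
  qed
  have "E (x + y) = E x + E y" for x y
    by (rule E_eq[OF subspace_add[OF subK EK EK]])
      (use E[of _ x] E[of _ y] in \<open>simp add: inner_diff_left inner_add_left\<close>)
  moreover have "E (r *\<^sub>R x) = r *\<^sub>R E x" for r x
  proof (rule E_eq[OF subspace_scale[OF subK EK]])
    fix y assume "y \<in> K"
    then have "r * inner (x - E x) y = 0" using E by simp
    then show "inner (r *\<^sub>R x - r *\<^sub>R E x) y = 0" by (simp add: inner_diff_left algebra_simps)
  qed
  moreover have E_le: "norm (E x) \<le> norm x" for x
  proof -
    have "(norm x)\<^sup>2 = (norm (E x))\<^sup>2 + (norm (x - E x))\<^sup>2 + 2 * inner (x - E x) (E x)"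
      unfolding power2_norm_eq_inner by (simp add: inner_diff_left inner_diff_right inner_commute)
    also have "\<dots> \<ge> (norm (E x))\<^sup>2" using E[OF EK, of x x] by simp
    finally show ?thesis by (rule power2_le_imp_le) simp
  qed
  ultimately have E_bl: "bounded_linear E" by (intro bounded_linear_intro[where K = 1]) auto
  have EE: "E (E x) = E x" for x by (rule E_eq[OF EK]) simp
  have E_sym: "inner (E x) y = inner x (E y)" for x y
    using E[OF EK, of x y] E[OF EK, of y x] by (simp add: inner_diff_left) (metis inner_commute)
  have low: "c * (norm (E x))\<^sup>2 \<le> inner (R (E x)) (E x)" for x
  proof -
    have "inner (F (E x)) (E x) = inner (R (E x)) (E x) - c * (norm (E x))\<^sup>2"
      using EK[of x] by (simp add: K_def T_def inner_diff_left dot_square_norm)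
    then show ?thesis using FD(3)[of "E x"] by simp
  qed
  \<comment> \<open>Since \<open>(F - T) (F + T) = 0\<close>, the range of \<open>F + T\<close> lies in \<open>K\<close>, so that \<open>F = - T\<close> on the
    orthogonal complement of \<open>K\<close>.\<close>
  have high: "inner (R w) w \<le> c * (norm w)\<^sup>2" if w: "w = x - E x" for w x
  proof -
    have "F (F w + T w) = T (F w + T w)" by (simp add: F.add T.add FF FT)
    then have "F (F w + T w) + T (F w + T w) \<in> K"
      by (simp add: K_def F.add T.add FF FT)
    then have "inner w (F (F w + T w) + T (F w + T w)) = 0" unfolding w by (rule E)
    then have "inner (F w + T w) (F w + T w) = 0"
      using FD(2)[of w "F w + T w"] Tsym[of w "F w + T w"] by (simp only: inner_add_left inner_add_right)
    then have "F w + T w = 0" by simp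
    then have "inner (F w + T w) w = 0" by simp
    then have "inner (F w) w + (inner (R w) w - c * (norm w)\<^sup>2) = 0"
      by (simp add: T_def inner_add_left inner_diff_left dot_square_norm)
    then show ?thesis using FD(3)[of w] by simp
  qed
  \<comment> \<open>Split the projection of a point of \<open>M\<close> along \<open>M\<close>. Both parts belong to \<open>K \<times> K\<close> because
    \<open>F - T\<close> respects the splitting, and this makes the second part orthogonal to itself.\<close>
  have inv: "\<forall>(x, y)\<in>M. (E x, E y) \<in> M"
    if M: "closed M" "subspace M" and "\<forall>(x, y)\<in>M. (R x, R y) \<in> M" for M
  proof clarify
    fix x y assume xy: "(x, y) \<in> M"
    have inv: "(R x, R y) \<in> M" if "(x, y) \<in> M" for x y using that \<open>\<forall>(x, y)\<in>M. (R x, R y) \<in> M\<close> by blast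
    have Tinv: "(T x, T y) \<in> M" if "(x, y) \<in> M" for x y
      using subspace_diff[OF M(2) inv[OF that] subspace_scale[OF M(2) that, of c]] by (simp add: T_def)
    have Finv: "(F x, F y) \<in> M" if "(x, y) \<in> M" for x y
      unfolding F_def by (rule positive_root_invariant[OF TT M Tinv[OF Tinv] that])
    define D where "D = (\<lambda>p. (F (fst p) - T (fst p), F (snd p) - T (snd p)))"
    have DM: "D p \<in> M" if "p \<in> M" for p
      using subspace_diff[OF M(2) Finv[of "fst p" "snd p"] Tinv[of "fst p" "snd p"]] that
      by (simp add: D_def)
    have Dsym: "inner (D p) q = inner p (D q)" for p q
      by (simp add: D_def inner_prod_def inner_diff_left inner_diff_right FD(2) Tsym)
    have Dadd: "D (p + q) = D p + D q" for p q
      by (simp add: D_def F.add T.add)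
    obtain s where s: "s \<in> M" "\<And>p. p \<in> M \<Longrightarrow> inner ((E x, E y) - s) p = 0"
      by (rule orthogonal_projection_exists[OF M, of "(E x, E y)"]) (rule that; assumption)
    define t where "t = (E x, E y) - s"
    have "D (s + t) = 0" using EK[of x] EK[of y] by (simp add: t_def D_def K_def zero_prod_def)
    then have "D s + D t = 0" by (simp only: Dadd)
    then have Dt: "D t = - D s" by (rule minus_unique[symmetric])
    have "inner (D t) (D s) = 0" unfolding Dsym t_def by (intro s(2) DM s(1))
    then have "D s = 0" by (simp add: Dt)
    then have "D t = 0" by (simp add: Dt)
    then have tK: "fst t \<in> K" "snd t \<in> K" by (simp_all add: D_def K_def zero_prod_def)
    have "inner t (x, y) = inner t (E x, E y)"
      using E[OF tK(1), of x] E[OF tK(2), of y]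
      by (simp add: inner_prod_def inner_diff_left inner_diff_right inner_commute)
    moreover have "inner t (x, y) = 0" "inner t s = 0"
      unfolding t_def by (intro s(2) xy, intro s)
    ultimately have "inner t t = 0" by (simp add: t_def inner_diff_right)
    then show "(E x, E y) \<in> M" using s(1) by (simp add: t_def)
  qed
  show ?thesis by (rule that[OF E_bl EE E_sym E_le low high[OF refl] inv])
qed

section \<open>Normal operators\<close>

lemma closed_graph_map:
  assumes "bounded_linear S"
  shows "closed {p. snd p = S (fst p)}" "subspace {p. snd p = S (fst p)}"
proof -
  interpret S: bounded_linear S by (rule assms)
  show "closed {p. snd p = S (fst p)}" by (intro closed_Collect_eq continuous_intros S.continuous_on)
  show "subspace {p. snd p = S (fst p)}" by (auto simp: subspace_def S.add S.scaleR S.zero)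
qed

lemma graph_closed_subspace:
  assumes "closed_operator T"
  shows "closed (Map.graph T)" "subspace (Map.graph T)"
  using assms subspace_graph by (auto simp: closed_operator_def)

text \<open>For normal \<open>A\<close>, the operator \<open>P\<^sup>2 = (1 + A\<^sup>* A)\<inverse> = (1 + A A\<^sup>*)\<inverse>\<close> commutes with \<open>A\<close> and with \<open>A\<^sup>*\<close>, and
  the range of \<open>P\<close> is contained in both domains. In terms of \<open>Z = A P\<close> and \<open>Z' = A\<^sup>* P\<close>, normality reads
  \<open>\<parallel>Z y\<parallel> = \<parallel>Z' y\<parallel> = \<parallel>Q y\<parallel>\<close>.\<close>

lemma normal_operator_structure:
  fixes A :: "'a::complex_hilbert operator"
  assumes A: "normal_operator A"
  defines "A' \<equiv> operator_adjoint A"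
  obtains P Q Z Z' where "circle_pair P Q" "operator_abs A = quotient_operator P Q"
    "\<And>x a. (A' \<circ>\<^sub>m A) x = Some a \<longleftrightarrow> (\<exists>w. x = P (P w) \<and> a = Q (Q w))"
    "bounded_linear Z" "\<And>y. A (P y) = Some (Z y)" "\<And>y. norm (Z y) = norm (Q y)"
    "bounded_linear Z'" "\<And>y. A' (P y) = Some (Z' y)" "\<And>y. norm (Z' y) = norm (Q y)"
    "\<And>x a. A x = Some a \<Longrightarrow> A (P (P x)) = Some (P (P a))"
    "\<And>x a. A' x = Some a \<Longrightarrow> A' (P (P x)) = Some (P (P a))"
proof -
  have A1: "densely_defined A" "closed_operator A" and comm: "A \<circ>\<^sub>m A' = A' \<circ>\<^sub>m A"
    using A by (simp_all add: normal_operator_def A'_def)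
  have lin: "linear_operator A" by (rule densely_definedD[OF A1(1)])
  have lin': "linear_operator A'" unfolding A'_def by (rule linear_operator_adjoint[OF A1(1)])
  have cl': "closed_operator A'" unfolding A'_def by (rule closed_operator_adjoint[OF A1(1)])
  note adj = operator_adjointD[OF A1(1), folded A'_def]
  obtain P Q Z where PQ: "circle_pair P Q" "operator_abs A = quotient_operator P Q"
    and iff: "\<And>x a. (A' \<circ>\<^sub>m A) x = Some a \<longleftrightarrow> (\<exists>w. x = P (P w) \<and> a = Q (Q w))"
    and Z: "bounded_linear Z" "\<And>y. A (P y) = Some (Z y)" "\<And>y. norm (Z y) = norm (Q y)"
    by (rule operator_abs_circle_pair[OF A1, folded A'_def]) (rule that; assumption)
  note D = circle_pairD[OF PQ(1)]
  interpret P: bounded_linear P by (rule D)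
  interpret Q: bounded_linear Q by (rule D)
  have fwd: "\<exists>b. A x = Some b \<and> A' b = Some a" if "(A' \<circ>\<^sub>m A) x = Some a" for x a
    using that unfolding map_comp_Some_iff by blast
  have fwd': "\<exists>b. A' x = Some b \<and> A b = Some a" if "(A' \<circ>\<^sub>m A) x = Some a" for x a
    using that unfolding comm[symmetric] map_comp_Some_iff by blast
  have QQ: "(A' \<circ>\<^sub>m A) (P (P w)) = Some (Q (Q w))" for w unfolding iff by blast
  have QQ_eq: "Q (Q w) = w - P (P w)" for w using D(7)[of w] by (simp add: algebra_simps)
  have range': "\<exists>z. A' (P y) = Some z \<and> norm z = norm (Q y)" if y: "y \<in> range P" for y
  proof -
    obtain w where w: "y = P w" using y by blast
    obtain z where z: "A' (P y) = Some z" "A z = Some (Q (Q w))"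
      using fwd'[OF QQ[of w]] w by blast
    have "inner (Q (Q w)) (P y) = inner z z" by (rule adj[OF z])
    moreover have "inner (Q (Q w)) (P y) = inner (Q y) (Q y)"
    proof -
      have e: "Q (P (P w)) = P (Q (P w))" by (rule D(6)[symmetric])
      show ?thesis
        by (simp only: w D(11)[of "Q w" "P (P w)"] e D(10)[of "Q w" "Q (P w)", symmetric] D(6)[of w])
    qed
    ultimately have "norm z = norm (Q y)" by (simp add: norm_eq_sqrt_inner)
    with z show ?thesis by blast
  qed
  have range'_le: "\<exists>z. A' (P y) = Some z \<and> norm z \<le> norm (Q y)" if "y \<in> range P" for y
    using range'[OF that] by auto
  obtain Z' where Z': "bounded_linear Z'" "\<And>y. A' (P y) = Some (Z' y)"
    by (rule closed_operator_bound[OF cl' D(8,9,12) linear_subspace_image[OF P.linear_axioms subspace_UNIV]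
          range'_le]) (assumption, (rule that; assumption))
  interpret Z': bounded_linear Z' by (rule Z')
  have norm': "norm (Z' y) = norm (Q y)" for y
    by (rule continuous_eq_on_dense[OF D(12)])
      (use range' Z'(2) in \<open>auto intro!: continuous_intros Z'.continuous_on Q.continuous_on\<close>)
  have resolvent: "A (P (P x)) = Some (P (P a))" if x: "A x = Some a" for x a
  proof -
    obtain b where b: "A (P (P x)) = Some b" "A' b = Some (Q (Q x))" using fwd[OF QQ] by blast
    have "A (Q (Q x)) = Some (a - b)"
      unfolding QQ_eq by (rule linear_operator_diff[OF lin x b(1)])
    then have "(A \<circ>\<^sub>m A') b = Some (a - b)" using b(2) by (simp add: map_comp_Some_iff)
    then obtain w where "b = P (P w)" "a - b = Q (Q w)" unfolding comm iff by blast
    then show ?thesis using b(1) by (simp add: QQ_eq algebra_simps)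
  qed
  have resolvent': "A' (P (P x)) = Some (P (P a))" if x: "A' x = Some a" for x a
  proof -
    obtain b where b: "A' (P (P x)) = Some b" "A b = Some (Q (Q x))" using fwd'[OF QQ] by blast
    have "A' (Q (Q x)) = Some (a - b)"
      unfolding QQ_eq by (rule linear_operator_diff[OF lin' x b(1)])
    then have "(A' \<circ>\<^sub>m A) b = Some (a - b)" using b(2) by (simp add: map_comp_Some_iff)
    then obtain w where "b = P (P w)" "a - b = Q (Q w)" unfolding iff by blast
    then show ?thesis using b(1) by (simp add: QQ_eq algebra_simps)
  qed
  show ?thesis
    by (rule that[OF PQ iff Z Z' norm' resolvent resolvent'])
qed


section \<open>Fuglede's theorem for normal operators\<close>

text \<open>The spectral projections \<open>E\<close> of \<open>(1 + A\<^sup>* A)\<inverse>\<close> for \<open>[c, \<infinity>)\<close> reduce \<open>A\<close> to bounded normal operators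
  \<open>N = A E\<close>, which commute with \<open>E B E\<close>. The bounded theorem shows that \<open>E B E\<close> commutes with \<open>N\<^sup>* = A\<^sup>* E\<close>.
  As \<open>c\<close> tends to \<open>0\<close>, the projections converge strongly to the identity, and the weak form
  \<open>\<langle>A y, B x\<rangle> = \<langle>y, B A\<^sup>* x\<rangle>\<close> of the claim is obtained in the limit.\<close>

theorem fuglede:
  fixes A :: "'a::complex_hilbert operator" and B :: "'a \<Rightarrow> 'a"
  assumes A: "normal_operator A" and B: "bounded_linear B" "complex_homogeneous B"
    and comm: "\<And>x a. A x = Some a \<Longrightarrow> A (B x) = Some (B a)"
    and x: "operator_adjoint A x = Some a"
  shows "operator_adjoint A (B x) = Some (B a)"
proof -
  define A' where "A' = operator_adjoint A"
  note x = x[folded A'_def]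
  obtain P Q Z Z' where PQ: "circle_pair P Q" and iff: "\<And>x a. (A' \<circ>\<^sub>m A) x = Some a \<longleftrightarrow> (\<exists>w. x = P (P w) \<and> a = Q (Q w))"
    and Z: "\<And>y. A (P y) = Some (Z y)" "\<And>y. norm (Z y) = norm (Q y)"
    and Z': "\<And>y. A' (P y) = Some (Z' y)" "\<And>y. norm (Z' y) = norm (Q y)"
    and resolvent: "\<And>x a. A x = Some a \<Longrightarrow> A (P (P x)) = Some (P (P a))"
    "\<And>x a. A' x = Some a \<Longrightarrow> A' (P (P x)) = Some (P (P a))"
    by (rule normal_operator_structure[OF A, folded A'_def]) (rule that; assumption)
  have A1: "densely_defined A" "closed_operator A" and A'A: "A \<circ>\<^sub>m A' = A' \<circ>\<^sub>m A"
    using A by (simp_all add: normal_operator_def A'_def)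
  have lin: "linear_operator A" by (rule densely_definedD[OF A1(1)])
  have lin': "linear_operator A'" unfolding A'_def by (rule linear_operator_adjoint[OF A1(1)])
  have cl': "closed_operator A'" unfolding A'_def by (rule closed_operator_adjoint[OF A1(1)])
  note adj = operator_adjointD[OF A1(1), folded A'_def]
  note D = circle_pairD[OF PQ]
  interpret P: bounded_linear P by (rule D)
  interpret Q: bounded_linear Q by (rule D)
  interpret B: bounded_linear B by (rule B)
  define R where "R = (\<lambda>x. P (P x))"
  have R: "positive_map R" unfolding R_def by (rule positive_map_comp[OF D(1) D(1) refl])
  note RD = positive_mapD[OF R]
  interpret R: bounded_linear R by (rule RD)
  have injR: "inj R" unfolding R_def using D(5) by (simp add: inj_def)
  have denseR: "closure (range R) = UNIV" by (rule dense_range_positive_map[OF R injR])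
  have subR: "subspace (range R)" by (rule linear_subspace_image[OF R.linear_axioms subspace_UNIV])
  have Rnorm: "(norm (R w))\<^sup>2 \<le> inner (R w) w" for w
  proof -
    have "(norm v)\<^sup>2 = (norm (P v))\<^sup>2 + (norm (Q v))\<^sup>2" for v
    proof -
      have "inner v v = inner (P (P v) + Q (Q v)) v" by (simp only: D(7))
      then show ?thesis by (simp only: power2_norm_eq_inner inner_add_left D(10)[of "P v"] D(11)[of "Q v"])
    qed
    then have "(norm (P (P w)))\<^sup>2 \<le> (norm (P w))\<^sup>2" by (metis le_add_same_cancel1 zero_le_power2)
    also have "\<dots> = inner (P (P w)) w" by (simp only: power2_norm_eq_inner D(10)[of "P w"])
    finally show ?thesis by (simp only: R_def)
  qed
  have cutoff: "\<exists>E. (\<forall>x. norm (E x) \<le> norm x) \<and> linear E \<and> (\<forall>z. (norm (R z - E (R z)))\<^sup>2 \<le> c * (norm z)\<^sup>2) \<and>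
      (\<forall>x a y b. A' x = Some a \<longrightarrow> A y = Some b \<longrightarrow> inner (E b) (B (E x)) = inner (E y) (B (E a)))"
    if c: "0 < c" for c
  proof -
    obtain E where E: "bounded_linear E" "\<And>x. E (E x) = E x" "\<And>x y. inner (E x) y = inner x (E y)"
      "\<And>x. norm (E x) \<le> norm x"
      and low: "\<And>x. c * (norm (E x))\<^sup>2 \<le> inner (R (E x)) (E x)"
      and high: "\<And>x. inner (R (x - E x)) (x - E x) \<le> c * (norm (x - E x))\<^sup>2"
      and inv: "\<And>M. closed M \<Longrightarrow> subspace M \<Longrightarrow> \<forall>(x, y)\<in>M. (R x, R y) \<in> M \<Longrightarrow> \<forall>(x, y)\<in>M. (E x, E y) \<in> M"
      by (rule spectral_cutoff[OF R, of c]) (rule that; assumption)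
    interpret E: bounded_linear E by (rule E(1))
    have E_comm: "E (S x) = S (E x)" if S: "bounded_linear S" "\<And>x. R (S x) = S (R x)" for S x
    proof -
      have "\<forall>(x, y)\<in>{p. snd p = S (fst p)}. (E x, E y) \<in> {p. snd p = S (fst p)}"
        by (rule inv[OF closed_graph_map[OF S(1)]]) (auto simp: S(2))
      then show ?thesis by simp
    qed
    have ER: "E (R x) = R (E x)" for x by (rule E_comm[OF RD(1) refl])
    have E_hom: "E (d *\<^sub>C x) = d *\<^sub>C E x" for d x
      by (rule E_comm[OF bounded_linear_scaleC]) (simp add: R_def D(3))
    have EA: "A (E x) = Some (E a)" if "A x = Some a" for x a
    proof -
      have "\<forall>(x, y)\<in>Map.graph A. (E x, E y) \<in> Map.graph A"
        by (rule inv[OF graph_closed_subspace[OF A1(2)]]) (use resolvent(1) in \<open>auto simp: Map.graph_def R_def\<close>)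
      with that show ?thesis by (auto simp: Map.graph_def)
    qed
    have EA': "A' (E x) = Some (E a)" if "A' x = Some a" for x a
    proof -
      have "\<forall>(x, y)\<in>Map.graph A'. (E x, E y) \<in> Map.graph A'"
        by (rule inv[OF graph_closed_subspace[OF cl']]) (use resolvent(2) in \<open>auto simp: Map.graph_def R_def\<close>)
      with that show ?thesis by (auto simp: Map.graph_def)
    qed
    \<comment> \<open>On the range of \<open>E\<close> the operator \<open>R = (1 + A\<^sup>* A)\<inverse>\<close> is bounded below by \<open>c\<close>.\<close>
    have QPE: "norm (Q (P (E z))) \<le> norm ((1 / sqrt c) *\<^sub>R R z)" for z
    proof (rule power2_le_imp_le)
      let ?v = "E z"
      have "c * norm ?v * norm ?v \<le> norm (R ?v) * norm ?v"
        using order_trans[OF low norm_cauchy_schwarz, of z] by (simp only: power2_eq_square ac_simps)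
      then have v: "c * norm ?v \<le> norm (R ?v)" by (cases "?v = 0") auto
      have "(norm (Q (P ?v)))\<^sup>2 = inner (Q (Q ?v)) (R ?v)"
      proof -
        have "inner (Q (P ?v)) (Q (P ?v)) = inner (Q ?v) (P (Q (P ?v)))"
          by (simp only: D(6)[of ?v, symmetric] D(10))
        also have "P (Q (P ?v)) = Q (R ?v)" by (simp only: R_def D(6))
        finally show ?thesis by (simp only: power2_norm_eq_inner D(11)[of "Q ?v"])
      qed
      also have "Q (Q ?v) = ?v - R ?v"
        using D(7)[of ?v] by (simp only: R_def eq_diff_eq add.commute)
      also have "inner (?v - R ?v) (R ?v) \<le> inner ?v (R ?v)" by (simp add: inner_diff_left)
      also have "\<dots> \<le> norm ?v * norm (R ?v)" by (rule norm_cauchy_schwarz)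
      also have "\<dots> \<le> (norm (R ?v) / c) * norm (R ?v)"
        by (rule mult_right_mono) (use v c in \<open>simp_all add: field_simps\<close>)
      also have "\<dots> = (norm (R ?v))\<^sup>2 / c" by (simp add: power2_eq_square)
      also have "\<dots> \<le> (norm (R z))\<^sup>2 / c"
        by (intro divide_right_mono power_mono) (use E(4)[of "R z"] ER c in auto)
      also have "\<dots> = (norm ((1 / sqrt c) *\<^sub>R R z))\<^sup>2" using c by (simp add: power_divide)
      finally show "(norm (Q (P ?v)))\<^sup>2 \<le> (norm ((1 / sqrt c) *\<^sub>R R z))\<^sup>2" .
    qed simp
    have bl: "bounded_linear (\<lambda>x. (1 / sqrt c) *\<^sub>R x)"
      by (intro bounded_linear_const_scaleR bounded_linear_ident)
    have bound: "\<exists>z. A (E y) = Some z \<and> norm z \<le> norm ((1 / sqrt c) *\<^sub>R y)" if y: "y \<in> range R" for y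
    proof -
      obtain z where z: "y = R z" using y by blast
      have "A (E y) = Some (Z (P (E z)))" unfolding z ER unfolding R_def by (rule Z(1))
      then show ?thesis using QPE[of z] by (simp add: Z(2) z)
    qed
    have bound': "\<exists>z. A' (E y) = Some z \<and> norm z \<le> norm ((1 / sqrt c) *\<^sub>R y)" if y: "y \<in> range R" for y
    proof -
      obtain z where z: "y = R z" using y by blast
      have "A' (E y) = Some (Z' (P (E z)))" unfolding z ER unfolding R_def by (rule Z'(1))
      then show ?thesis using QPE[of z] by (simp add: Z'(2) z)
    qed
    obtain N where N: "bounded_linear N" "\<And>y. A (E y) = Some (N y)"
      and Nle: "\<And>y. norm (N y) \<le> norm ((1 / sqrt c) *\<^sub>R y)"
      by (rule closed_operator_bound[OF A1(2) E(1) bl denseR subR bound]) (assumption, (rule that; assumption))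
    obtain N' where N': "bounded_linear N'" "\<And>y. A' (E y) = Some (N' y)"
      and N'le: "\<And>y. norm (N' y) \<le> norm ((1 / sqrt c) *\<^sub>R y)"
      by (rule closed_operator_bound[OF cl' E(1) bl denseR subR bound']) (assumption, (rule that; assumption))
    interpret N: bounded_linear N by (rule N)
    interpret N': bounded_linear N' by (rule N')
    have EN: "E (N y) = N y" "N (E y) = N y" for y
      using EA[OF N(2), of y] N(2)[of y] N(2)[of "E y"] by (simp_all add: E(2))
    have EN': "E (N' y) = N' y" "N' (E y) = N' y" for y
      using EA'[OF N'(2), of y] N'(2)[of y] N'(2)[of "E y"] by (simp_all add: E(2))
    have NA: "N y = b" if "A (E y) = Some b" for y b using N(2)[of y] that by simp
    have NA': "N' y = b" if "A' (E y) = Some b" for y b using N'(2)[of y] that by simp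
    have N_adj: "inner (N u) v = inner u (N' v)" for u v
      using adj[OF N'(2)[of v] N(2)[of u]] EN(1)[of u] EN'(1)[of v] E(3)[of "N u" v] E(3)[of u "N' v"]
      by simp
    have NN: "N (N' y) = N' (N y)" for y
    proof (rule continuous_eq_on_dense[where f = "\<lambda>y. N (N' y)" and g = "\<lambda>y. N' (N y)", OF denseR])
      fix y assume "y \<in> range R"
      then obtain z where z: "y = R z" by blast
      have AA: "(A' \<circ>\<^sub>m A) (E y) = Some (Q (Q (E z)))" unfolding iff
        by (intro exI[of _ "E z"]) (simp only: z ER, simp only: R_def)
      then have "A' (N y) = Some (Q (Q (E z)))" by (simp add: map_comp_Some_iff N(2))
      moreover have "A (N' y) = Some (Q (Q (E z)))"
        using AA unfolding A'A[symmetric] by (simp add: map_comp_Some_iff N'(2))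
      ultimately show "N (N' y) = N' (N y)"
        using N(2)[of "N' y"] N'(2)[of "N y"] by (simp add: EN EN')
    qed (intro N.continuous_on N'.continuous_on continuous_on_id)+
    have N_hom: "N (d *\<^sub>C y) = d *\<^sub>C N y" "N' (d *\<^sub>C y) = d *\<^sub>C N' y" for d y
      using linear_operator_scaleC[OF lin N(2), of d y] linear_operator_scaleC[OF lin' N'(2), of d y]
      by (auto intro!: NA NA' simp: E_hom)
    interpret NN: bounded_normal N N' "1 / sqrt c"
      using N N' N_hom N_adj NN Nle N'le c by unfold_locales simp_all
    define X where "X = (\<lambda>y. E (B (E y)))"
    have "NN.commuting X"
      unfolding NN.commuting_def complex_homogeneous_def
    proof (intro conjI allI)
      show "bounded_linear X" unfolding X_def
        by (intro bounded_linear_compose[OF E(1)] bounded_linear_compose[OF B(1)] E(1))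
      show "X (d *\<^sub>C y) = d *\<^sub>C X y" for d y
        using B(2) by (simp add: X_def E_hom complex_homogeneous_def)
      show "X (N y) = N (X y)" for y
      proof (rule NA[symmetric])
        have "A (E (B (E y))) = Some (E (B (N y)))" by (intro EA comm N)
        then show "A (E (X y)) = Some (X (N y))" by (simp add: X_def E(2) EN)
      qed
    qed
    then have XN': "X (N' y) = N' (X y)" for y by (rule NN.fuglede_bounded)
    have "inner (E b) (B (E x)) = inner (E y) (B (E a))" if "A' x = Some a" "A y = Some b" for x a y b
    proof -
      have "N' x = E a" "N y = E b" using EA'[OF that(1)] EA[OF that(2)] by (auto intro: NA NA')
      then have "inner (E b) (B (E x)) = inner (N y) (X x)"
        by (simp add: X_def E(2) flip: E(3))
      also have "\<dots> = inner y (X (N' x))" by (simp only: N_adj XN')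
      also have "\<dots> = inner (E y) (B (E a))"
        using \<open>N' x = E a\<close> by (simp add: X_def E(2) E(3))
      finally show ?thesis .
    qed
    moreover have "(norm (R z - E (R z)))\<^sup>2 \<le> c * (norm z)\<^sup>2" for z
    proof -
      have "(norm (R (z - E z)))\<^sup>2 \<le> c * (norm (z - E z))\<^sup>2" by (rule order_trans[OF Rnorm high])
      also have "\<dots> \<le> c * (norm z)\<^sup>2"
      proof (intro mult_left_mono)
        have "inner (E z) (E z) = inner (E z) z" by (simp only: E(3)[of z] E(2))
        then have "inner (z - E z) (z - E z) = inner z z - inner (E z) (E z)"
          by (simp add: inner_diff_left inner_diff_right inner_commute)
        then show "(norm (z - E z))\<^sup>2 \<le> (norm z)\<^sup>2" by (simp add: power2_norm_eq_inner)
      qed (use c in simp)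
      finally show ?thesis by (simp add: R.diff ER)
    qed
    ultimately show ?thesis using E(4) E.linear_axioms by blast
  qed
  have "\<forall>n. \<exists>E. (\<forall>x. norm (E x) \<le> norm x) \<and> linear E \<and>
      (\<forall>z. (norm (R z - E (R z)))\<^sup>2 \<le> inverse (real (Suc n)) * (norm z)\<^sup>2) \<and>
      (\<forall>x a y b. A' x = Some a \<longrightarrow> A y = Some b \<longrightarrow> inner (E b) (B (E x)) = inner (E y) (B (E a)))"
    by (intro allI cutoff) simp
  then obtain E where E: "\<And>n x. norm (E n x) \<le> norm x" "\<And>n. linear (E n)"
    and ER: "\<And>n z. (norm (R z - E n (R z)))\<^sup>2 \<le> inverse (real (Suc n)) * (norm z)\<^sup>2"
    and EB: "\<And>n x a y b. A' x = Some a \<Longrightarrow> A y = Some b \<Longrightarrow> inner (E n b) (B (E n x)) = inner (E n y) (B (E n a))"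
    by metis
  have lim: "(\<lambda>n. E n y) \<longlonglongrightarrow> y" for y
  proof (rule LIMSEQ_I)
    fix r :: real assume "0 < r"
    then have r: "0 < r / 3" by simp
    have "y \<in> closure (range R)" by (simp add: denseR)
    then obtain z where z: "norm (R z - y) < r / 3"
      using r unfolding closure_approachable dist_norm by blast
    have "(\<lambda>n. inverse (real (Suc n)) * (norm z)\<^sup>2) \<longlonglongrightarrow> 0"
      by (rule tendsto_mult_left_zero[OF LIMSEQ_inverse_real_of_nat])
    from LIMSEQ_D[OF this, of "(r / 3)\<^sup>2"] obtain n0
      where n0: "\<And>n. n \<ge> n0 \<Longrightarrow> inverse (real (Suc n)) * (norm z)\<^sup>2 < (r / 3)\<^sup>2" using r by auto
    have "norm (E n y - y) < r" if "n \<ge> n0" for n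
    proof -
      have "(norm (R z - E n (R z)))\<^sup>2 < (r / 3)\<^sup>2" using ER n0[OF that] by (rule le_less_trans)
      then have 1: "norm (R z - E n (R z)) < r / 3" by (rule power_less_imp_less_base) (use r in simp)
      have 2: "norm (E n (R z) - E n y) < r / 3"
        using E(1)[of n "R z - y"] z by (simp add: linear_diff[OF E(2)])
      have "E n y - y = (R z - y) - (R z - E n (R z)) - (E n (R z) - E n y)" by simp
      also have "norm \<dots> \<le> norm (R z - y) + norm (R z - E n (R z)) + norm (E n (R z) - E n y)"
        by (intro norm_triangle_le_diff add_mono order_refl norm_triangle_ineq4)
      finally show ?thesis using z 1 2 by simp
    qed
    then show "\<exists>n0. \<forall>n\<ge>n0. norm (E n y - y) < r" by blast
  qed
  have "inner b (B x) = inner y (B a)" if y: "A y = Some b" for y b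
  proof (rule LIMSEQ_unique)
    show "(\<lambda>n. inner (E n b) (B (E n x))) \<longlonglongrightarrow> inner b (B x)"
      by (intro tendsto_inner B.tendsto lim)
    show "(\<lambda>n. inner (E n b) (B (E n x))) \<longlonglongrightarrow> inner y (B a)"
      unfolding EB[OF x y] by (intro tendsto_inner B.tendsto lim)
  qed
  then show ?thesis by (simp add: operator_adjoint_Some_iff[OF A1(1)])
qed

section \<open>Bounded summands\<close>

lemma positive_selfadjoint_total:
  fixes C :: "'a::complex_hilbert \<Rightarrow> 'a"
  assumes C: "positive_map C" and h: "complex_homogeneous C"
  shows "positive_selfadjoint (\<lambda>x. Some (C x))"
proof -
  interpret C: bounded_linear C by (rule positive_mapD[OF C])
  have lin: "linear_operator (\<lambda>x. Some (C x))"
    using h by (simp add: linear_operator_iff C.add C.zero complex_homogeneous_def)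
  have "dom (\<lambda>x. Some (C x)) = UNIV" by auto
  then have "densely_defined (\<lambda>x. Some (C x))" using lin by (simp add: densely_defined_def)
  moreover have "(\<forall>x. inner (C x) y = inner x z) \<longleftrightarrow> C y = z" for y z
    using positive_mapD(2)[OF C] by (metis inner_diff_right inner_eq_zero_iff right_minus_eq)
  ultimately show ?thesis
    using positive_mapD(3)[OF C] by (simp add: positive_selfadjoint_iff)
qed

lemma operator_add_total_Some_iff:
  "operator_add T (\<lambda>x. Some (f x)) x = Some a \<longleftrightarrow> T x = Some (a - f x)"
  by (cases "T x") (auto simp: operator_add_def dom_def)

lemma linear_operator_add_total:
  assumes T: "linear_operator T" and f: "bounded_linear f" "complex_homogeneous f"
  shows "linear_operator (operator_add T (\<lambda>x. Some (f x)))"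
proof -
  interpret f: bounded_linear f by (rule f)
  show ?thesis
    unfolding linear_operator_iff operator_add_total_Some_iff
    using linear_operatorD[OF T] f(2)
    by (auto simp: f.add f.zero add_diff_add complex_homogeneous_def
        simp flip: complex_vector.scale_right_diff_distrib)
qed

lemma dom_operator_add_total: "dom (operator_add T (\<lambda>x. Some (f x))) = dom T"
  by (auto simp: operator_add_def dom_def)

lemma densely_defined_add_total:
  assumes "densely_defined T" "bounded_linear f" "complex_homogeneous f"
  shows "densely_defined (operator_add T (\<lambda>x. Some (f x)))"
  using assms by (simp add: densely_defined_def dom_operator_add_total linear_operator_add_total)

lemma closed_operator_add_total:
  assumes T: "closed_operator T" and f: "bounded_linear f" "complex_homogeneous f"
  shows "closed_operator (operator_add T (\<lambda>x. Some (f x)))"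
proof -
  interpret f: bounded_linear f by (rule f)
  have lin: "linear_operator T" and cl: "closed (Map.graph T)"
    using T by (simp_all add: closed_operator_def)
  have "Map.graph (operator_add T (\<lambda>x. Some (f x))) = (\<lambda>p. (fst p, snd p - f (fst p))) -` Map.graph T"
    by (auto simp: Map.graph_def operator_add_total_Some_iff)
  also have "closed \<dots>"
    by (intro closed_vimage[OF cl] continuous_intros f.continuous_on)
  finally show ?thesis
    by (simp add: closed_operator_def linear_operator_add_total[OF lin f])
qed

lemma positive_selfadjoint_add_total:
  fixes C :: "'a::complex_hilbert \<Rightarrow> 'a"
  assumes T: "positive_selfadjoint T" and C: "positive_map C" and h: "complex_homogeneous C"
  shows "positive_selfadjoint (operator_add T (\<lambda>x. Some (C x)))"
proof -
  note CD = positive_mapD[OF C]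
  have dense: "densely_defined (operator_add T (\<lambda>x. Some (C x)))"
    by (rule densely_defined_add_total[OF positive_selfadjointD(1)[OF T] CD(1) h])
  have "T y = Some (z - C y) \<longleftrightarrow>
      (\<forall>x a. T x = Some (a - C x) \<longrightarrow> inner a y = inner x z)" for y z
  proof
    assume y: "T y = Some (z - C y)"
    have "inner (a - C x) y = inner x (z - C y)" if "T x = Some (a - C x)" for x a
      by (rule positive_selfadjointD(4)[OF T that y])
    then show "\<forall>x a. T x = Some (a - C x) \<longrightarrow> inner a y = inner x z"
      by (simp add: inner_diff_left inner_diff_right CD(2))
  next
    assume h: "\<forall>x a. T x = Some (a - C x) \<longrightarrow> inner a y = inner x z"
    show "T y = Some (z - C y)"
    proof (rule positive_selfadjointD(6)[OF T])
      fix x a assume "T x = Some a"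
      then have "inner (a + C x) y = inner x z" using h by simp
      then show "inner a y = inner x (z - C y)"
        by (simp add: inner_add_left inner_diff_right CD(2))
    qed
  qed
  moreover have "0 \<le> inner a x" if "T x = Some (a - C x)" for x a
    using positive_selfadjointD(5)[OF T that] CD(3)[of x] by (simp add: inner_diff_left)
  ultimately show ?thesis
    unfolding positive_selfadjoint_iff operator_add_total_Some_iff using dense by blast
qed

section \<open>The triangle inequality\<close>

text \<open>An everywhere defined hyponormal operator has an everywhere defined adjoint by definition,
  and the norm estimate makes the adjoint bounded.\<close>

lemma bounded_hyponormal_structure:
  fixes B :: "'a::complex_hilbert operator"
  assumes B: "bounded_operator B" and hyp: "hyponormal_operator B"
  obtains b b' where "B = (\<lambda>x. Some (b x))" "bounded_linear b" "complex_homogeneous b"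
    "bounded_linear b'" "complex_homogeneous b'" "\<And>x. operator_adjoint B x = Some (b' x)"
    "\<And>x y. inner (b x) y = inner x (b' y)" "\<And>x. norm (b' x) \<le> norm (b x)"
proof -
  have lin: "linear_operator B" and dom: "dom B = UNIV"
    using B by (simp_all add: bounded_operator_def)
  have dense: "densely_defined B" and sub: "dom B \<subseteq> dom (operator_adjoint B)"
    and le: "\<And>x. x \<in> dom B \<Longrightarrow> norm (the (operator_adjoint B x)) \<le> norm (the (B x))"
    using hyp by (simp_all add: hyponormal_operator_def)
  have lin': "linear_operator (operator_adjoint B)" by (rule linear_operator_adjoint[OF dense])
  define b b' where "b = (\<lambda>x. the (B x))" and "b' = (\<lambda>x. the (operator_adjoint B x))"
  have "x \<in> dom B" "x \<in> dom (operator_adjoint B)" for x using dom sub by auto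
  then have bS: "B x = Some (b x)" and bS': "operator_adjoint B x = Some (b' x)" for x
    by (auto simp: b_def b'_def dom_def)
  obtain K where K: "\<And>x. norm (b x) \<le> K * norm x"
    using B by (auto simp: bounded_operator_def b_def)
  have le': "norm (b' x) \<le> norm (b x)" for x using le dom by (simp add: b_def b'_def)
  have lin_map: "bounded_linear f \<and> complex_homogeneous f"
    if L: "linear_operator L" and f: "\<And>x. L x = Some (f x)" and K: "\<And>x. norm (f x) \<le> K * norm x"
    for L :: "'a operator" and f
  proof
    show "bounded_linear f"
    proof (rule bounded_linear_intro)
      show "f (x + y) = f x + f y" for x y using linear_operator_add[OF L f f, of x y] by (simp add: f)
      show "f (r *\<^sub>R x) = r *\<^sub>R f x" for r x using linear_operator_scaleR[OF L f, of r x] by (simp add: f)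
      show "norm (f x) \<le> norm x * K" for x using K[of x] by (simp add: mult.commute)
    qed
    show "complex_homogeneous f"
      unfolding complex_homogeneous_def using linear_operator_scaleC[OF L f] by (simp add: f)
  qed
  show ?thesis
  proof (rule that)
    show "B = (\<lambda>x. Some (b x))" using bS by blast
    show "bounded_linear b" "complex_homogeneous b" using lin_map[OF lin bS K] by auto
    show "bounded_linear b'" "complex_homogeneous b'"
      using lin_map[OF lin' bS' order_trans[OF le' K]] by auto
    show "operator_adjoint B x = Some (b' x)" for x by (rule bS')
    show "inner (b x) y = inner x (b' y)" for x y by (rule operator_adjointD[OF dense bS' bS])
    show "norm (b' x) \<le> norm (b x)" for x by (rule le')
  qed
qed

text \<open>\<open>C\<close> is the bounded root of \<open>b\<^sup>* b\<close>. The last property gathers what commutes with it.\<close>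

lemma operator_abs_total:
  fixes b :: "'a::complex_hilbert \<Rightarrow> 'a"
  assumes b: "bounded_linear b" "complex_homogeneous b" and b': "bounded_linear b'" "complex_homogeneous b'"
    and adj: "\<And>x. operator_adjoint (\<lambda>x. Some (b x)) x = Some (b' x)"
    and sym: "\<And>x y. inner (b x) y = inner x (b' y)"
  obtains C where "operator_abs (\<lambda>x. Some (b x)) = (\<lambda>x. Some (C x))" "positive_map C"
    "complex_homogeneous C" "\<And>x. norm (C x) = norm (b x)"
    "\<And>S x. bounded_linear S \<Longrightarrow> \<forall>x. S (b x) = b (S x) \<Longrightarrow> \<forall>x. S (b' x) = b' (S x) \<Longrightarrow> C (S x) = S (C x)"
proof -
  define T where "T = (\<lambda>x. b' (b x))"
  have Tsym: "inner (T x) y = inner x (T y)" for x y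
  proof -
    have "inner (T x) y = inner (b x) (b y)" unfolding T_def by (metis sym inner_commute)
    then show ?thesis by (simp add: sym T_def)
  qed
  have "0 \<le> inner (T x) x" for x
    using inner_ge_zero[of "b x"] unfolding T_def sym by (simp only: inner_commute)
  then have T: "positive_map T"
    unfolding positive_map_def using Tsym bounded_linear_compose[OF b'(1) b(1)] by (simp add: T_def)
  have Th: "complex_homogeneous T" using b(2) b'(2) by (simp add: complex_homogeneous_def T_def)
  define C where "C = positive_root T"
  have C: "positive_map C" "\<And>x. C (C x) = T x"
    unfolding C_def using positive_map_root[OF T] positive_root_square[OF T] by simp_all
  have Ch: "complex_homogeneous C" unfolding C_def by (rule complex_homogeneous_root[OF T Th])
  have "operator_adjoint (\<lambda>x. Some (b x)) \<circ>\<^sub>m (\<lambda>x. Some (b x)) = (\<lambda>x. Some (T x))"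
    by (rule ext) (simp add: map_comp_def adj T_def)
  then have "operator_abs (\<lambda>x. Some (b x)) = operator_sqrt (\<lambda>x. Some (T x))"
    by (simp add: operator_abs_def)
  also have "\<dots> = (\<lambda>x. Some (C x))"
    by (rule operator_sqrt_eqI[OF positive_selfadjoint_total[OF T Th] positive_selfadjoint_total[OF C(1) Ch]])
      (simp add: map_comp_def C(2))
  finally have abs: "operator_abs (\<lambda>x. Some (b x)) = (\<lambda>x. Some (C x))" .
  have norm: "norm (C x) = norm (b x)" for x
  proof -
    have "inner (C x) (C x) = inner x (T x)" by (simp only: positive_mapD(2)[OF C(1), of x "C x"] C(2))
    also have "\<dots> = inner (b x) (b x)" by (simp only: T_def sym)
    finally show ?thesis by (simp add: norm_eq_sqrt_inner)
  qed
  have comm: "C (S x) = S (C x)" if "bounded_linear S" "\<forall>x. S (b x) = b (S x)" "\<forall>x. S (b' x) = b' (S x)" for S x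
    unfolding C_def by (rule positive_root_commute[OF T that(1)]) (simp add: T_def that)
  show ?thesis by (rule that[OF abs C(1) Ch norm comm])
qed

lemma adjoint_commute:
  fixes b b' P :: "'a::real_inner \<Rightarrow> 'a"
  assumes "\<And>x y. inner (b x) y = inner x (b' y)" "\<And>x y. inner (P x) y = inner x (P y)"
    "\<And>x. P (b x) = b (P x)"
  shows "P (b' x) = b' (P x)"
proof -
  have "inner y (P (b' x)) = inner y (b' (P x))" for y
    by (simp add: assms(3) flip: assms(1,2))
  then show ?thesis by (metis inner_diff_right inner_eq_zero_iff right_minus_eq)
qed

theorem theorem3p1:
  fixes A B :: "'a::complex_hilbert operator"
  assumes "normal_operator A"
    and "bounded_operator B"
    and "hyponormal_operator B"
    and "B \<circ>\<^sub>m A \<subseteq>\<^sub>m A \<circ>\<^sub>m B"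
  shows "operator_le (operator_abs (operator_add A B))
    (operator_add (operator_abs A) (operator_abs B))"
proof -
  obtain b b' where B: "B = (\<lambda>x. Some (b x))" and b: "bounded_linear b" "complex_homogeneous b"
    and b': "bounded_linear b'" "complex_homogeneous b'" and adjB: "\<And>x. operator_adjoint B x = Some (b' x)"
    and b_adj: "\<And>x y. inner (b x) y = inner x (b' y)" and hyp: "\<And>x. norm (b' x) \<le> norm (b x)"
    by (rule bounded_hyponormal_structure[OF assms(2,3)]) (rule that; assumption)
  have A1: "densely_defined A" "closed_operator A"
    using assms(1) by (simp_all add: normal_operator_def)
  define A' where "A' = operator_adjoint A"
  obtain P Q Z Z' where PQ: "circle_pair P Q" and absA: "operator_abs A = quotient_operator P Q"
    and iff: "\<And>x a. (A' \<circ>\<^sub>m A) x = Some a \<longleftrightarrow> (\<exists>w. x = P (P w) \<and> a = Q (Q w))"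
    and Z: "bounded_linear Z" "\<And>y. A (P y) = Some (Z y)" "\<And>y. norm (Z y) = norm (Q y)"
    and Z': "bounded_linear Z'" "\<And>y. A' (P y) = Some (Z' y)" "\<And>y. norm (Z' y) = norm (Q y)"
    and resolvent: "\<And>x a. A x = Some a \<Longrightarrow> A (P (P x)) = Some (P (P a))"
    "\<And>x a. A' x = Some a \<Longrightarrow> A' (P (P x)) = Some (P (P a))"
    by (rule normal_operator_structure[OF assms(1), folded A'_def]) (rule that; assumption)
  note D = circle_pairD[OF PQ]
  interpret P: bounded_linear P by (rule D)
  interpret Q: bounded_linear Q by (rule D)
  interpret b: bounded_linear b by (rule b)
  interpret Z: bounded_linear Z by (rule Z)
  interpret Z': bounded_linear Z' by (rule Z')
  have cl': "closed_operator A'" unfolding A'_def by (rule closed_operator_adjoint[OF A1(1)])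
  note adj = operator_adjointD[OF A1(1), folded A'_def]

  \<comment> \<open>Commutation of \<open>b\<close> with \<open>A\<close>, \<open>A\<^sup>*\<close> and hence with all functions of \<open>A\<close> that occur.\<close>
  have bA: "A (b x) = Some (b a)" if "A x = Some a" for x a
  proof -
    have "(B \<circ>\<^sub>m A) x = Some (b a)" using that by (simp add: B map_comp_Some_iff)
    then have "(A \<circ>\<^sub>m B) x = Some (b a)" using assms(4) by (metis map_le_def domI)
    then show ?thesis by (simp add: B map_comp_def)
  qed
  have bA': "A' (b x) = Some (b a)" if "A' x = Some a" for x a
    unfolding A'_def by (rule fuglede[OF assms(1) b bA that[unfolded A'_def]])
  have bPP: "P (P (b w)) = b (P (P w))" for w
  proof -
    obtain p where p: "A (P (P w)) = Some p" "A' p = Some (Q (Q w))"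
      using iff[of "P (P w)" "Q (Q w)"] unfolding map_comp_Some_iff by blast
    have "(A' \<circ>\<^sub>m A) (b (P (P w))) = Some (b (Q (Q w)))"
      using bA[OF p(1)] bA'[OF p(2)] by (simp add: map_comp_Some_iff)
    then obtain v where v: "b (P (P w)) = P (P v)" "b (Q (Q w)) = Q (Q v)" unfolding iff by blast
    have "b (P (P w) + Q (Q w)) = P (P v) + Q (Q v)" by (simp only: b.add v)
    then have "b w = v" by (simp only: D(7))
    with v(1) show ?thesis by simp
  qed
  have Pb: "P (b x) = b (P x)" and Qb: "Q (b x) = b (Q x)" for x
    using circle_pair_commute[OF PQ b(1) bPP] by simp_all
  have Pb': "P (b' x) = b' (P x)" and Qb': "Q (b' x) = b' (Q x)" for x
    using adjoint_commute[of b b' P] adjoint_commute[of b b' Q] b_adj D(10,11) Pb Qb by blast+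
  have Zb: "Z (b x) = b (Z x)" and Zb': "Z' (b x) = b (Z' x)" for x
    using bA[OF Z(2)[of x]] Z(2)[of "b x"] bA'[OF Z'(2)[of x]] Z'(2)[of "b x"] by (simp_all add: Pb)
  have ZP: "Z (P x) = P (Z x)" for x
  proof -
    have "(P (P x), P (Z x)) \<in> Map.graph A"
      by (rule positive_map_invariant_square[OF D(1) graph_closed_subspace[OF A1(2)]])
        (use resolvent(1) Z(2) in \<open>auto simp: Map.graph_def\<close>)
    then show ?thesis using Z(2)[of "P x"] by (simp add: Map.graph_def)
  qed
  have ZP': "Z' (P x) = P (Z' x)" for x
  proof -
    have "(P (P x), P (Z' x)) \<in> Map.graph A'"
      by (rule positive_map_invariant_square[OF D(1) graph_closed_subspace[OF cl']])
        (use resolvent(2) Z'(2) in \<open>auto simp: Map.graph_def\<close>)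
    then show ?thesis using Z'(2)[of "P x"] by (simp add: Map.graph_def)
  qed
  have Z_adj: "inner (Z x) v = inner x (Z' v)" for x v
  proof (rule continuous_eq_on_dense[where f = "inner (Z x)" and g = "\<lambda>v. inner x (Z' v)", OF D(12)])
    fix v assume "v \<in> range P"
    then obtain w where w: "v = P w" by blast
    have "inner (Z x) (P w) = inner (P x) (Z' w)" by (rule adj[OF Z'(2) Z(2)])
    then show "inner (Z x) v = inner x (Z' v)" by (simp add: w D(10) ZP')
  qed (intro continuous_intros Z'.continuous_on)+
  obtain C where absB: "operator_abs B = (\<lambda>x. Some (C x))" and C: "positive_map C" "complex_homogeneous C"
    and Cnorm: "\<And>x. norm (C x) = norm (b x)"
    and Ccomm: "\<And>S x. bounded_linear S \<Longrightarrow> \<forall>x. S (b x) = b (S x) \<Longrightarrow> \<forall>x. S (b' x) = b' (S x) \<Longrightarrow> C (S x) = S (C x)"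
    by (rule operator_abs_total[OF b b' adjB[unfolded B] b_adj, folded B]) (rule that; assumption)
  have CP: "C (P x) = P (C x)" and CQ: "C (Q x) = Q (C x)" for x
    using Ccomm[OF D(8)] Ccomm[OF D(9)] Pb Pb' Qb Qb' by simp_all
  note CD = positive_mapD[OF C(1)]

  \<comment> \<open>The inequality \<open>Re \<langle>A x, B x\<rangle> \<le> \<langle>|A| x, |B| x\<rangle>\<close> for \<open>x = P y\<close>.\<close>
  define S where "S = (\<lambda>x. P (C (Q x)))"
  have S: "positive_map S"
    unfolding S_def
    by (rule positive_map_comp[OF D(1) positive_map_comp[OF C(1) D(2) CQ]]) (simp only: CP[symmetric] D(6))
  have Sh: "complex_homogeneous S"
    using C(2) by (simp add: S_def complex_homogeneous_def D(3,4))
  have Snorm: "norm (S x) = norm (b (P (Q x)))" for x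
    by (simp add: S_def Cnorm flip: CP)
  define M where "M = (\<lambda>x. (1/2) *\<^sub>R (P (b' (Z x)) + Z' (b (P x))))"
  have flip: "inner (P (b' (Z x))) y = inner x (Z' (b (P y)))" for x y
  proof -
    have "inner (P (b' (Z x))) y = inner (P y) (b' (Z x))"
      unfolding D(10)[of "b' (Z x)"] by (rule inner_commute)
    also have "\<dots> = inner (b (P y)) (Z x)" by (rule b_adj[symmetric])
    also have "\<dots> = inner x (Z' (b (P y)))" unfolding Z_adj[symmetric] by (rule inner_commute)
    finally show ?thesis .
  qed
  have "inner (M x) y = inner x (M y)" for x y
    using flip[of x y] flip[of y x] by (simp add: M_def inner_add_left inner_add_right inner_commute)
  moreover have "norm (M x) \<le> norm (S x)" for x
  proof -
    have "norm (P (b' (Z x))) \<le> norm (b (P (Z x)))" unfolding Pb' by (rule hyp)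
    also have "\<dots> = norm (S x)" by (simp add: Snorm D(6) Z(3) flip: ZP Zb Qb)
    finally have 1: "norm (P (b' (Z x))) \<le> norm (S x)" .
    have 2: "norm (Z' (b (P x))) = norm (S x)" by (simp add: Snorm Z'(3) Qb D(6))
    have "norm (P (b' (Z x)) + Z' (b (P x))) \<le> norm (S x) + norm (S x)"
      using 1 2 by (intro norm_triangle_le) simp
    then show ?thesis by (simp add: M_def)
  qed
  ultimately have "inner (M y) y \<le> inner (S y) y" for y
    by (intro form_le_of_norm_le[OF positive_selfadjoint_total[OF S Sh], of "\<lambda>x. Some (M x)"]) auto
  moreover have "inner (M y) y = inner (Z y) (b (P y))" for y
    using flip[of y y] Z_adj[of y "b (P y)"] inner_commute[of "Z' (b (P y))" y]
    by (simp add: M_def inner_add_left)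
  moreover have "inner (S y) y = inner (Q y) (C (P y))" for y
    by (simp only: S_def D(10) CD(2))
  ultimately have key: "inner (Z y) (b (P y)) \<le> inner (Q y) (C (P y))" for y by simp

  have AB: "densely_defined (operator_add A B)" "closed_operator (operator_add A B)"
    unfolding B by (rule densely_defined_add_total[OF A1(1) b], rule closed_operator_add_total[OF A1(2) b])
  obtain P2 Q2 Z2 where PQ2: "circle_pair P2 Q2" and abs2: "operator_abs (operator_add A B) = quotient_operator P2 Q2"
    and Z2: "\<And>y. operator_add A B (P2 y) = Some (Z2 y)" "\<And>y. norm (Z2 y) = norm (Q2 y)"
    and dom2: "dom (operator_add A B) = range P2"
    by (rule operator_abs_circle_pair[OF AB]) (rule that; assumption)
  show ?thesis
  proof (rule operator_le_of_norm_le)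
    show "positive_selfadjoint (operator_abs (operator_add A B))"
      unfolding abs2 by (rule positive_selfadjoint_quotient[OF PQ2])
    show "positive_selfadjoint (operator_add (operator_abs A) (operator_abs B))"
      unfolding absA absB by (rule positive_selfadjoint_add_total[OF positive_selfadjoint_quotient[OF PQ] C])
  next
    fix x a assume "operator_add (operator_abs A) (operator_abs B) x = Some a"
    then obtain y where y: "x = P y" "a = Q y + C (P y)"
      unfolding absA absB operator_add_total_Some_iff quotient_operator_Some_iff[OF D(5)]
      by (auto simp: algebra_simps)
    have ABx: "operator_add A B x = Some (Z y + b (P y))"
      unfolding B operator_add_total_Some_iff by (simp add: y(1) Z(2))
    then have "x \<in> range P2" unfolding dom2[symmetric] by blast
    then obtain w where w: "x = P2 w" by blast
    have "operator_abs (operator_add A B) x = Some (Q2 w)"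
      unfolding abs2 quotient_operator_Some_iff[OF circle_pairD(5)[OF PQ2]] using w by blast
    moreover have "norm (Q2 w) \<le> norm a"
    proof (rule power2_le_imp_le)
      have "Z2 w = Z y + b (P y)" using ABx Z2(1)[of w] by (simp add: w)
      then have "(norm (Q2 w))\<^sup>2 = (norm (Z y + b (P y)))\<^sup>2" by (simp flip: Z2(2))
      also have "\<dots> = (norm (Z y))\<^sup>2 + (norm (b (P y)))\<^sup>2 + 2 * inner (Z y) (b (P y))"
        by (simp add: power2_norm_eq_inner inner_add_left inner_add_right inner_commute)
      also have "\<dots> \<le> (norm (Q y))\<^sup>2 + (norm (C (P y)))\<^sup>2 + 2 * inner (Q y) (C (P y))"
        using key[of y] by (simp add: Z(3) Cnorm)
      also have "\<dots> = (norm a)\<^sup>2"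
        by (simp add: y(2) power2_norm_eq_inner inner_add_left inner_add_right inner_commute)
      finally show "(norm (Q2 w))\<^sup>2 \<le> (norm a)\<^sup>2" .
    qed simp
    ultimately show "\<exists>c. operator_abs (operator_add A B) x = Some c \<and> norm c \<le> norm a" by blast
  qed
qed

end
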